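(* There exist constants $\eta_0>0$ and $C_{\rm nrg}>0$, depending only on the potential $V$ (and the fixed choice of $\mu_0$), such that the following holds. Let $0<\varepsilon\le1$ and let $u_\varepsilon:\mathbb D^2\to\mathbb R^k$ be a solution of $-\Delta u_\varepsilon=-\varepsilon^{-2}\nabla V(u_\varepsilon)$ on $\mathbb D^2$. If $E_\varepsilon(u_\varepsilon,\mathbb D^2)\le\eta_0$, then there exists some $\sigma\in\Sigma$ such that $$|u_\varepsilon(x)-\sigma|\le\frac{\mu_0}{2}\quad\text{for every }x\in\mathbb D^2(\tfrac34),$$ and moreover $$E_\varepsilon\big(u_\varepsilon,\mathbb D^2(\tfrac58)\big)\le C_{\rm nrg}\,\varepsilon\,E_\varepsilon(u_\varepsilon,\mathbb D^2).$$
   Context: Let $k\ge 1$ and let $V:\mathbb R^k\to\mathbb R$ be smooth with $\inf V=0$ and satisfying: (1) $\Sigma:=\{y\in\mathbb R^k: V(y)=0\}=\{\sigma_1,\dots,\sigma_q\}$ is finite with $q\ge2$; (2) the Hessian $\nabla^2V(\sigma_i)$ is positive definite for every $i$, with smallest eigenvalue $\lambda_i^->0$ and largest eigenvalue $\lambda_i^+$; (3) there are constants $\alpha_\infty>0$, $R_\infty>0$ such that $y\cdot\nabla V(y)\ge\alpha_\infty|y|^2$ if $|y|>R_\infty$, and $V(y)\to+\infty$ as $|y|\to+\infty$. A sufficiently small constant $\mu_0>0$ (depending only on $V$) is fixed so that the balls $\mathbb B^k(\sigma_i,2\mu_0)$ are pairwise disjoint and $\frac12\lambda_i^-\mathrm{Id}\le\nabla^2V(y)\le2\lambda_i^+\mathrm{Id}$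 for all $i$ and all $y\in \mathbb B^k(\sigma_i,2\mu_0)$. $\mathbb D^2(r)$ is the open disc of $\mathbb R^2$ centered at $0$ with radius $r$, $\mathbb D^2=\mathbb D^2(1)$. For a domain $G$, $E_\varepsilon(u,G)=\int_G e_\varepsilon(u)\,dx$ with $e_\varepsilon(u)=\varepsilon\frac{|\nabla u|^2}{2}+\frac1\varepsilon V(u)$. Solutions are smooth maps satisfying the equation pointwise. *)

theory Defs
  imports "HOL-Analysis.Analysis"
begin

text \<open>
  Differentiability of order \<open>n\<close> on an open set \<open>S\<close>: derivatives are taken at points of the
  ambient space, so values of \<open>f\<close> outside of \<open>S\<close> are irrelevant.
\<close>

primrec Ck_on :: "nat \<Rightarrow> ('a::euclidean_space \<Rightarrow> 'b::real_normed_vector) \<Rightarrow> 'a set \<Rightarrow> bool" where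
  "Ck_on 0 f S \<longleftrightarrow> continuous_on S f"
| "Ck_on (Suc n) f S \<longleftrightarrow>
     (\<forall>x\<in>S. f differentiable (at x)) \<and>
     (\<forall>v. Ck_on n (\<lambda>x. frechet_derivative f (at x) v) S)"

definition smooth_on :: "'a set \<Rightarrow> ('a::euclidean_space \<Rightarrow> 'b::real_normed_vector) \<Rightarrow> bool" where
  "smooth_on S f \<longleftrightarrow> (\<forall>n. Ck_on n f S)"

definition grad :: "(real ^ 'n \<Rightarrow> real) \<Rightarrow> real ^ 'n \<Rightarrow> real ^ 'n" where
  "grad f x = (\<chi> i. frechet_derivative f (at x) (axis i 1))"

definition hessian :: "(real ^ 'n \<Rightarrow> real) \<Rightarrow> real ^ 'n \<Rightarrow> real ^ 'n ^ 'n" where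
  "hessian f x = matrix (frechet_derivative (grad f) (at x))"

definition laplacian :: "('a::euclidean_space \<Rightarrow> 'b::real_normed_vector) \<Rightarrow> 'a \<Rightarrow> 'b" where
  "laplacian u x =
     (\<Sum>b\<in>Basis. frechet_derivative (\<lambda>z. frechet_derivative u (at z) b) (at x) b)"

definition eigenvalues :: "real ^ 'n ^ 'n \<Rightarrow> real set" where
  "eigenvalues A = {l. \<exists>v. v \<noteq> 0 \<and> A *v v = l *\<^sub>R v}"

text \<open>
  The following two are meaningful for symmetric \<open>A\<close>, where the set of real eigenvalues is
  finite and nonempty.
\<close>

definition min_eigenvalue :: "real ^ 'n ^ 'n \<Rightarrow> real" where
  "min_eigenvalue A = Min (eigenvalues A)"

definition max_eigenvalue :: "real ^ 'n ^ 'n \<Rightarrow> real" where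
  "max_eigenvalue A = Max (eigenvalues A)"

definition positive_definite :: "real ^ 'n ^ 'n \<Rightarrow> bool" where
  "positive_definite A \<longleftrightarrow> transpose A = A \<and> (\<forall>v. v \<noteq> 0 \<longrightarrow> 0 < v \<bullet> (A *v v))"

definition loewner_le :: "real ^ 'n ^ 'n \<Rightarrow> real ^ 'n ^ 'n \<Rightarrow> bool" where
  "loewner_le A B \<longleftrightarrow> (\<forall>v. v \<bullet> (A *v v) \<le> v \<bullet> (B *v v))"

definition wells :: "(real ^ 'k \<Rightarrow> real) \<Rightarrow> (real ^ 'k) set" where
  "wells V = {y. V y = 0}"

definition multi_well_potential :: "(real ^ 'k \<Rightarrow> real) \<Rightarrow> bool" where
  "multi_well_potential V \<longleftrightarrow>
     smooth_on UNIV V \<and>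
     bdd_below (range V) \<and> (INF y. V y) = 0 \<and>
     finite (wells V) \<and> card (wells V) \<ge> 2 \<and>
     (\<forall>\<sigma>\<in>wells V. positive_definite (hessian V \<sigma>)) \<and>
     (\<exists>\<alpha>>0. \<exists>R>0. \<forall>y. norm y > R \<longrightarrow> y \<bullet> grad V y \<ge> \<alpha> * (norm y)\<^sup>2) \<and>
     filterlim V at_top at_infinity"

text \<open>Note that \<open>mat c\<close> is the scalar matrix with diagonal entry \<open>c\<close>.\<close>

definition admissible_radius :: "(real ^ 'k \<Rightarrow> real) \<Rightarrow> real \<Rightarrow> bool" where
  "admissible_radius V \<mu> \<longleftrightarrow>
     \<mu> > 0 \<and>
     disjoint_family_on (\<lambda>\<sigma>. ball \<sigma> (2 * \<mu>)) (wells V) \<and>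
     (\<forall>\<sigma>\<in>wells V. \<forall>y\<in>ball \<sigma> (2 * \<mu>).
        loewner_le (mat (1 / 2 * min_eigenvalue (hessian V \<sigma>))) (hessian V y) \<and>
        loewner_le (hessian V y) (mat (2 * max_eigenvalue (hessian V \<sigma>))))"

definition energy_density ::
  "(real ^ 'k \<Rightarrow> real) \<Rightarrow> real \<Rightarrow> (real ^ 2 \<Rightarrow> real ^ 'k) \<Rightarrow> real ^ 2 \<Rightarrow> real" where
  "energy_density V \<epsilon> u x =
     \<epsilon> * (\<Sum>b\<in>Basis. (norm (frechet_derivative u (at x) b))\<^sup>2) / 2 + 1 / \<epsilon> * V (u x)"

text \<open>
  The energy is an extended nonnegative real: a map that is smooth on an open disc may have
  infinite energy, and then it must not satisfy a finite energy bound.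
\<close>

definition energy ::
  "(real ^ 'k \<Rightarrow> real) \<Rightarrow> real \<Rightarrow> (real ^ 2 \<Rightarrow> real ^ 'k) \<Rightarrow> (real ^ 2) set \<Rightarrow> ennreal" where
  "energy V \<epsilon> u G = (\<integral>\<^sup>+x\<in>G. ennreal (energy_density V \<epsilon> u x) \<partial>lborel)"

definition is_solution ::
  "(real ^ 'k \<Rightarrow> real) \<Rightarrow> real \<Rightarrow> (real ^ 2) set \<Rightarrow> (real ^ 2 \<Rightarrow> real ^ 'k) \<Rightarrow> bool" where
  "is_solution V \<epsilon> G u \<longleftrightarrow>
     smooth_on G u \<and> (\<forall>x\<in>G. - laplacian u x = - ((1 / \<epsilon>\<^sup>2) *\<^sub>R grad V (u x)))"

end

theory Submission
  imports Defs
begin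

text \<open>
  Write \<open>A = V(u) + \<epsilon>\<^sup>2|\<nabla>u|\<^sup>2/2\<close>, so that the energy density is \<open>A/\<epsilon>\<close>, and let
  \<open>I(r)\<close> be the integral of \<open>A\<close> over a disc of radius \<open>r\<close>. There is no monotonicity formula
  for \<open>I(r)/r\<close>; instead, if \<open>I(r)/(\<epsilon>r)\<close> and \<open>\<epsilon>/r\<close> are small, then \<open>I(r/16) \<le> I(r)/16\<close>.
  To see this, first test \<open>\<Delta>(V(u))\<close>, which dominates \<open>A/\<epsilon>\<^sup>2\<close> near the wells, against a
  logarithmic cutoff of \<open>V(u)\<close>: the energy carried by \<open>{V(u) < k}\<close> is a small fraction of
  \<open>I(r)\<close>. On most coordinate lines the energy is so small that \<open>V(u) < k\<close> along the whole
  line, hence Pohozaev's identity with a cutoff varying only across such lines bounds the integral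
  of \<open>V(u)\<close> by that fraction. Finally \<open>u\<close> and \<open>\<epsilon>|\<nabla>u|\<close> are bounded in terms of \<open>V\<close> alone, which
  controls the gradient by \<open>V(u)\<close> away from the wells.

  Iterating down to the scale \<open>\<epsilon>\<close>, where \<open>V(u)\<close> is Lipschitz with constant of order \<open>1/\<epsilon>\<close>, gives
  \<open>V(u) < v\<^sub>0\<close> on the disc of radius \<open>3/4\<close>. By connectedness \<open>u\<close> stays near a single well, and
  testing \<open>\<Delta>(V(u))\<close> once more yields the energy estimate.
\<close>

subsection \<open>Integration by parts against a radial bump\<close>

text \<open>Monotonicity of I(r)/r would follow from a pointwise bound of \<epsilon>^2 |grad u|^2 /
  2 by V(u), which vector-valued solutions need not satisfy. Pohozaev's identity in dimension two
  controls the integral of V(u) only, and its cutoff error is a multiple of the energy that is not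
  small. It becomes small only because it is confined to {V(u) < k}, where the logarithmic weight
  gains a factor of order 1 / L with L = ln (v0 / k). A smaller k forces a smaller energy threshold,
  since V(u) must stay below k along lines; there is no circle, because the gain depends on L and
  \<epsilon> / r alone and the constants are chosen in the order L, then k, then \<eta>. The flux
  terms of the weighted estimates cost a multiple of \<epsilon> / r, which is why the descent in
  scales stops at a fixed multiple of \<epsilon>. No boundary integral ever appears: every test
  field has compact support, so integration by parts in the plane only says that a directional
  derivative of such a field integrates to zero.\<close>

lemma integrable_on_compact:
  fixes f :: "'a::euclidean_space \<Rightarrow> real"
  assumes "compact S" "continuous_on S f"
  shows "f integrable_on S" "set_integrable lborel S f" "(LINT x:S|lborel. f x) = integral S f"
proof -
  show s: "set_integrable lborel S f"
    unfolding set_integrable_def using borel_integrable_compact[OF assms] .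
  show "f integrable_on S" "(LINT x:S|lborel. f x) = integral S f"
    using set_borel_integral_eq_integral[OF s] by auto
qed

text \<open>Translating \<open>g\<close> does not change its integral, and differentiating the
  integral of \<open>g (x + h *\<^sub>R b)\<close> at h = 0 under the integral sign produces the
  integral of the directional derivative.\<close>

lemma integral_directional_derivative_eq_0:
  fixes g :: "'a::euclidean_space \<Rightarrow> real"
  assumes der: "\<And>x. (g has_derivative D x) (at x)"
    and cont: "continuous_on UNIV (\<lambda>x. D x b)"
    and K: "compact K" and supp: "\<And>x. x \<notin> K \<Longrightarrow> g x = 0"
  shows "integral K (\<lambda>x. D x b) = 0"
proof -
  have gc: "continuous_on UNIV g"
    using der by (meson continuous_at_imp_continuous_on has_derivative_continuous)
  have D0: "D x b = 0" if "x \<notin> K" for x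
  proof -
    have "open (- K)" using K compact_imp_closed by blast
    have "(g has_derivative (\<lambda>_. 0)) (at x)"
      by (rule has_derivative_transform_within_open[of "\<lambda>_. 0" _ _ UNIV "-K"])
        (use that supp \<open>open (-K)\<close> in auto)
    with der have "D x = (\<lambda>_. 0)" using has_derivative_unique by blast
    then show ?thesis by simp
  qed
  obtain R where R: "K \<subseteq> cball 0 R"
    using bounded_subset_ballD[OF compact_imp_bounded[OF K]] ball_subset_cball by (metis subset_trans)
  obtain c d where cd: "cball 0 (R + norm b) \<subseteq> cbox c (d::'a)"
    by (meson bounded_cball bounded_subset_cbox_symmetric)
  \<comment> \<open>The box contains every translate of \<open>K\<close> by
    \<open>h *\<^sub>R b\<close> with |h| <= 1, so for these h the integral over the box is the
    integral over the whole space and does not depend on h.\<close>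
  have KR: "x + h *\<^sub>R b \<in> K \<Longrightarrow> \<bar>h\<bar> \<le> 1 \<Longrightarrow> x \<in> cbox c d" for x h
  proof -
    assume "x + h *\<^sub>R b \<in> K" "\<bar>h\<bar> \<le> 1"
    then have "norm (x + h *\<^sub>R b) \<le> R" using R by auto
    moreover have "norm x \<le> norm (x + h *\<^sub>R b) + norm (h *\<^sub>R b)"
      by (metis add_diff_cancel_right' norm_triangle_ineq4)
    moreover have "norm (h *\<^sub>R b) \<le> norm b" using \<open>\<bar>h\<bar> \<le> 1\<close>
      by (simp add: mult_left_le_one_le)
    ultimately show ?thesis using cd by (auto simp: dist_norm)
  qed
  define F where "F h = integral (cbox c d) (\<lambda>x. g (x + h *\<^sub>R b))" for h :: real
  have Feq: "F h = integral\<^sup>L lborel g" if "\<bar>h\<bar> \<le> 1" for h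
  proof -
    have gm[measurable]: "g \<in> borel_measurable borel" using gc borel_measurable_continuous_onI by blast
    have "F h = (LINT x:cbox c d|lborel. g (x + h *\<^sub>R b))"
      unfolding F_def
      by (rule integrable_on_compact(3)[symmetric], auto intro!: continuous_intros continuous_on_compose2[OF gc])
    also have "\<dots> = (\<integral>x. g (h *\<^sub>R b + x) \<partial>lborel)"
      unfolding set_lebesgue_integral_def
      by (rule Bochner_Integration.integral_cong) (use KR[OF _ that] supp in \<open>auto simp: indicator_def add.commute\<close>)
    also have "\<dots> = integral\<^sup>L (distr lborel borel ((+) (h *\<^sub>R b))) g"
      by (subst integral_distr) auto
    also have "\<dots> = integral\<^sup>L lborel g" by (simp only: lborel_distr_plus)
    finally show ?thesis .
  qed
  have "(F has_field_derivative integral (cbox c d) (\<lambda>x. D (x + 0 *\<^sub>R b) b)) (at 0 within {-1<..<1})"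
    unfolding F_def
  proof (rule leibniz_rule_field_derivative[where fx="\<lambda>h x. D (x + h *\<^sub>R b) b"])
    fix h x
    have "((\<lambda>h. g (x + h *\<^sub>R b)) has_derivative (\<lambda>s. D (x + h *\<^sub>R b) (s *\<^sub>R b))) (at h)"
      by (rule has_derivative_compose[OF _ der]) (auto intro!: derivative_eq_intros)
    moreover have "D (x + h *\<^sub>R b) (s *\<^sub>R b) = D (x + h *\<^sub>R b) b * s" for s
      using linear_scale[OF has_derivative_linear[OF der]] by simp
    ultimately have "((\<lambda>h. g (x + h *\<^sub>R b)) has_field_derivative D (x + h *\<^sub>R b) b) (at h)"
      by (simp add: has_field_derivative_def mult_commute_abs)
    then show "((\<lambda>h. g (x + h *\<^sub>R b)) has_field_derivative D (x + h *\<^sub>R b) b) (at h within {-1<..<1})"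
      by (rule has_field_derivative_at_within)
  next
    fix h show "(\<lambda>x. g (x + h *\<^sub>R b)) integrable_on cbox c d"
      by (intro integrable_continuous continuous_intros continuous_on_compose2[OF gc]) auto
  next
    show "continuous_on ({-1<..<1} \<times> cbox c d) (\<lambda>(x, t). D (t + x *\<^sub>R b) b)"
      unfolding split_beta
      by (intro continuous_intros continuous_on_compose2[OF cont]) auto
  qed auto
  then have "(F has_field_derivative integral (cbox c d) (\<lambda>x. D x b)) (at 0)"
    by (simp add: at_within_open[of 0 "{-1<..<1::real}"])
  moreover have "(F has_field_derivative 0) (at 0)"
    by (rule has_field_derivative_transform_within_open[of "\<lambda>_. integral\<^sup>L lborel g" _ _ "{-1<..<1}"])
      (auto simp: Feq)
  ultimately have "integral (cbox c d) (\<lambda>x. D x b) = 0" using DERIV_unique by blast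
  moreover have "integral K (\<lambda>x. D x b) = integral (cbox c d) (\<lambda>x. D x b)"
  proof -
    have "integral (cbox c d) (\<lambda>x. D x b) = integral (cbox c d) (\<lambda>x. if x \<in> K then D x b else 0)"
      by (rule integral_cong) (use D0 in auto)
    also have "\<dots> = integral (K \<inter> cbox c d) (\<lambda>x. D x b)" by (rule integral_restrict_Int)
    also have "K \<inter> cbox c d = K" using KR[of _ 0] by auto
    finally show ?thesis by simp
  qed
  ultimately show ?thesis by simp
qed

text \<open>Extension by zero reduces this to the global case: \<open>g\<close> vanishes on the open
  set \<open>U - K\<close>, so its derivative vanishes there too and the extended derivative along
  \<open>b\<close> stays continuous.\<close>

lemma integral_directional_derivative_eq_0_on:
  fixes g :: "'a::euclidean_space \<Rightarrow> real"
  assumes U: "open U" and K: "compact K" "K \<subseteq> U"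
    and der: "\<And>x. x \<in> U \<Longrightarrow> (g has_derivative D x) (at x)"
    and cont: "continuous_on U (\<lambda>x. D x b)"
    and supp: "\<And>x. x \<in> U \<Longrightarrow> x \<notin> K \<Longrightarrow> g x = 0"
  shows "integral K (\<lambda>x. D x b) = 0"
proof -
  define g' where "g' x = (if x \<in> K then g x else 0)" for x
  define D' where "D' x = (if x \<in> U then D x else (\<lambda>_. 0))" for x
  have oK: "open (- K)" using K compact_imp_closed by blast
  have D0: "D x = (\<lambda>_. 0)" if "x \<in> U" "x \<notin> K" for x
  proof -
    have "(g has_derivative (\<lambda>_. 0)) (at x)"
      by (rule has_derivative_transform_within_open[of "\<lambda>_. 0" _ _ UNIV "U \<inter> -K"])
        (use that supp oK U in auto)
    with der that show ?thesis using has_derivative_unique by blast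
  qed
  have "(g' has_derivative D' x) (at x)" for x
  proof (cases "x \<in> U")
    case True
    show ?thesis
      unfolding D'_def using True
      by (auto intro!: has_derivative_transform_within_open[OF der[OF True] U True] simp: g'_def supp)
  next
    case False
    then have "x \<in> - K" using K by auto
    show ?thesis
      by (rule has_derivative_transform_within_open[of "\<lambda>_. 0" _ _ UNIV "-K"])
        (use \<open>x \<in> - K\<close> False oK in \<open>auto simp: g'_def D'_def\<close>)
  qed
  moreover have "continuous_on UNIV (\<lambda>x. D' x b)"
  proof -
    have "continuous_on (U \<union> - K) (\<lambda>x. D' x b)"
    proof (rule continuous_on_open_Un[OF U oK])
      show "continuous_on U (\<lambda>x. D' x b)"
        using cont by (rule continuous_on_eq) (simp add: D'_def)
      have "D' x b = 0" if "x \<in> - K" for x using that D0 by (auto simp: D'_def)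
      then show "continuous_on (- K) (\<lambda>x. D' x b)"
        by (metis (no_types, lifting) continuous_on_const continuous_on_eq)
    qed
    moreover have "U \<union> - K = UNIV" using K by auto
    ultimately show ?thesis by simp
  qed
  ultimately have "integral K (\<lambda>x. D' x b) = 0"
    by (rule integral_directional_derivative_eq_0) (auto simp: g'_def K)
  moreover have "integral K (\<lambda>x. D' x b) = integral K (\<lambda>x. D x b)"
    by (rule integral_cong) (use K in \<open>auto simp: D'_def\<close>)
  ultimately show ?thesis by simp
qed

section \<open>Powers of a truncated paraboloid as compactly supported test functions\<close>

definition bump_base :: "'a::euclidean_space \<Rightarrow> real \<Rightarrow> 'a \<Rightarrow> real" where
  "bump_base x0 r x = max 0 (r\<^sup>2 - (norm (x - x0))\<^sup>2)"

lemma DERIV_max_0_power: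
  "((\<lambda>s::real. (max 0 s) ^ Suc (Suc n)) has_real_derivative (real n + 2) * (max 0 s) ^ Suc n) (at s)"
proof -
  consider "s < 0" | "s = 0" | "s > 0" by linarith
  then show ?thesis
  proof cases
    case 1
    show ?thesis
      by (rule has_field_derivative_transform_within_open[of "\<lambda>_. 0" _ _ "{..<0}"]) (use 1 in auto)
  next
    case 2
    \<comment> \<open>At the corner, \<open>max 0 z ^ Suc n\<close> is a continuous slope function
      on both sides of 0, so Caratheodory's criterion gives the derivative 0.\<close>
    have "\<forall>z::real. (max 0 z) ^ Suc (Suc n) - (max 0 s) ^ Suc (Suc n) = (max 0 z) ^ Suc n * (z - s)"
      using 2 by (auto simp: max_def)
    moreover have "isCont (\<lambda>z::real. (max 0 z) ^ Suc n) s" by (intro continuous_intros)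
    ultimately show ?thesis unfolding CARAT_DERIV
      using 2 by (intro exI[of _ "\<lambda>z. (max 0 z) ^ Suc n"]) auto
  next
    case 3
    have "((\<lambda>s. s ^ Suc (Suc n)) has_real_derivative (real n + 2) * (max 0 s) ^ Suc n) (at s)"
      using DERIV_pow[of "Suc (Suc n)" s UNIV] 3 by (simp add: max_def algebra_simps)
    then show ?thesis
      by (rule has_field_derivative_transform_within_open[of _ _ _ "{0<..}"]) (use 3 in auto)
  qed
qed

lemma has_derivative_bump_base_power:
  "((\<lambda>x. bump_base x0 r x ^ Suc (Suc n)) has_derivative
     (\<lambda>h. - (2 * (real n + 2)) * bump_base x0 r x ^ Suc n * ((x - x0) \<bullet> h))) (at x)"
proof -
  have "((\<lambda>x. r\<^sup>2 - (norm (x - x0))\<^sup>2) has_derivative (\<lambda>h. - 2 * ((x - x0) \<bullet> h))) (at x)"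
    unfolding power2_norm_eq_inner
    by (auto intro!: derivative_eq_intros simp: inner_commute)
  from has_derivative_compose[OF this DERIV_max_0_power[of n, unfolded has_field_derivative_def]]
  show ?thesis unfolding bump_base_def by (simp add: algebra_simps)
qed

lemma has_derivative_bump_base_cube:
  "((\<lambda>x. bump_base x0 r x ^ 3) has_derivative
     (\<lambda>h. - 6 * (bump_base x0 r x)\<^sup>2 * ((x - x0) \<bullet> h))) (at x)"
  using has_derivative_bump_base_power[of x0 r 1 x] by (simp add: numeral_eq_Suc)

lemma continuous_on_bump_base[continuous_intros]:
  "continuous_on S f \<Longrightarrow> continuous_on S (\<lambda>x. bump_base x0 r (f x))"
  unfolding bump_base_def by (intro continuous_intros)

lemma bump_base_nonneg[simp]: "0 \<le> bump_base x0 r x" by (simp add: bump_base_def)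

lemma bump_base_le: "bump_base x0 r x \<le> r\<^sup>2" by (simp add: bump_base_def)

lemma bump_base_outside: "0 \<le> r \<Longrightarrow> x \<notin> cball x0 r \<Longrightarrow> bump_base x0 r x = 0"
  by (auto simp: bump_base_def max_def dist_norm norm_minus_commute not_le)

text \<open>The cube of the bump m has gradient - 6 m^2 (x - x0). The identity serves two purposes:
  with m^3 as cutoff it gives energy estimates, and its right-hand side is the radial derivative of
  averages with weight m^2.\<close>

lemma integral_bump_divergence:
  fixes Y :: "'a::euclidean_space \<Rightarrow> 'a"
  assumes U: "open U" "cball x0 r \<subseteq> U" and r: "0 \<le> r"
    and der: "\<And>x. x \<in> U \<Longrightarrow> (Y has_derivative DY x) (at x)"
    and cont: "\<And>b. b \<in> Basis \<Longrightarrow> continuous_on U (\<lambda>x. DY x b \<bullet> b)"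
  shows "integral (cball x0 r) (\<lambda>x. bump_base x0 r x ^ 3 * (\<Sum>b\<in>Basis. DY x b \<bullet> b))
       = 6 * integral (cball x0 r) (\<lambda>x. (bump_base x0 r x)\<^sup>2 * ((x - x0) \<bullet> Y x))"
proof -
  let ?m = "bump_base x0 r"
  have Yc: "continuous_on U Y"
    using der by (meson continuous_at_imp_continuous_on has_derivative_continuous)
  note Yc' = continuous_on_subset[OF Yc U(2)]
  have c1: "continuous_on (cball x0 r) (\<lambda>x. DY x b \<bullet> b)" if "b \<in> Basis" for b
    using cont[OF that] U(2) continuous_on_subset by blast
  have 0: "integral (cball x0 r) (\<lambda>x. ?m x ^ 3 * (DY x b \<bullet> b) - 6 * (?m x)\<^sup>2 * ((x - x0) \<bullet> b) * (Y x \<bullet> b)) = 0"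
    if b: "b \<in> Basis" for b
  proof (rule integral_directional_derivative_eq_0_on[where g = "\<lambda>x. ?m x ^ 3 * (Y x \<bullet> b)" and U=U and b=b and
      D = "\<lambda>x h. ?m x ^ 3 * (DY x h \<bullet> b) - 6 * (?m x)\<^sup>2 * ((x - x0) \<bullet> h) * (Y x \<bullet> b)"])
    fix x assume "x \<in> U"
    show "((\<lambda>x. ?m x ^ 3 * (Y x \<bullet> b)) has_derivative
         (\<lambda>h. ?m x ^ 3 * (DY x h \<bullet> b) - 6 * (?m x)\<^sup>2 * ((x - x0) \<bullet> h) * (Y x \<bullet> b))) (at x)"
      by (rule derivative_eq_intros has_derivative_bump_base_cube der[OF \<open>x \<in> U\<close>] refl)+
        (simp add: algebra_simps)
  next
    show "continuous_on U (\<lambda>x. ?m x ^ 3 * (DY x b \<bullet> b) - 6 * (?m x)\<^sup>2 * ((x - x0) \<bullet> b) * (Y x \<bullet> b))"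
      by (intro continuous_intros cont b Yc)
  qed (use U r bump_base_outside in auto)
  have I1: "(\<lambda>x. ?m x ^ 3 * (DY x b \<bullet> b)) integrable_on cball x0 r" if "b \<in> Basis" for b
    by (intro integrable_on_compact continuous_intros c1 that) auto
  have I2: "(\<lambda>x. 6 * (?m x)\<^sup>2 * ((x - x0) \<bullet> b) * (Y x \<bullet> b)) integrable_on cball x0 r" for b
    by (intro integrable_on_compact continuous_intros Yc') auto
  have "integral (cball x0 r) (\<lambda>x. ?m x ^ 3 * (\<Sum>b\<in>Basis. DY x b \<bullet> b))
      = (\<Sum>b\<in>Basis. integral (cball x0 r) (\<lambda>x. ?m x ^ 3 * (DY x b \<bullet> b)))"
    by (simp add: sum_distrib_left integral_sum I1)
  also have "\<dots> = (\<Sum>b\<in>Basis. integral (cball x0 r) (\<lambda>x. 6 * (?m x)\<^sup>2 * ((x - x0) \<bullet> b) * (Y x \<bullet> b)))"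
  proof (rule sum.cong[OF refl])
    fix b :: 'a assume b: "b \<in> Basis"
    show "integral (cball x0 r) (\<lambda>x. ?m x ^ 3 * (DY x b \<bullet> b)) = integral (cball x0 r) (\<lambda>x. 6 * (?m x)\<^sup>2 * ((x - x0) \<bullet> b) * (Y x \<bullet> b))"
      using 0[OF b] integral_diff[OF I1[OF b] I2] by simp
  qed
  also have "\<dots> = integral (cball x0 r) (\<lambda>x. \<Sum>b\<in>Basis. 6 * (?m x)\<^sup>2 * ((x - x0) \<bullet> b) * (Y x \<bullet> b))"
    by (simp add: integral_sum I2)
  also have "\<dots> = integral (cball x0 r) (\<lambda>x. 6 * ((?m x)\<^sup>2 * ((x - x0) \<bullet> Y x)))"
    by (rule integral_cong, subst (3) euclidean_inner) (simp add: sum_distrib_left mult.assoc)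
  finally show ?thesis by simp
qed

section \<open>Integrals over balls: scaling, restriction and mass\<close>

lemma integral_cball_affine:
  fixes w :: "'a::euclidean_space \<Rightarrow> real"
  assumes r: "r > 0" and w: "continuous_on (cball x0 r) w"
  shows "integral (cball x0 r) w = r ^ DIM('a) * integral (cball 0 1) (\<lambda>y. w (x0 + r *\<^sub>R y))"
proof -
  let ?f = "\<lambda>x. indicator (cball x0 r) x *\<^sub>R w x"
  have f[measurable]: "?f \<in> borel_measurable borel"
    using borel_integrable_compact[OF compact_cball w] by (auto dest: borel_measurable_integrable)
  have c: "continuous_on (cball 0 1) (\<lambda>y. w (x0 + r *\<^sub>R y))"
    by (rule continuous_on_compose2[OF w]) (use r in \<open>auto intro!: continuous_intros simp: dist_norm mult_le_cancel_left1\<close>)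
  have "integral (cball x0 r) w = integral\<^sup>L lborel ?f"
    using integrable_on_compact(3)[OF compact_cball w] by (simp add: set_lebesgue_integral_def)
  also have "\<dots> = integral\<^sup>L (density (distr lborel borel (\<lambda>x. x0 + r *\<^sub>R x)) (\<lambda>_. ennreal (r^DIM('a)))) ?f"
    using lborel_affine[of r x0] r by simp
  also have "\<dots> = r^DIM('a) * integral\<^sup>L lborel (\<lambda>x. ?f (x0 + r *\<^sub>R x))"
    using r f by (subst integral_density[where g="\<lambda>_. r ^ DIM('a)"]) (auto simp: integral_distr)
  also have "(\<lambda>x. ?f (x0 + r *\<^sub>R x)) = (\<lambda>x. indicator (cball 0 1) x *\<^sub>R w (x0 + r *\<^sub>R x))"
    using r by (auto simp: indicator_def dist_norm mult_le_cancel_left1)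
  also have "integral\<^sup>L lborel \<dots> = integral (cball 0 1) (\<lambda>y. w (x0 + r *\<^sub>R y))"
    using integrable_on_compact(3)[OF compact_cball c] by (simp add: set_lebesgue_integral_def)
  finally show ?thesis .
qed

lemma integral_superset_eq:
  fixes f :: "'a::euclidean_space \<Rightarrow> real"
  assumes "S \<subseteq> T" "\<And>x. x \<in> T \<Longrightarrow> x \<notin> S \<Longrightarrow> f x = 0"
  shows "integral T f = integral S f"
proof -
  have "integral T f = integral T (\<lambda>x. if x \<in> S then f x else 0)"
    by (rule integral_cong) (use assms in auto)
  also have "\<dots> = integral (S \<inter> T) f" by (rule integral_restrict_Int)
  also have "S \<inter> T = S" using assms by auto
  finally show ?thesis .
qed

lemma integral_const_cball: "integral (cball x r) (\<lambda>_::'a::euclidean_space. c::real) = c * measure lborel (cball x r)"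
proof -
  have "integral (cball x r) (\<lambda>_. c) = (LINT y:cball x r|lborel. c)"
    by (rule integrable_on_compact(3)[symmetric]) auto
  also have "\<dots> = c * measure lborel (cball x r)"
    by (simp add: set_lebesgue_integral_def emeasure_bounded_finite)
  finally show ?thesis .
qed

lemma bump_mass_pos: "0 < integral (cball 0 1) (\<lambda>y::'a::euclidean_space. (bump_base 0 1 y)\<^sup>2)"
proof -
  let ?\<psi> = "\<lambda>y::'a. (bump_base 0 1 y)\<^sup>2"
  have "0 < measure lborel (cball (0::'a) (1/2)) * (9/16)" by (simp add: content_cball_pos)
  also have "\<dots> = integral (cball (0::'a) (1/2)) (\<lambda>_. 9/16)" by (simp add: integral_const_cball)
  also have "\<dots> \<le> integral (cball 0 (1/2)) ?\<psi>"
  proof (rule integral_le)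
    show "(\<lambda>_::'a. 9/16::real) integrable_on cball 0 (1 / 2)" by (intro integrable_on_compact) auto
    show "?\<psi> integrable_on cball 0 (1 / 2)" by (intro integrable_on_compact continuous_intros) auto
    fix y :: 'a assume "y \<in> cball 0 (1/2)"
    then have "norm y ^ 2 \<le> (1/2)^2" by (intro power_mono) auto
    then have "3/4 \<le> bump_base 0 1 y" by (simp add: bump_base_def power2_eq_square)
    then have "(3/4)^2 \<le> ?\<psi> y" by (intro power_mono) auto
    then show "9/16 \<le> ?\<psi> y" by (simp add: power2_eq_square)
  qed
  also have "\<dots> \<le> integral (cball 0 1) ?\<psi>"
    by (rule integral_subset_le) (auto intro!: integrable_on_compact continuous_intros)
  finally show ?thesis .
qed

text \<open>
  The weighted averages \<open>h t\<close> of \<open>w\<close> over \<open>cball x0 t\<close> satisfy \<open>h' t \<ge> - const * A * t\<close>,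
  because the weight times \<open>y\<close> is the gradient of a compactly supported nonpositive function.
\<close>

lemma mean_value_inequality:
  fixes w :: "'a::euclidean_space \<Rightarrow> real"
  assumes U: "open U" "cbox (x0 - r *\<^sub>R One) (x0 + r *\<^sub>R One) \<subseteq> U" and r: "r > 0"
    and w: "\<And>x. x \<in> U \<Longrightarrow> (w has_derivative (\<lambda>h. Y x \<bullet> h)) (at x)"
    and Y: "\<And>x. x \<in> U \<Longrightarrow> (Y has_derivative DY x) (at x)"
    and cont: "\<And>b. b \<in> Basis \<Longrightarrow> continuous_on U (\<lambda>x. DY x b \<bullet> b)"
    and div: "\<And>x. x \<in> U \<Longrightarrow> (\<Sum>b\<in>Basis. DY x b \<bullet> b) \<ge> - A" and A: "A \<ge> 0"
    and pos: "\<And>x. x \<in> U \<Longrightarrow> w x \<ge> 0"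
  shows "integral (cball 0 1) (\<lambda>y::'a. (bump_base 0 1 y)\<^sup>2) * w x0
    \<le> integral (cball x0 r) w / r ^ DIM('a) + measure lborel (cball (0::'a) 1) * A * r\<^sup>2"
proof -
  \<comment> \<open>Differentiation under the integral sign is carried out on a box; the weight
    vanishes outside the unit ball, so the box may replace the ball in every average.\<close>
  let ?Q = "cbox (- One) One :: 'a set" and ?B = "cball 0 1 :: 'a set"
  let ?m = "bump_base (0::'a) 1"
  let ?v = "measure lborel ?B"
  have BQ: "?B \<subseteq> ?Q"
  proof
    fix x :: 'a assume "x \<in> ?B"
    then have "\<bar>x \<bullet> b\<bar> \<le> 1" if "b \<in> Basis" for b using Basis_le_norm[OF that, of x] by simp
    then show "x \<in> ?Q" by (auto simp: mem_box abs_le_iff)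
  qed
  have inU: "x0 + t *\<^sub>R y \<in> U" if "y \<in> ?Q" "t \<in> {0..r}" for t y
  proof -
    have "\<bar>t * (y \<bullet> b)\<bar> \<le> r" if "b \<in> Basis" for b
    proof -
      have "\<bar>y \<bullet> b\<bar> \<le> 1" using \<open>y \<in> ?Q\<close> that by (force simp: mem_box)
      then have "\<bar>t\<bar> * \<bar>y \<bullet> b\<bar> \<le> r * 1" using \<open>t \<in> {0..r}\<close> by (intro mult_mono) auto
      then show ?thesis by (simp add: abs_mult)
    qed
    then have "x0 + t *\<^sub>R y \<in> cbox (x0 - r *\<^sub>R One) (x0 + r *\<^sub>R One)"
      by (force simp: mem_box inner_simps)
    then show ?thesis using U by auto
  qed
  have wc: "continuous_on U w" and Yc: "continuous_on U Y"
    using w Y by (meson continuous_at_imp_continuous_on has_derivative_continuous)+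
  define h where "h t = integral ?Q (\<lambda>y. w (x0 + t *\<^sub>R y) * (?m y)\<^sup>2)" for t
  define h' where "h' t = integral ?Q (\<lambda>y. (Y (x0 + t *\<^sub>R y) \<bullet> y) * (?m y)\<^sup>2)" for t
  have dh: "(h has_field_derivative h' t) (at t within {0..r})" if "t \<in> {0..r}" for t
    unfolding h_def h'_def
  proof (rule leibniz_rule_field_derivative[where fx="\<lambda>t y. (Y (x0 + t *\<^sub>R y) \<bullet> y) * (?m y)\<^sup>2"])
    fix t y assume ty: "t \<in> {0..r}" "y \<in> ?Q"
    have "((\<lambda>t. w (x0 + t *\<^sub>R y)) has_derivative (\<lambda>s. Y (x0 + t *\<^sub>R y) \<bullet> (s *\<^sub>R y))) (at t)"
      by (rule has_derivative_compose[where f="\<lambda>t. x0 + t *\<^sub>R y", OF _ w[OF inU[OF ty(2,1)]]])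
        (auto intro!: derivative_eq_intros)
    then have "((\<lambda>t. w (x0 + t *\<^sub>R y)) has_field_derivative (Y (x0 + t *\<^sub>R y) \<bullet> y)) (at t)"
      by (simp add: has_field_derivative_def mult_commute_abs)
    then have "((\<lambda>t. w (x0 + t *\<^sub>R y) * (?m y)\<^sup>2) has_field_derivative (Y (x0 + t *\<^sub>R y) \<bullet> y) * (?m y)\<^sup>2) (at t)"
      by (rule DERIV_cmult_right)
    then show "((\<lambda>t. w (x0 + t *\<^sub>R y) * (?m y)\<^sup>2) has_field_derivative (Y (x0 + t *\<^sub>R y) \<bullet> y) * (?m y)\<^sup>2) (at t within {0..r})"
      by (rule has_field_derivative_at_within)
  next
    fix t assume t: "t \<in> {0..r}"
    show "(\<lambda>y. w (x0 + t *\<^sub>R y) * (?m y)\<^sup>2) integrable_on ?Q"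
      by (intro integrable_continuous continuous_intros continuous_on_compose2[OF wc]) (use inU t in auto)
  next
    show "continuous_on ({0..r} \<times> ?Q) (\<lambda>(t, y). (Y (x0 + t *\<^sub>R y) \<bullet> y) * (?m y)\<^sup>2)"
      unfolding split_beta
      by (intro continuous_intros continuous_on_compose2[OF Yc]) (use inU in auto)
  qed (use that in auto)
  \<comment> \<open>Six times \<open>h' t\<close> is the integral of m^3 times t times the
    divergence at x0 + t y; 0 <= m <= 1 turns the lower bound - A into - t A times the volume, and
    the factor 6 is discarded.\<close>
  have h'_ge: "h' t \<ge> - (t * A * ?v)" if t: "t \<in> {0..r}" for t
  proof -
    let ?U = "(\<lambda>y. x0 + t *\<^sub>R y) -` U"
    have oU: "open ?U" by (intro continuous_open_vimage U continuous_intros)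
    have BU: "cball 0 1 \<subseteq> ?U" using inU[OF _ t] BQ by auto
    have cdiv: "continuous_on (cball 0 1) (\<lambda>y. \<Sum>b\<in>Basis. t * (DY (x0 + t *\<^sub>R y) b \<bullet> b))"
      by (intro continuous_intros continuous_on_compose2[OF cont]) (use BU in auto)
    have "integral ?B (\<lambda>y. ?m y ^ 3 * (\<Sum>b\<in>Basis. DY (x0 + t *\<^sub>R y) (t *\<^sub>R b) \<bullet> b))
       = 6 * integral ?B (\<lambda>y. (?m y)\<^sup>2 * ((y - 0) \<bullet> Y (x0 + t *\<^sub>R y)))"
    proof (rule integral_bump_divergence[OF oU BU])
      fix y assume "y \<in> ?U"
      then show "((\<lambda>y. Y (x0 + t *\<^sub>R y)) has_derivative (\<lambda>h. DY (x0 + t *\<^sub>R y) (t *\<^sub>R h))) (at y)"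
        by (intro has_derivative_compose[OF _ Y]) (auto intro!: derivative_eq_intros)
    next
      fix b :: 'a assume b: "b \<in> Basis"
      have "continuous_on ?U (\<lambda>y. t * (DY (x0 + t *\<^sub>R y) b \<bullet> b))"
        by (intro continuous_intros continuous_on_compose2[OF cont[OF b]]) auto
      then show "continuous_on ?U (\<lambda>y. DY (x0 + t *\<^sub>R y) (t *\<^sub>R b) \<bullet> b)"
        by (rule continuous_on_eq) (simp add: linear_scale[OF has_derivative_linear[OF Y]])
    qed simp
    also have "integral ?B (\<lambda>y. ?m y ^ 3 * (\<Sum>b\<in>Basis. DY (x0 + t *\<^sub>R y) (t *\<^sub>R b) \<bullet> b))
        = integral ?B (\<lambda>y. ?m y ^ 3 * (\<Sum>b\<in>Basis. t * (DY (x0 + t *\<^sub>R y) b \<bullet> b)))"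
      by (rule integral_cong) (use BU in \<open>auto simp: linear_scale[OF has_derivative_linear[OF Y]]\<close>)
    also have "integral ?B (\<lambda>y. (?m y)\<^sup>2 * ((y - 0) \<bullet> Y (x0 + t *\<^sub>R y))) = h' t"
      unfolding h'_def
      by (subst integral_superset_eq[OF BQ]) (auto simp: bump_base_outside inner_commute mult.commute)
    finally have "6 * h' t = integral ?B (\<lambda>y. ?m y ^ 3 * (\<Sum>b\<in>Basis. t * (DY (x0 + t *\<^sub>R y) b \<bullet> b)))" by simp
    also have "\<dots> \<ge> integral ?B (\<lambda>y. - (t * A))"
    proof (rule integral_le)
      show "(\<lambda>y. ?m y ^ 3 * (\<Sum>b\<in>Basis. t * (DY (x0 + t *\<^sub>R y) b \<bullet> b))) integrable_on ?B"
        by (intro integrable_on_compact continuous_on_mult continuous_on_power continuous_on_bump_base cdiv)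
          (auto intro!: continuous_intros)
      fix y :: 'a assume "y \<in> ?B"
      then have "- A \<le> (\<Sum>b\<in>Basis. DY (x0 + t *\<^sub>R y) b \<bullet> b)" using div BU by auto
      then have "t * (- A) \<le> (\<Sum>b\<in>Basis. t * (DY (x0 + t *\<^sub>R y) b \<bullet> b))"
        unfolding sum_distrib_left[symmetric] using t by (intro mult_left_mono) auto
      then have 1: "?m y ^ 3 * (- (t * A)) \<le> ?m y ^ 3 * (\<Sum>b\<in>Basis. t * (DY (x0 + t *\<^sub>R y) b \<bullet> b))"
        by (intro mult_left_mono) auto
      have "?m y ^ 3 \<le> 1" using bump_base_le[of 0 1 y] by (intro power_le_one) auto
      then have "?m y ^ 3 * (t * A) \<le> 1 * (t * A)" using t A by (intro mult_right_mono) auto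
      with 1 show "- (t * A) \<le> ?m y ^ 3 * (\<Sum>b\<in>Basis. t * (DY (x0 + t *\<^sub>R y) b \<bullet> b))" by simp
    qed (intro integrable_on_compact, auto)
    finally have "- (t * A * ?v) \<le> 6 * h' t" by (simp add: integral_const_cball mult_ac)
    moreover have "0 \<le> t * A * ?v" using t A by auto
    ultimately show ?thesis by linarith
  qed
  \<comment> \<open>The quadratic term compensates the lower bound on \<open>h'\<close>, so that
    \<open>H\<close> does not decrease.\<close>
  define H where "H t = h t + A * ?v * t\<^sup>2 / 2" for t
  have "\<exists>t\<in>{0<..<r}. H r - H 0 = (h' t + A * ?v * t) * (r - 0)"
  proof (rule mvt_simple[OF r])
    fix t assume "0 \<le> t" "t \<le> r"
    then have "(H has_field_derivative (h' t + A * ?v * t)) (at t within {0..r})"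
      unfolding H_def by (auto intro!: derivative_eq_intros dh)
    then show "(H has_derivative (*) (h' t + A * ?v * t)) (at t within {0..r})"
      by (simp add: has_field_derivative_def)
  qed
  then obtain t where t: "t \<in> {0<..<r}" "H r - H 0 = (h' t + A * ?v * t) * (r - 0)" by blast
  have "0 \<le> (h' t + A * ?v * t) * (r - 0)"
    using h'_ge[of t] t(1) r by (intro mult_nonneg_nonneg) (auto simp: algebra_simps)
  then have "H 0 \<le> H r" using t by linarith
  then have "h 0 \<le> h r + A * ?v * r\<^sup>2 / 2" by (simp add: H_def)
  moreover have "h 0 = integral ?B (\<lambda>y. (?m y)\<^sup>2) * w x0"
    unfolding h_def by (subst integral_superset_eq[OF BQ]) (auto simp: bump_base_outside)
  moreover have "h r \<le> integral (cball x0 r) w / r ^ DIM('a)"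
  proof -
    have BU: "x0 + r *\<^sub>R y \<in> U" if "y \<in> ?B" for y using inU[of y r] that BQ r by auto
    have cU: "cball x0 r \<subseteq> U"
    proof
      fix x assume "x \<in> cball x0 r"
      then have "(1/r) *\<^sub>R (x - x0) \<in> ?B" using r by (simp add: dist_norm norm_minus_commute divide_le_eq)
      from BU[OF this] show "x \<in> U" using r by simp
    qed
    have cw: "continuous_on ?B (\<lambda>y. w (x0 + r *\<^sub>R y))"
      by (intro continuous_on_compose2[OF wc] continuous_intros) (use BU in auto)
    have "h r = integral ?B (\<lambda>y. w (x0 + r *\<^sub>R y) * (?m y)\<^sup>2)"
      unfolding h_def by (subst integral_superset_eq[OF BQ]) (auto simp: bump_base_outside)
    also have "\<dots> \<le> integral ?B (\<lambda>y. w (x0 + r *\<^sub>R y))"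
    proof (rule integral_le)
      show "(\<lambda>y. w (x0 + r *\<^sub>R y) * (?m y)\<^sup>2) integrable_on ?B"
        by (intro integrable_on_compact continuous_on_mult cw continuous_intros) auto
      show "(\<lambda>y. w (x0 + r *\<^sub>R y)) integrable_on ?B" by (intro integrable_on_compact cw) auto
      fix y :: 'a assume "y \<in> ?B"
      have "(?m y)\<^sup>2 \<le> 1" using bump_base_le[of 0 1 y] by (intro power_le_one) auto
      then show "w (x0 + r *\<^sub>R y) * (?m y)\<^sup>2 \<le> w (x0 + r *\<^sub>R y)"
        using pos[OF BU[OF \<open>y \<in> ?B\<close>]] by (simp add: mult_left_le)
    qed
    also have "\<dots> = integral (cball x0 r) w / r ^ DIM('a)"
      using integral_cball_affine[OF r continuous_on_subset[OF wc cU]] r by simp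
    finally show ?thesis .
  qed
  moreover have "A * ?v * r\<^sup>2 / 2 \<le> ?v * A * r\<^sup>2"
    using A by (simp add: mult.commute)
  ultimately show ?thesis by linarith
qed

subsection \<open>Smooth functions\<close>

abbreviation pd :: "('a::euclidean_space \<Rightarrow> 'b::real_normed_vector) \<Rightarrow> 'a \<Rightarrow> 'a \<Rightarrow> 'b" where
  "pd f v \<equiv> (\<lambda>x. frechet_derivative f (at x) v)"

lemma smooth_on_has_derivative:
  assumes "smooth_on S f" "x \<in> S"
  shows "(f has_derivative (\<lambda>h. pd f h x)) (at x)"
proof -
  have "Ck_on (Suc 0) f S" using assms unfolding smooth_on_def by blast
  then show ?thesis using assms(2) frechet_derivative_works by (auto simp: eta_contract_eq)
qed

lemma smooth_on_pd: "smooth_on S f \<Longrightarrow> smooth_on S (pd f v)"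
  unfolding smooth_on_def by (metis Ck_on.simps(2))

lemma smooth_on_continuous_on: "smooth_on S f \<Longrightarrow> continuous_on S f"
  unfolding smooth_on_def by (metis Ck_on.simps(1))

text \<open>The mean value theorem is applied along \<open>a\<close> to the increment in direction
  \<open>b\<close>, and then along \<open>b\<close> to the derivative in direction
  \<open>a\<close>.\<close>

lemma second_difference_mvt:
  fixes f :: "'a::real_normed_vector \<Rightarrow> real"
  assumes s: "s > 0"
    and f: "\<And>y. y \<in> S \<Longrightarrow> (f has_derivative Df y) (at y)"
    and p: "\<And>y. y \<in> S \<Longrightarrow> ((\<lambda>y. Df y a) has_derivative Dp y) (at y)"
    and S: "\<And>\<sigma> \<tau>. \<sigma> \<in> {0..s} \<Longrightarrow> \<tau> \<in> {0..s} \<Longrightarrow> x + \<sigma> *\<^sub>R a + \<tau> *\<^sub>R b \<in> S"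
  shows "\<exists>\<sigma>\<in>{0..s}. \<exists>\<tau>\<in>{0..s}. f (x + s *\<^sub>R a + s *\<^sub>R b) - f (x + s *\<^sub>R a) - f (x + s *\<^sub>R b) + f x
    = s\<^sup>2 * Dp (x + \<sigma> *\<^sub>R a + \<tau> *\<^sub>R b) b"
proof -
  have S0: "x + \<sigma> *\<^sub>R a \<in> S" if "\<sigma> \<in> {0..s}" for \<sigma> using S[OF that, of 0] s by simp
  have "\<exists>\<sigma>\<in>{0<..<s}. (f (x + s *\<^sub>R a + s *\<^sub>R b) - f (x + s *\<^sub>R a)) - (f (x + 0 *\<^sub>R a + s *\<^sub>R b) - f (x + 0 *\<^sub>R a))
     = (Df (x + \<sigma> *\<^sub>R a + s *\<^sub>R b) ((s - 0) *\<^sub>R a) - Df (x + \<sigma> *\<^sub>R a) ((s - 0) *\<^sub>R a))"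
  proof (rule mvt_simple[OF s])
    fix \<sigma> assume "0 \<le> \<sigma>" "\<sigma> \<le> s"
    then have *: "\<sigma> \<in> {0..s}" "s \<in> {0..s}" using s by auto
    have "((\<lambda>\<sigma>. f (x + \<sigma> *\<^sub>R a + s *\<^sub>R b)) has_derivative (\<lambda>t. Df (x + \<sigma> *\<^sub>R a + s *\<^sub>R b) (t *\<^sub>R a))) (at \<sigma>)"
      by (rule has_derivative_compose[where f="\<lambda>\<sigma>. x + \<sigma> *\<^sub>R a + s *\<^sub>R b", OF _ f[OF S[OF *]]])
        (auto intro!: derivative_eq_intros)
    moreover have "((\<lambda>\<sigma>. f (x + \<sigma> *\<^sub>R a)) has_derivative (\<lambda>t. Df (x + \<sigma> *\<^sub>R a) (t *\<^sub>R a))) (at \<sigma>)"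
      by (rule has_derivative_compose[where f="\<lambda>\<sigma>. x + \<sigma> *\<^sub>R a", OF _ f[OF S0[OF *(1)]]])
        (auto intro!: derivative_eq_intros)
    ultimately show "((\<lambda>\<sigma>. f (x + \<sigma> *\<^sub>R a + s *\<^sub>R b) - f (x + \<sigma> *\<^sub>R a)) has_derivative
       (\<lambda>t. Df (x + \<sigma> *\<^sub>R a + s *\<^sub>R b) (t *\<^sub>R a) - Df (x + \<sigma> *\<^sub>R a) (t *\<^sub>R a))) (at \<sigma> within {0..s})"
      by (rule has_derivative_at_withinI[OF has_derivative_diff])
  qed
  then obtain \<sigma> where \<sigma>0: "\<sigma> \<in> {0<..<s}" and
    e0: "(f (x + s *\<^sub>R a + s *\<^sub>R b) - f (x + s *\<^sub>R a)) - (f (x + 0 *\<^sub>R a + s *\<^sub>R b) - f (x + 0 *\<^sub>R a))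
     = (Df (x + \<sigma> *\<^sub>R a + s *\<^sub>R b) ((s - 0) *\<^sub>R a) - Df (x + \<sigma> *\<^sub>R a) ((s - 0) *\<^sub>R a))"
    by (elim bexE) (rule that)
  have \<sigma>: "\<sigma> \<in> {0..s}" using \<sigma>0 by auto
  have e1: "f (x + s *\<^sub>R a + s *\<^sub>R b) - f (x + s *\<^sub>R a) - f (x + s *\<^sub>R b) + f x
     = Df (x + \<sigma> *\<^sub>R a + s *\<^sub>R b) (s *\<^sub>R a) - Df (x + \<sigma> *\<^sub>R a) (s *\<^sub>R a)"
    using e0 by simp
  have e2: "Df (x + \<sigma> *\<^sub>R a + s *\<^sub>R b) (s *\<^sub>R a) - Df (x + \<sigma> *\<^sub>R a) (s *\<^sub>R a)
     = s * (Df (x + \<sigma> *\<^sub>R a + s *\<^sub>R b) a - Df (x + \<sigma> *\<^sub>R a) a)"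
    using linear_scale[OF has_derivative_linear[OF f[OF S[OF \<sigma>, of s]]]]
      linear_scale[OF has_derivative_linear[OF f[OF S0[OF \<sigma>]]]] s by (simp add: algebra_simps)
  have "\<exists>\<tau>\<in>{0<..<s}. Df (x + \<sigma> *\<^sub>R a + s *\<^sub>R b) a - Df (x + \<sigma> *\<^sub>R a + 0 *\<^sub>R b) a
     = Dp (x + \<sigma> *\<^sub>R a + \<tau> *\<^sub>R b) ((s - 0) *\<^sub>R b)"
  proof (rule mvt_simple[OF s])
    fix \<tau> assume "0 \<le> \<tau>" "\<tau> \<le> s"
    then have *: "\<tau> \<in> {0..s}" using s by auto
    have "((\<lambda>\<tau>. Df (x + \<sigma> *\<^sub>R a + \<tau> *\<^sub>R b) a) has_derivative (\<lambda>t. Dp (x + \<sigma> *\<^sub>R a + \<tau> *\<^sub>R b) (t *\<^sub>R b))) (at \<tau>)"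
      by (rule has_derivative_compose[where f="\<lambda>\<tau>. x + \<sigma> *\<^sub>R a + \<tau> *\<^sub>R b" and g="\<lambda>y. Df y a", OF _ p[OF S[OF \<sigma> *]]])
        (auto intro!: derivative_eq_intros)
    then show "((\<lambda>\<tau>. Df (x + \<sigma> *\<^sub>R a + \<tau> *\<^sub>R b) a) has_derivative (\<lambda>t. Dp (x + \<sigma> *\<^sub>R a + \<tau> *\<^sub>R b) (t *\<^sub>R b))) (at \<tau> within {0..s})"
      by (rule has_derivative_at_withinI)
  qed
  then obtain \<tau> where \<tau>0: "\<tau> \<in> {0<..<s}" and
    e3: "Df (x + \<sigma> *\<^sub>R a + s *\<^sub>R b) a - Df (x + \<sigma> *\<^sub>R a + 0 *\<^sub>R b) a = Dp (x + \<sigma> *\<^sub>R a + \<tau> *\<^sub>R b) ((s - 0) *\<^sub>R b)"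
    by (elim bexE) (rule that)
  have \<tau>: "\<tau> \<in> {0..s}" using \<tau>0 by auto
  have e4: "Dp (x + \<sigma> *\<^sub>R a + \<tau> *\<^sub>R b) (s *\<^sub>R b) = s * Dp (x + \<sigma> *\<^sub>R a + \<tau> *\<^sub>R b) b"
    using linear_scale[OF has_derivative_linear[OF p[OF S[OF \<sigma> \<tau>]]]] by simp
  show ?thesis
    using \<sigma> \<tau> e1 e2 e3 e4 by (intro bexI[of _ \<sigma>] bexI[of _ \<tau>]) (auto simp: power2_eq_square)
qed

text \<open>Schwarz's theorem: the second difference is symmetric in \<open>a\<close> and
  \<open>b\<close>, so the two mixed derivatives take a common value at points arbitrarily close to
  \<open>x\<close>, and continuity passes this to \<open>x\<close>.\<close>

lemma mixed_derivatives_eq: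
  fixes f :: "'a::real_normed_vector \<Rightarrow> real"
  assumes S: "open S" "x \<in> S"
    and f: "\<And>y. y \<in> S \<Longrightarrow> (f has_derivative Df y) (at y)"
    and p: "\<And>y. y \<in> S \<Longrightarrow> ((\<lambda>y. Df y a) has_derivative Dp y) (at y)"
    and q: "\<And>y. y \<in> S \<Longrightarrow> ((\<lambda>y. Df y b) has_derivative Dq y) (at y)"
    and cp: "continuous_on S (\<lambda>y. Dp y b)" and cq: "continuous_on S (\<lambda>y. Dq y a)"
  shows "Dp x b = Dq x a"
proof (rule ccontr)
  assume ne: "Dp x b \<noteq> Dq x a"
  define e where "e = \<bar>Dp x b - Dq x a\<bar> / 2"
  have e: "e > 0" using ne by (simp add: e_def)
  obtain d0 where d0: "d0 > 0" "ball x d0 \<subseteq> S" using S openE by blast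
  obtain d1 where d1: "d1 > 0" "\<And>y. y \<in> S \<Longrightarrow> dist y x < d1 \<Longrightarrow> \<bar>Dp y b - Dp x b\<bar> < e"
    using cp S e unfolding continuous_on_iff dist_real_def by metis
  obtain d2 where d2: "d2 > 0" "\<And>y. y \<in> S \<Longrightarrow> dist y x < d2 \<Longrightarrow> \<bar>Dq y a - Dq x a\<bar> < e"
    using cq S e unfolding continuous_on_iff dist_real_def by metis
  define d where "d = Min {d0, d1, d2}"
  have d: "d > 0" "d \<le> d0" "d \<le> d1" "d \<le> d2" using d0 d1 d2 by (auto simp: d_def)
  define N where "N = norm a + norm b + 1"
  have den: "N > 0" by (simp add: N_def add_nonneg_pos)
  define s where "s = d / N / 2"
  have s: "s > 0" unfolding s_def using d(1) den by simp
  have near: "dist (x + \<sigma> *\<^sub>R a + \<tau> *\<^sub>R b) x < d" if "\<sigma> \<in> {0..s}" "\<tau> \<in> {0..s}" for \<sigma> \<tau>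
  proof -
    have "norm (\<sigma> *\<^sub>R a + \<tau> *\<^sub>R b) \<le> norm (\<sigma> *\<^sub>R a) + norm (\<tau> *\<^sub>R b)" by (rule norm_triangle_ineq)
    also have "\<dots> \<le> s * norm a + s * norm b" using that by (auto intro!: add_mono mult_right_mono)
    also have "\<dots> \<le> s * N" using s by (simp add: N_def algebra_simps)
    also have "\<dots> = d / 2" using den by (simp add: s_def)
    also have "\<dots> < d" using d by simp
    finally have "norm (\<sigma> *\<^sub>R a + \<tau> *\<^sub>R b) < d" .
    moreover have "x + \<sigma> *\<^sub>R a + \<tau> *\<^sub>R b - x = \<sigma> *\<^sub>R a + \<tau> *\<^sub>R b" by simp
    ultimately show ?thesis by (simp only: dist_norm)
  qed
  have inS: "x + \<sigma> *\<^sub>R a + \<tau> *\<^sub>R b \<in> S" if "\<sigma> \<in> {0..s}" "\<tau> \<in> {0..s}" for \<sigma> \<tau>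
  proof -
    have "x + \<sigma> *\<^sub>R a + \<tau> *\<^sub>R b \<in> ball x d0"
      unfolding mem_ball dist_commute[of x] using near[OF that] d(2) by linarith
    then show ?thesis using d0(2) by (rule set_rev_mp)
  qed
  have inS': "x + \<tau> *\<^sub>R b + \<sigma> *\<^sub>R a \<in> S" if "\<tau> \<in> {0..s}" "\<sigma> \<in> {0..s}" for \<sigma> \<tau>
    using inS[OF that(2,1)] by (metis add.commute add.left_commute)
  have "\<exists>\<sigma>\<in>{0..s}. \<exists>\<tau>\<in>{0..s}. f (x + s *\<^sub>R a + s *\<^sub>R b) - f (x + s *\<^sub>R a) - f (x + s *\<^sub>R b) + f x
      = s\<^sup>2 * Dp (x + \<sigma> *\<^sub>R a + \<tau> *\<^sub>R b) b"
    by (rule second_difference_mvt[OF s, where S=S and Df=Df]) (fact f p inS)+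
  then obtain \<sigma> \<tau> where 1: "\<sigma> \<in> {0..s}" "\<tau> \<in> {0..s}"
    "f (x + s *\<^sub>R a + s *\<^sub>R b) - f (x + s *\<^sub>R a) - f (x + s *\<^sub>R b) + f x = s\<^sup>2 * Dp (x + \<sigma> *\<^sub>R a + \<tau> *\<^sub>R b) b"
    by (elim bexE) (rule that)
  have "\<exists>\<tau>\<in>{0..s}. \<exists>\<sigma>\<in>{0..s}. f (x + s *\<^sub>R b + s *\<^sub>R a) - f (x + s *\<^sub>R b) - f (x + s *\<^sub>R a) + f x
      = s\<^sup>2 * Dq (x + \<tau> *\<^sub>R b + \<sigma> *\<^sub>R a) a"
    by (rule second_difference_mvt[OF s, where S=S and Df=Df]) (fact f q inS')+
  then obtain \<sigma>' \<tau>' where 2: "\<sigma>' \<in> {0..s}" "\<tau>' \<in> {0..s}"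
    "f (x + s *\<^sub>R b + s *\<^sub>R a) - f (x + s *\<^sub>R b) - f (x + s *\<^sub>R a) + f x = s\<^sup>2 * Dq (x + \<tau>' *\<^sub>R b + \<sigma>' *\<^sub>R a) a"
    by (elim bexE) (rule that)
  have sw: "x + t *\<^sub>R b + r *\<^sub>R a = x + r *\<^sub>R a + t *\<^sub>R b" for r t
    by (metis add.assoc add.commute)
  have "s\<^sup>2 * Dp (x + \<sigma> *\<^sub>R a + \<tau> *\<^sub>R b) b = s\<^sup>2 * Dq (x + \<sigma>' *\<^sub>R a + \<tau>' *\<^sub>R b) a"
    using 1(3) 2(3) unfolding sw by linarith
  then have "Dp (x + \<sigma> *\<^sub>R a + \<tau> *\<^sub>R b) b = Dq (x + \<sigma>' *\<^sub>R a + \<tau>' *\<^sub>R b) a" using s by simp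
  moreover have "\<bar>Dp (x + \<sigma> *\<^sub>R a + \<tau> *\<^sub>R b) b - Dp x b\<bar> < e"
    using d1(2)[OF inS[OF 1(1,2)]] near[OF 1(1,2)] d by linarith
  moreover have "\<bar>Dq (x + \<sigma>' *\<^sub>R a + \<tau>' *\<^sub>R b) a - Dq x a\<bar> < e"
    using d2(2)[OF inS[OF 2(1,2)]] near[OF 2(1,2)] d by linarith
  moreover have "2 * e = \<bar>Dp x b - Dq x a\<bar>" by (simp add: e_def)
  ultimately show False by arith
qed

lemma pd_commute:
  fixes f :: "'a::euclidean_space \<Rightarrow> 'b::euclidean_space"
  assumes "open S" "smooth_on S f" "x \<in> S"
  shows "pd (pd f a) b x = pd (pd f b) a x"
proof (rule euclidean_eqI)
  fix e :: 'b assume "e \<in> Basis"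
  have d: "((\<lambda>x. g x \<bullet> e) has_derivative (\<lambda>h. pd g h y \<bullet> e)) (at y)"
    if "smooth_on S g" "y \<in> S" for g :: "'a \<Rightarrow> 'b" and y
    by (rule has_derivative_inner_left[OF smooth_on_has_derivative[OF that]])
  have c: "continuous_on S (\<lambda>x. pd (pd f v) w x \<bullet> e)" for v w
    by (intro continuous_on_inner continuous_on_const smooth_on_continuous_on smooth_on_pd assms)
  show "pd (pd f a) b x \<bullet> e = pd (pd f b) a x \<bullet> e"
    by (rule mixed_derivatives_eq[OF assms(1,3) d[OF assms(2)]
        d[OF smooth_on_pd[OF assms(2)]] d[OF smooth_on_pd[OF assms(2)]] c c])
qed

subsection \<open>Cutoff functions in one variable and Fubini's theorem in the plane\<close>

lemma integral_parabola:
  fixes A l :: real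
  assumes "l > 0"
  shows "integral {A..A + l} (\<lambda>t. (t - A) * (A + l - t)) = l ^ 3 / 6"
proof -
  have "((\<lambda>t. (t - A) * (A + l - t)) has_integral
      ((l * (A + l - A)\<^sup>2 / 2 - (A + l - A) ^ 3 / 3) - (l * (A - A)\<^sup>2 / 2 - (A - A) ^ 3 / 3))) {A..A + l}"
    by (rule fundamental_theorem_of_calculus)
      (use assms in \<open>auto intro!: derivative_eq_intros simp: has_real_derivative_iff_has_vector_derivative[symmetric]
        power2_eq_square field_simps\<close>)
  then show ?thesis by (simp add: integral_unique power2_eq_square power3_eq_cube)
qed

text \<open>The derivative is a normalised density: a parabola on the interval times a factor
  vanishing where a >= \<tau>. As in Chebyshev's inequality, the small integral of \<open>a\<close>
  costs at most half of the mass of the parabola, which keeps the slope of order 1 / l.\<close>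

lemma C1_step_avoiding_large_values:
  fixes a :: "real \<Rightarrow> real"
  assumes l: "l > 0" and \<tau>: "\<tau> > 0"
    and a: "continuous_on {A..A + l} a" "\<And>t. t \<in> {A..A + l} \<Longrightarrow> 0 \<le> a t"
    and small: "integral {A..A + l} a \<le> \<tau> * l / 3"
  obtains P P' where "\<And>t. (P has_real_derivative P' t) (at t)" "continuous_on UNIV P'"
    "\<And>t. t \<le> A \<Longrightarrow> P t = 0" "\<And>t. A + l \<le> t \<Longrightarrow> P t = 1"
    "\<And>t. 0 \<le> P t" "\<And>t. P t \<le> 1" "\<And>t. 0 \<le> P' t" "\<And>t. P' t \<le> 3 / l"
    "\<And>t. P' t \<noteq> 0 \<Longrightarrow> A < t \<and> t < A + l \<and> a t < \<tau>"
proof -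
  \<comment> \<open>Clamping the argument extends \<open>a\<close> continuously to the line, so the
    density has an antiderivative everywhere.\<close>
  define c where "c t = a (max A (min t (A + l)))" for t
  have cc: "continuous_on S c" for S
    unfolding c_def by (rule continuous_on_compose2[OF a(1)]) (use l in \<open>auto intro!: continuous_intros\<close>)
  have c_eq: "c t = a t" if "t \<in> {A..A + l}" for t using that by (simp add: c_def)
  define q where "q t = max 0 ((t - A) * (A + l - t))" for t
  define p where "p t = q t * max 0 (1 - c t / \<tau>)" for t
  have q0: "q t = 0" if "\<not> (A < t \<and> t < A + l)" for t
    using that l by (auto simp: q_def max_def not_less zero_le_mult_iff)
  have q_le: "q t \<le> l\<^sup>2 / 4" for t
  proof -
    have "(t - A) * (A + l - t) \<le> l\<^sup>2 / 4"
      using sum_squares_ge_zero[of "t - A - l / 2" 0] by (simp add: power2_eq_square algebra_simps)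
    moreover have "0 \<le> l\<^sup>2 / 4" by simp
    ultimately show ?thesis unfolding q_def by (rule max.boundedI[rotated])
  qed
  have q_nn: "0 \<le> q t" for t by (simp add: q_def)
  have pc: "continuous_on S p" for S
    unfolding p_def q_def by (intro continuous_intros cc) (use \<tau> in auto)
  have p_nn: "0 \<le> p t" for t by (simp add: p_def q_nn)
  have c_nn: "0 \<le> c t" for t unfolding c_def by (rule a(2)) (use l in auto)
  have p_le: "p t \<le> l\<^sup>2 / 4" for t
  proof -
    have "p t \<le> q t * 1" unfolding p_def using q_nn c_nn \<tau> by (intro mult_left_mono) auto
    with q_le[of t] show ?thesis by simp
  qed
  have "\<exists>F. \<forall>x::real. -\<infinity> < ereal x \<longrightarrow> ereal x < \<infinity> \<longrightarrow> (F has_vector_derivative p x) (at x)"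
    by (rule einterval_antiderivative) (use pc[of UNIV] in \<open>auto simp: continuous_on_eq_continuous_at\<close>)
  then obtain F where F: "\<And>x. (F has_real_derivative p x) (at x)"
    by (auto simp: has_real_derivative_iff_has_vector_derivative)
  define J where "J = F (A + l) - F A"
  have "(p has_integral J) {A..A + l}" unfolding J_def
    by (rule fundamental_theorem_of_calculus)
      (use l F in \<open>auto simp: has_real_derivative_iff_has_vector_derivative[symmetric] intro: has_field_derivative_at_within\<close>)
  then have "J = integral {A..A + l} p" by (simp add: integral_unique)
  also have "\<dots> \<ge> integral {A..A + l} (\<lambda>t. (t - A) * (A + l - t) - l\<^sup>2 / 4 / \<tau> * a t)"
  proof (rule integral_le)
    show "(\<lambda>t. (t - A) * (A + l - t) - l\<^sup>2 / 4 / \<tau> * a t) integrable_on {A..A + l}"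
      by (intro integrable_continuous_interval continuous_intros a)
    show "p integrable_on {A..A + l}" by (intro integrable_continuous_interval pc)
    fix t assume t: "t \<in> {A..A + l}"
    have "(t - A) * (A + l - t) = q t" using t by (auto simp: q_def max_def)
    moreover have "q t * (1 - c t / \<tau>) \<le> p t" unfolding p_def using q_nn by (intro mult_left_mono) auto
    moreover have "q t * (c t / \<tau>) \<le> l\<^sup>2 / 4 * (c t / \<tau>)"
      using q_le c_nn \<tau> by (intro mult_right_mono) auto
    ultimately show "(t - A) * (A + l - t) - l\<^sup>2 / 4 / \<tau> * a t \<le> p t"
      using c_eq[OF t] by (simp add: algebra_simps)
  qed
  also have "integral {A..A + l} (\<lambda>t. (t - A) * (A + l - t) - l\<^sup>2 / 4 / \<tau> * a t)
      = l ^ 3 / 6 - l\<^sup>2 / 4 / \<tau> * integral {A..A + l} a"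
  proof -
    have "integral {A..A + l} (\<lambda>t. (t - A) * (A + l - t) - l\<^sup>2 / 4 / \<tau> * a t)
      = integral {A..A + l} (\<lambda>t. (t - A) * (A + l - t)) - integral {A..A + l} (\<lambda>t. l\<^sup>2 / 4 / \<tau> * a t)"
      by (intro Henstock_Kurzweil_Integration.integral_diff integrable_continuous_interval continuous_intros a)
    then show ?thesis using integral_parabola[OF l] by simp
  qed
  also have "\<dots> \<ge> l ^ 3 / 6 - l\<^sup>2 / 4 / \<tau> * (\<tau> * l / 3)"
    using small \<tau> by (intro diff_left_mono mult_left_mono) auto
  also have "l ^ 3 / 6 - l\<^sup>2 / 4 / \<tau> * (\<tau> * l / 3) = l ^ 3 / 12"
    using \<tau> by (simp add: power2_eq_square power3_eq_cube)
  finally have J: "l ^ 3 / 12 \<le> J" by linarith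
  have l3: "0 < l ^ 3 / 12" using l by simp
  with J have J0: "J > 0" by linarith
  have const: "F t = F s" if "t \<le> s" "\<And>x. t < x \<Longrightarrow> x < s \<Longrightarrow> p x = 0" for t s
  proof (cases "t = s")
    case False
    then have "t < s" using that by simp
    then obtain z where "t < z" "z < s" "F s - F t = (s - t) * p z"
      using MVT2[of t s F p] F by auto
    then show ?thesis using that by simp
  qed simp
  have mono: "F s \<le> F t" if "s \<le> t" for s t
    using DERIV_nonneg_imp_nondecreasing[OF that, of F] F p_nn by blast
  show thesis
  proof (rule that[of "\<lambda>t. (F t - F A) / J" "\<lambda>t. p t / J"])
    show "((\<lambda>t. (F t - F A) / J) has_real_derivative p t / J) (at t)" for t
      using F J0 by (auto intro!: derivative_eq_intros)
    show "continuous_on UNIV (\<lambda>t. p t / J)" using J0 by (intro continuous_intros pc) auto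
    show lo: "(F t - F A) / J = 0" if "t \<le> A" for t
      using const[OF that] q0 by (simp add: p_def)
    show hi: "(F t - F A) / J = 1" if "A + l \<le> t" for t
      using const[OF that] q0 J0 by (simp add: p_def J_def)
    show "0 \<le> (F t - F A) / J" for t
      using mono[of A t] lo[of t] J0 by (cases "t \<le> A") auto
    show "(F t - F A) / J \<le> 1" for t
      using mono[of t "A + l"] hi[of t] J0 by (cases "A + l \<le> t") (auto simp: J_def)
    show "0 \<le> p t / J" for t using p_nn J0 by simp
    \<comment> \<open>The parabola peaks at l^2 / 4, and of its mass l^3 / 6 at least l^3 / 12
      survives; the quotient is 3 / l.\<close>
    have "p t / J \<le> (l\<^sup>2 / 4) / (l ^ 3 / 12)" for t
      using p_le J p_nn l3 by (intro frac_le) auto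
    then show "p t / J \<le> 3 / l" for t
      using l by (simp add: power2_eq_square power3_eq_cube)
    show "A < t \<and> t < A + l \<and> a t < \<tau>" if "p t / J \<noteq> 0" for t
    proof -
      have t: "A < t \<and> t < A + l" using that q0 by (auto simp: p_def)
      have "max 0 (1 - c t / \<tau>) \<noteq> 0" using that by (auto simp: p_def)
      then have "0 < 1 - c t / \<tau>" by linarith
      then show ?thesis using t c_eq[of t] \<tau> by (simp add: divide_less_eq)
    qed
  qed
qed

text \<open>On the interval \<open>g\<close> oscillates by at most \<open>k\<close> times the
  integral of \<open>b\<close>, and somewhere it does not exceed the mean of
  \<open>b\<close>.\<close>

lemma pointwise_le_integral_of_density:
  fixes g :: "real \<Rightarrow> real"
  assumes cd: "c < d" and t: "t \<in> {c..d}" and k: "k \<ge> 0"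
    and g: "\<And>s. s \<in> {c..d} \<Longrightarrow> (g has_real_derivative g' s) (at s within {c..d})"
    and g': "\<And>s. s \<in> {c..d} \<Longrightarrow> \<bar>g' s\<bar> \<le> k * b s"
    and b: "continuous_on {c..d} b" "\<And>s. s \<in> {c..d} \<Longrightarrow> g s \<le> b s" "\<And>s. s \<in> {c..d} \<Longrightarrow> 0 \<le> b s"
  shows "g t \<le> (1 / (d - c) + k) * integral {c..d} b"
proof -
  have incr: "\<bar>g s' - g s\<bar> \<le> k * integral {c..d} b" if s: "s \<in> {c..d}" "s' \<in> {c..d}" "s \<le> s'" for s s'
  proof -
    have sub: "{s..s'} \<subseteq> {c..d}" using s by auto
    have 1: "(g' has_integral (g s' - g s)) {s..s'}"
      by (rule fundamental_theorem_of_calculus)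
        (use s sub in \<open>auto simp: has_real_derivative_iff_has_vector_derivative[symmetric] intro!: DERIV_subset[OF g]\<close>)
    have 2: "b integrable_on {s..s'}" by (intro integrable_continuous_interval continuous_on_subset[OF b(1) sub])
    have "norm (integral {s..s'} g') \<le> integral {s..s'} (\<lambda>x. k * b x)"
      by (rule integral_norm_bound_integral) (use 1 2 g' sub in \<open>auto simp: integrable_on_def intro: has_integral_mult_right\<close>)
    also have "\<dots> = k * integral {s..s'} b" by simp
    also have "\<dots> \<le> k * integral {c..d} b"
      by (intro mult_left_mono integral_subset_le sub 2 integrable_continuous_interval b k) (use b in auto)
    finally show ?thesis using 1 by (simp add: integral_unique)
  qed
  have "g t - k * integral {c..d} b \<le> b s" if s: "s \<in> {c..d}" for s
    using incr[OF s t] incr[OF t s] b(2)[OF s] by (cases "s \<le> t") auto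
  then have "integral {c..d} (\<lambda>_. g t - k * integral {c..d} b) \<le> integral {c..d} b"
    by (intro integral_le integrable_continuous_interval b) auto
  then have "(g t - k * integral {c..d} b) * (d - c) \<le> integral {c..d} b"
    using cd by (simp add: mult.commute)
  then have "g t - k * integral {c..d} b \<le> integral {c..d} b / (d - c)"
    using cd by (simp add: pos_le_divide_eq)
  then show ?thesis by (simp add: algebra_simps)
qed

section \<open>Coordinates and Lebesgue measure in the plane\<close>

abbreviation e1 :: "real ^ 2" where "e1 \<equiv> axis 1 1"
abbreviation e2 :: "real ^ 2" where "e2 \<equiv> axis 2 1"

definition vec2 :: "real \<Rightarrow> real \<Rightarrow> real ^ 2" where "vec2 s t = s *\<^sub>R e1 + t *\<^sub>R e2"

lemma Basis_real2: "Basis = {e1, e2}" "e1 \<noteq> e2" "e2 \<noteq> e1"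
  by (auto simp: Basis_vec_def UNIV_2 axis_eq_axis)

lemma sum_Basis_real2: "(\<Sum>b\<in>Basis. f b) = f e1 + f e2" for f :: "real ^ 2 \<Rightarrow> 'b::comm_monoid_add"
  by (simp add: Basis_real2)

lemma inner_axis_real2[simp]: "e1 \<bullet> e1 = 1" "e2 \<bullet> e2 = 1" "e1 \<bullet> e2 = 0" "e2 \<bullet> e1 = 0"
  by (simp_all add: inner_axis_axis)

lemma vec2_inner[simp]: "vec2 s t \<bullet> e1 = s" "vec2 s t \<bullet> e2 = t"
  by (simp_all add: vec2_def inner_add_left)

lemma vec2_eta: "vec2 (x \<bullet> e1) (x \<bullet> e2) = x"
  using euclidean_representation[of x] by (simp add: vec2_def sum_Basis_real2)

lemma continuous_on_vec2[continuous_intros]: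
  "continuous_on S f \<Longrightarrow> continuous_on S g \<Longrightarrow> continuous_on S (\<lambda>x. vec2 (f x) (g x))"
  unfolding vec2_def by (intro continuous_intros)

text \<open>Values on boxes determine the measure. The push-forward form transports Fubini's theorem
  from pairs of reals to \<open>real ^ 2\<close>.\<close>

lemma lborel_real2: "lborel = distr (lborel :: (real \<times> real) measure) borel (\<lambda>(s, t). vec2 s t)"
proof (rule lborel_eqI)
  have m: "(\<lambda>(s, t). vec2 s t) \<in> borel_measurable (borel :: (real \<times> real) measure)"
    unfolding split_beta by (intro borel_measurable_continuous_onI continuous_intros)
  fix l u :: "real ^ 2" assume le: "\<And>b. b \<in> Basis \<Longrightarrow> l \<bullet> b \<le> u \<bullet> b"
  have "(\<lambda>(s, t). vec2 s t) -` box l u = box (l \<bullet> e1, l \<bullet> e2) (u \<bullet> e1, u \<bullet> e2)"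
    by (auto simp: box_def Basis_real2 Basis_prod_def)
  moreover have "emeasure lborel (box (l \<bullet> e1, l \<bullet> e2) (u \<bullet> e1, u \<bullet> e2)) = ennreal ((u \<bullet> e1 - l \<bullet> e1) * (u \<bullet> e2 - l \<bullet> e2))"
    using le[of e1] le[of e2] by (subst emeasure_lborel_box) (auto simp: Basis_prod_def Basis_real2)
  ultimately show "emeasure (distr lborel borel (\<lambda>(s, t). vec2 s t)) (box l u) = (\<Prod>b\<in>Basis. (u - l) \<bullet> b)"
    using m by (subst emeasure_distr) (auto simp: Basis_real2 inner_diff_left)
qed simp

lemma cbox_vec2: "vec2 s t \<in> cbox (vec2 a c) (vec2 b d) \<longleftrightarrow> s \<in> {a..b} \<and> t \<in> {c..d}"
  by (auto simp: mem_box Basis_real2)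

lemma integral_square_real2:
  fixes f :: "real ^ 2 \<Rightarrow> real"
  assumes f: "continuous_on (cbox (vec2 a c) (vec2 b d)) f"
  shows "integral (cbox (vec2 a c) (vec2 b d)) f = integral {a..b} (\<lambda>s. integral {c..d} (\<lambda>t. f (vec2 s t)))" (is ?A)
    and "integral (cbox (vec2 a c) (vec2 b d)) f = integral {c..d} (\<lambda>t. integral {a..b} (\<lambda>s. f (vec2 s t)))" (is ?B)
proof -
  let ?S = "cbox (vec2 a c) (vec2 b d)"
  have m[measurable]: "(\<lambda>(s, t). vec2 s t) \<in> borel_measurable (borel :: (real \<times> real) measure)"
    unfolding split_beta by (intro borel_measurable_continuous_onI continuous_intros)
  have fm[measurable]: "(\<lambda>x. indicator ?S x *\<^sub>R f x) \<in> borel_measurable borel"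
    using borel_integrable_compact[OF compact_cbox f] by (auto dest: borel_measurable_integrable)
  have c: "continuous_on (cbox (a, c) (b, d)) (\<lambda>(s, t). f (vec2 s t))"
    unfolding split_beta
    by (rule continuous_on_compose2[OF f]) (auto intro!: continuous_intros simp: cbox_vec2 cbox_Pair_eq)
  have "integral ?S f = integral\<^sup>L lborel (\<lambda>x. indicator ?S x *\<^sub>R f x)"
    using integrable_on_compact(3)[OF compact_cbox f] by (simp add: set_lebesgue_integral_def)
  also have "\<dots> = integral\<^sup>L lborel (\<lambda>x. indicator ?S (case x of (s, t) \<Rightarrow> vec2 s t) *\<^sub>R f (case x of (s, t) \<Rightarrow> vec2 s t))"
    using m fm by (subst lborel_real2, subst integral_distr) auto
  also have "\<dots> = integral\<^sup>L lborel (\<lambda>x. indicator (cbox (a, c) (b, d)) x *\<^sub>R (case x of (s, t) \<Rightarrow> f (vec2 s t)))"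
    by (rule Bochner_Integration.integral_cong) (auto simp: indicator_def cbox_vec2 cbox_Pair_eq)
  also have "\<dots> = integral (cbox (a, c) (b, d)) (\<lambda>(s, t). f (vec2 s t))"
    using integrable_on_compact(3)[OF compact_cbox c] by (simp add: set_lebesgue_integral_def)
  finally have *: "integral ?S f = integral (cbox (a, c) (b, d)) (\<lambda>(s, t). f (vec2 s t))" .
  show ?A using integral_prod_continuous[OF c] * by simp
  then show ?B using integral_swap_continuous[OF c] by simp
qed

subsection \<open>Multi-well potentials\<close>

lemma vec_expansion: "(\<Sum>i\<in>UNIV. (h $ i) *\<^sub>R axis i 1) = (h :: real ^ 'n)"
  using basis_expansion[of h] by (simp only: scalar_mult_eq_scaleR)

text \<open>The Hessian as a linear map in \<open>h\<close>, built from iterated directional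
  derivatives of \<open>V\<close>, for which smoothness gives continuity directly;
  \<open>hessian_mult\<close> identifies it with the matrix.\<close>

definition hess_apply :: "(real ^ 'k \<Rightarrow> real) \<Rightarrow> real ^ 'k \<Rightarrow> real ^ 'k \<Rightarrow> real ^ 'k" where
  "hess_apply V y h = (\<chi> i. pd (pd V (axis i 1)) h y)"

context
  fixes V :: "real ^ 'k \<Rightarrow> real"
  assumes smooth: "smooth_on UNIV V"
begin

lemma has_derivative_potential: "(V has_derivative (\<lambda>h. grad V y \<bullet> h)) (at y)"
proof -
  note d = smooth_on_has_derivative[OF smooth UNIV_I, of y]
  have "pd V h y = grad V y \<bullet> h" for h
  proof -
    have "pd V h y = pd V (\<Sum>i\<in>UNIV. (h $ i) *\<^sub>R axis i 1) y"
      by (simp only: vec_expansion)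
    also have "\<dots> = (\<Sum>i\<in>UNIV. h $ i * pd V (axis i 1) y)"
      by (simp only: linear_sum[OF has_derivative_linear[OF d]] linear_scale[OF has_derivative_linear[OF d]] real_scaleR_def)
    finally show ?thesis by (simp add: grad_def inner_vec_def mult.commute)
  qed
  with d show ?thesis by simp
qed

lemma has_derivative_grad: "(grad V has_derivative hess_apply V y) (at y)"
proof -
  have "((\<lambda>y. \<Sum>i\<in>UNIV. pd V (axis i 1) y *\<^sub>R (axis i 1 :: real ^ 'k)) has_derivative
      (\<lambda>h. \<Sum>i\<in>UNIV. pd (pd V (axis i 1)) h y *\<^sub>R axis i 1)) (at y)"
    by (intro has_derivative_sum has_derivative_scaleR_left smooth_on_has_derivative[OF smooth_on_pd[OF smooth]]) simp
  moreover have "(\<Sum>i\<in>UNIV. f i *\<^sub>R (axis i 1 :: real ^ 'k)) = (\<chi> i. f i)" for f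
    using vec_expansion[of "\<chi> i. f i"] by simp
  moreover have "grad V = (\<lambda>y. \<chi> i. pd V (axis i 1) y)" by (simp add: grad_def fun_eq_iff)
  moreover have "hess_apply V y = (\<lambda>h. \<chi> i. pd (pd V (axis i 1)) h y)"
    by (simp add: hess_apply_def fun_eq_iff)
  ultimately show ?thesis by simp
qed

lemma linear_hess_apply: "linear (hess_apply V y)"
  using has_derivative_linear[OF has_derivative_grad] .

lemma hess_apply_expansion: "hess_apply V y h = (\<Sum>j\<in>UNIV. (h $ j) *\<^sub>R hess_apply V y (axis j 1))"
proof -
  have "hess_apply V y h = hess_apply V y (\<Sum>j\<in>UNIV. (h $ j) *\<^sub>R axis j 1)"
    by (simp only: vec_expansion)
  then show ?thesis
    by (simp only: linear_sum[OF linear_hess_apply] linear_scale[OF linear_hess_apply])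
qed

lemma hessian_mult: "hessian V y *v h = hess_apply V y h"
proof -
  have "frechet_derivative (grad V) (at y) = hess_apply V y"
    using has_derivative_grad frechet_derivative_at by metis
  then have "hessian V y *v h = (\<Sum>j\<in>UNIV. (h $ j) *\<^sub>R hess_apply V y (axis j 1))"
    unfolding hessian_def by (simp add: vec_eq_iff matrix_def matrix_vector_mult_def mult.commute)
  then show ?thesis by (simp only: hess_apply_expansion[symmetric])
qed

text \<open>Joint continuity in base point and direction follows by expanding the direction in the
  standard basis.\<close>

lemma continuous_on_hess_apply[continuous_intros]:
  fixes f g :: "'b::topological_space \<Rightarrow> real ^ 'k"
  assumes f: "continuous_on S f" and g: "continuous_on S g"
  shows "continuous_on S (\<lambda>x. hess_apply V (f x) (g x))"
proof -
  have "continuous_on S (\<lambda>x. hess_apply V (f x) (axis j 1))" for j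
    unfolding hess_apply_def
    by (intro continuous_on_vec_lambda continuous_on_compose2[OF _ f, where t=UNIV]
        smooth_on_continuous_on smooth_on_pd smooth) auto
  then have "continuous_on S (\<lambda>x. \<Sum>j\<in>UNIV. (g x $ j) *\<^sub>R hess_apply V (f x) (axis j 1))"
    using g by (intro continuous_intros)
  then show ?thesis by (simp only: hess_apply_expansion[symmetric])
qed

lemma continuous_on_grad: "continuous_on S (grad V)"
  using has_derivative_grad by (meson continuous_at_imp_continuous_on has_derivative_continuous)

lemma continuous_on_potential: "continuous_on S V"
  using has_derivative_potential by (meson continuous_at_imp_continuous_on has_derivative_continuous)

lemma potential_mvt: "\<exists>\<theta>\<in>{0<..<1}. V (y + h) - V y = grad V (y + \<theta> *\<^sub>R h) \<bullet> h"
proof -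
  have "\<exists>\<theta>\<in>{0<..<1}. V (y + 1 *\<^sub>R h) - V (y + 0 *\<^sub>R h) = grad V (y + \<theta> *\<^sub>R h) \<bullet> ((1 - 0) *\<^sub>R h)"
  proof (rule mvt_simple)
    fix \<theta> :: real
    have "((\<lambda>\<theta>. V (y + \<theta> *\<^sub>R h)) has_derivative (\<lambda>s. grad V (y + \<theta> *\<^sub>R h) \<bullet> (s *\<^sub>R h))) (at \<theta>)"
      by (rule has_derivative_compose[where f="\<lambda>\<theta>. y + \<theta> *\<^sub>R h", OF _ has_derivative_potential])
        (auto intro!: derivative_eq_intros)
    then show "((\<lambda>\<theta>. V (y + \<theta> *\<^sub>R h)) has_derivative (\<lambda>s. grad V (y + \<theta> *\<^sub>R h) \<bullet> (s *\<^sub>R h))) (at \<theta> within {0..1})"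
      by (rule has_derivative_at_withinI)
  qed simp
  then show ?thesis by simp
qed

text \<open>The free parameter \<open>t\<close> serves two comparisons: t = 0 compares with the base
  point, while 0 < t < 1 compares with the intermediate point supplied by
  \<open>potential_mvt\<close>.\<close>

lemma grad_mvt:
  assumes "t \<le> (1::real)" "0 \<le> t"
  shows "\<exists>\<theta>\<in>{0..1}. (grad V (y + h) - grad V (y + t *\<^sub>R h)) \<bullet> h = (1 - t) * (hess_apply V (y + \<theta> *\<^sub>R h) h \<bullet> h)"
proof (cases "t = 1")
  case True then show ?thesis by (intro bexI[of _ 0]) auto
next
  case False
  with assms have "t < 1" by simp
  then have "\<exists>\<theta>\<in>{t<..<1}. grad V (y + 1 *\<^sub>R h) \<bullet> h - grad V (y + t *\<^sub>R h) \<bullet> h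
      = hess_apply V (y + \<theta> *\<^sub>R h) ((1 - t) *\<^sub>R h) \<bullet> h"
  proof (rule mvt_simple)
    fix \<theta> :: real
    have "((\<lambda>\<theta>. grad V (y + \<theta> *\<^sub>R h) \<bullet> h) has_derivative (\<lambda>s. hess_apply V (y + \<theta> *\<^sub>R h) (s *\<^sub>R h) \<bullet> h)) (at \<theta>)"
      by (rule has_derivative_inner_left, rule has_derivative_compose[where f="\<lambda>\<theta>. y + \<theta> *\<^sub>R h", OF _ has_derivative_grad])
        (auto intro!: derivative_eq_intros)
    then show "((\<lambda>\<theta>. grad V (y + \<theta> *\<^sub>R h) \<bullet> h) has_derivative (\<lambda>s. hess_apply V (y + \<theta> *\<^sub>R h) (s *\<^sub>R h) \<bullet> h)) (at \<theta> within {t..1})"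
      by (rule has_derivative_at_withinI)
  qed
  then obtain \<theta> where "\<theta> \<in> {t<..<1}" "grad V (y + 1 *\<^sub>R h) \<bullet> h - grad V (y + t *\<^sub>R h) \<bullet> h
      = hess_apply V (y + \<theta> *\<^sub>R h) ((1 - t) *\<^sub>R h) \<bullet> h" by (elim bexE) (rule that)
  then show ?thesis using assms linear_scale[OF linear_hess_apply]
    by (intro bexI[of _ \<theta>]) (auto simp: inner_diff_left)
qed

text \<open>Compactness of the ball times the unit sphere treats unit directions; linearity in
  \<open>h\<close> does the rest.\<close>

lemma hess_bounded:
  obtains \<Lambda> where "\<Lambda> > 0" "\<And>y h. norm y \<le> M \<Longrightarrow> norm (hess_apply V y h) \<le> \<Lambda> * norm h"
    "\<And>y h. norm y \<le> M \<Longrightarrow> \<bar>hess_apply V y h \<bullet> h\<bar> \<le> \<Lambda> * (norm h)\<^sup>2"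
proof -
  let ?K = "cball 0 M \<times> sphere 0 1 :: ((real ^ 'k) \<times> (real ^ 'k)) set"
  have "compact ((\<lambda>(y, h). hess_apply V y h) ` ?K)"
    unfolding split_beta by (intro compact_continuous_image continuous_intros compact_Times) auto
  then have "bounded ((\<lambda>(y, h). hess_apply V y h) ` ?K)" by (rule compact_imp_bounded)
  then obtain B where B: "\<And>y h. norm y \<le> M \<Longrightarrow> norm h = 1 \<Longrightarrow> norm (hess_apply V y h) \<le> B"
    unfolding bounded_iff by force
  define \<Lambda> where "\<Lambda> = max B 1"
  have n: "norm (hess_apply V y h) \<le> \<Lambda> * norm h" if "norm y \<le> M" for y h
  proof (cases "h = 0")
    case True then show ?thesis using linear_0[OF linear_hess_apply] by simp
  next
    case False
    have "norm (hess_apply V y ((1 / norm h) *\<^sub>R h)) \<le> \<Lambda>"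
      using B[OF that, of "(1 / norm h) *\<^sub>R h"] False by (simp add: \<Lambda>_def)
    moreover have "hess_apply V y ((1 / norm h) *\<^sub>R h) = (1 / norm h) *\<^sub>R hess_apply V y h"
      by (rule linear_scale[OF linear_hess_apply])
    ultimately show ?thesis using False by (simp add: divide_le_eq)
  qed
  show thesis
  proof
    show "\<Lambda> > 0" by (simp add: \<Lambda>_def)
    show "norm (hess_apply V y h) \<le> \<Lambda> * norm h" if "norm y \<le> M" for y h by (rule n[OF that])
    show "\<bar>hess_apply V y h \<bullet> h\<bar> \<le> \<Lambda> * (norm h)\<^sup>2" if "norm y \<le> M" for y h
    proof -
      have "\<bar>hess_apply V y h \<bullet> h\<bar> \<le> norm (hess_apply V y h) * norm h" by (rule Cauchy_Schwarz_ineq2)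
      also have "\<dots> \<le> \<Lambda> * norm h * norm h" by (intro mult_right_mono n that) auto
      finally show ?thesis by (simp add: power2_eq_square mult.assoc)
    qed
  qed
qed

text \<open>One gradient descent step from y to y - grad V(y) / N lowers \<open>V\<close> by at
  least |grad V(y)|^2 / (2 N), and the value after the step is still nonnegative.\<close>

lemma grad_sq_le_potential:
  assumes nn: "\<And>y. 0 \<le> V y"
  obtains K where "K > 0" "\<And>y. norm y \<le> M \<Longrightarrow> (norm (grad V y))\<^sup>2 \<le> K * V y"
proof -
  obtain \<Lambda> where \<Lambda>: "\<Lambda> > 0" "\<And>y h. norm y \<le> M + 1 \<Longrightarrow> \<bar>hess_apply V y h \<bullet> h\<bar> \<le> \<Lambda> * (norm h)\<^sup>2"
    using hess_bounded[of "M + 1"] by metis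
  have "bounded (grad V ` cball 0 M)"
    by (intro compact_imp_bounded compact_continuous_image continuous_on_grad) auto
  then obtain G where G: "\<And>y. norm y \<le> M \<Longrightarrow> norm (grad V y) \<le> G"
    unfolding bounded_iff by force
  \<comment> \<open>Large enough to dominate twice the second derivatives and to keep the step
    \<open>h\<close> of length at most 1, hence inside the ball of radius M + 1 on which \<Lambda>
    is valid.\<close>
  define N where "N = 2 * (\<Lambda> + max G 0 + 1)"
  have N: "N > 0" "\<Lambda> \<le> N / 2" "\<And>y. norm y \<le> M \<Longrightarrow> norm (grad V y) \<le> N"
    using \<Lambda> G by (force simp: N_def)+
  have "(norm (grad V y))\<^sup>2 \<le> (2 * N) * V y" if y: "norm y \<le> M" for y
  proof -
    define h where "h = (- 1 / N) *\<^sub>R grad V y"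
    have hn: "norm h \<le> 1" using N y by (simp add: h_def divide_le_eq)
    obtain \<theta> where \<theta>: "\<theta> \<in> {0<..<1}" "V (y + h) - V y = grad V (y + \<theta> *\<^sub>R h) \<bullet> h"
      using potential_mvt[of y h] by blast
    obtain \<theta>' where \<theta>': "\<theta>' \<in> {0..1}"
      "(grad V (y + \<theta> *\<^sub>R h) - grad V (y + 0 *\<^sub>R (\<theta> *\<^sub>R h))) \<bullet> (\<theta> *\<^sub>R h)
        = (1 - 0) * (hess_apply V (y + \<theta>' *\<^sub>R \<theta> *\<^sub>R h) (\<theta> *\<^sub>R h) \<bullet> (\<theta> *\<^sub>R h))"
      using grad_mvt[of 0 y "\<theta> *\<^sub>R h"] by auto
    let ?z = "y + \<theta>' *\<^sub>R \<theta> *\<^sub>R h"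
    have "\<theta>' * \<theta> * norm h \<le> 1 * 1 * 1" using \<theta> \<theta>' hn by (intro mult_mono) auto
    then have "norm (\<theta>' *\<^sub>R \<theta> *\<^sub>R h) \<le> 1" using \<theta> \<theta>' by (simp add: mult.assoc)
    then have z: "norm ?z \<le> M + 1" using norm_triangle_ineq[of y "\<theta>' *\<^sub>R \<theta> *\<^sub>R h"] y by linarith
    have "\<theta> * ((grad V (y + \<theta> *\<^sub>R h) - grad V y) \<bullet> h) = \<theta> * (\<theta> * (hess_apply V ?z h \<bullet> h))"
      using \<theta>'(2) linear_scale[OF linear_hess_apply] by simp
    then have "(grad V (y + \<theta> *\<^sub>R h) - grad V y) \<bullet> h = \<theta> * (hess_apply V ?z h \<bullet> h)"
      using \<theta> by simp
    also have "\<dots> \<le> \<theta> * (\<Lambda> * (norm h)\<^sup>2)"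
      using \<Lambda>(2)[OF z, of h] \<theta> by (intro mult_left_mono) (auto simp: abs_le_iff)
    also have "\<dots> \<le> 1 * (N / 2 * (norm h)\<^sup>2)"
      using \<theta> N \<Lambda> by (intro mult_mono mult_right_mono) auto
    finally have "V (y + h) \<le> V y + grad V y \<bullet> h + N / 2 * (norm h)\<^sup>2"
      using \<theta>(2) by (simp add: inner_diff_left)
    moreover have "grad V y \<bullet> h = - (norm (grad V y))\<^sup>2 / N"
      by (simp add: h_def power2_norm_eq_inner)
    moreover have "N / 2 * (norm h)\<^sup>2 = (norm (grad V y))\<^sup>2 / N / 2"
      using N by (simp add: h_def power_mult_distrib power2_eq_square)
    ultimately have "(norm (grad V y))\<^sup>2 / N / 2 \<le> V y" using nn[of "y + h"] by simp
    then show ?thesis using N by (simp add: divide_le_eq mult_ac)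
  qed
  then show thesis using N by (intro that[of "2 * N"]) auto
qed

text \<open>Half of the minimum of the quadratic form over the unit sphere at \<sigma> survives
  nearby by uniform continuity; homogeneity extends this to all vectors.\<close>

lemma hess_pos_def_near:
  assumes "positive_definite (hessian V \<sigma>)"
  shows "\<exists>\<kappa>>0. \<exists>\<rho>>0. \<forall>y\<in>ball \<sigma> \<rho>. \<forall>h. \<kappa> * (norm h)\<^sup>2 \<le> hess_apply V y h \<bullet> h"
proof -
  let ?S = "sphere 0 1 :: (real ^ 'k) set"
  let ?f = "\<lambda>(y, h). hess_apply V y h \<bullet> h"
  have c: "continuous_on (cball \<sigma> 1 \<times> ?S) ?f"
    unfolding split_beta by (intro continuous_intros)
  obtain h0 where h0: "h0 \<in> ?S" "\<And>h. h \<in> ?S \<Longrightarrow> hess_apply V \<sigma> h0 \<bullet> h0 \<le> hess_apply V \<sigma> h \<bullet> h"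
    using continuous_attains_inf[of ?S "\<lambda>h. hess_apply V \<sigma> h \<bullet> h"]
    by (force intro!: continuous_intros)
  define \<kappa> where "\<kappa> = hess_apply V \<sigma> h0 \<bullet> h0 / 2"
  have "h0 \<noteq> 0" using h0(1) by auto
  then have \<kappa>: "\<kappa> > 0"
    using assms by (simp add: \<kappa>_def positive_definite_def hessian_mult inner_commute)
  have uc: "uniformly_continuous_on (cball \<sigma> 1 \<times> ?S) ?f"
    using c by (intro compact_uniformly_continuous compact_Times) auto
  obtain d where d: "d > 0" and dd: "\<forall>p\<in>cball \<sigma> 1 \<times> ?S. \<forall>p'\<in>cball \<sigma> 1 \<times> ?S. dist p' p < d \<longrightarrow> dist (?f p') (?f p) < \<kappa>"
    using uc[unfolded uniformly_continuous_on_def, rule_format, OF \<kappa>] by (elim exE conjE) (rule that)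
  have unit: "\<kappa> \<le> hess_apply V y h \<bullet> h" if "y \<in> ball \<sigma> (min d 1)" "norm h = 1" for y h
  proof -
    have "dist (?f (y, h)) (?f (\<sigma>, h)) < \<kappa>"
      using that by (intro dd[rule_format]) (auto simp: dist_Pair_Pair dist_commute)
    moreover have "2 * \<kappa> \<le> ?f (\<sigma>, h)" using h0(2)[of h] that by (simp add: \<kappa>_def)
    ultimately show ?thesis by (simp add: dist_real_def abs_less_iff)
  qed
  have "\<kappa> * (norm h)\<^sup>2 \<le> hess_apply V y h \<bullet> h" if "y \<in> ball \<sigma> (min d 1)" for y h
  proof (cases "h = 0")
    case True then show ?thesis using linear_0[OF linear_hess_apply] by simp
  next
    case False
    have "\<kappa> \<le> hess_apply V y ((1 / norm h) *\<^sub>R h) \<bullet> ((1 / norm h) *\<^sub>R h)"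
      using False by (intro unit that) simp
    also have "\<dots> = (hess_apply V y h \<bullet> h) / (norm h)\<^sup>2"
      by (simp add: linear_scale[OF linear_hess_apply] power2_eq_square)
    finally show ?thesis using False by (simp add: pos_le_divide_eq)
  qed
  then show ?thesis using \<kappa> d by (intro exI[of _ \<kappa>] conjI exI[of _ "min d 1"]) auto
qed

text \<open>For d = y - \<sigma>, uniform convexity gives both V(y) <= grad V(y) . d and \<kappa>
  |d|^2 <= grad V(y) . d. By Cauchy-Schwarz the second yields \<kappa> |d| <= |grad V(y)|, which
  eliminates d from the first.\<close>

lemma potential_le_grad_sq:
  assumes nn: "\<And>y. 0 \<le> V y" and \<sigma>: "V \<sigma> = 0" and \<kappa>: "\<kappa> > 0"
    and H: "\<And>y h. y \<in> ball \<sigma> \<rho> \<Longrightarrow> \<kappa> * (norm h)\<^sup>2 \<le> hess_apply V y h \<bullet> h" and y: "y \<in> ball \<sigma> \<rho>"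
  shows "\<kappa> * V y \<le> (norm (grad V y))\<^sup>2"
proof -
  define d where "d = y - \<sigma>"
  have yd: "y = \<sigma> + d" by (simp add: d_def)
  \<comment> \<open>The bound |grad V|^2 <= K V turns V(\<sigma>) = 0 into a vanishing
    gradient.\<close>
  have g0: "grad V \<sigma> = 0"
    using grad_sq_le_potential[OF nn, of "norm \<sigma>"] \<sigma> by (metis mult_zero_right norm_le_zero_iff order_refl power2_less_eq_zero_iff norm_eq_zero)
  have inb: "\<sigma> + \<theta> *\<^sub>R d \<in> ball \<sigma> \<rho>" if "\<theta> \<in> {0..1}" for \<theta>
  proof -
    have "\<theta> * norm d \<le> 1 * norm d" using that by (intro mult_right_mono) auto
    then show ?thesis using y that by (simp add: dist_norm d_def norm_minus_commute)
  qed
  obtain \<theta>1 where \<theta>1: "\<theta>1 \<in> {0..1}" "(grad V (\<sigma> + d) - grad V (\<sigma> + 0 *\<^sub>R d)) \<bullet> d = (1 - 0) * (hess_apply V (\<sigma> + \<theta>1 *\<^sub>R d) d \<bullet> d)"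
    using grad_mvt[of 0 \<sigma> d] by auto
  have 1: "\<kappa> * (norm d)\<^sup>2 \<le> grad V y \<bullet> d"
    using \<theta>1(2) H[OF inb[OF \<theta>1(1)], of d] g0 yd by simp
  obtain \<theta> where \<theta>: "\<theta> \<in> {0<..<1}" "V (\<sigma> + d) - V \<sigma> = grad V (\<sigma> + \<theta> *\<^sub>R d) \<bullet> d"
    using potential_mvt[of \<sigma> d] by blast
  obtain \<theta>2 where \<theta>2: "\<theta>2 \<in> {0..1}" "(grad V (\<sigma> + d) - grad V (\<sigma> + \<theta> *\<^sub>R d)) \<bullet> d = (1 - \<theta>) * (hess_apply V (\<sigma> + \<theta>2 *\<^sub>R d) d \<bullet> d)"
    using grad_mvt[of \<theta> \<sigma> d] \<theta>(1) by auto
  have "0 \<le> \<kappa> * (norm d)\<^sup>2" using \<kappa> by simp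
  also have "\<dots> \<le> hess_apply V (\<sigma> + \<theta>2 *\<^sub>R d) d \<bullet> d" by (rule H[OF inb[OF \<theta>2(1)]])
  finally have "0 \<le> (1 - \<theta>) * (hess_apply V (\<sigma> + \<theta>2 *\<^sub>R d) d \<bullet> d)" using \<theta>(1) by simp
  then have 2: "V y \<le> grad V y \<bullet> d" using \<theta>(2) \<theta>2(2) \<sigma> yd by (simp add: inner_diff_left)
  have cs: "grad V y \<bullet> d \<le> norm (grad V y) * norm d" by (rule norm_cauchy_schwarz)
  have 3: "\<kappa> * norm d \<le> norm (grad V y)"
  proof (cases "d = 0")
    case False
    have "norm d * (\<kappa> * norm d) \<le> norm d * norm (grad V y)" using 1 cs by (simp add: power2_eq_square mult_ac)
    then show ?thesis using False by simp
  qed simp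
  have "\<kappa> * V y \<le> \<kappa> * (norm (grad V y) * norm d)" using 2 cs \<kappa> by (intro mult_left_mono) auto
  also have "\<dots> = norm (grad V y) * (\<kappa> * norm d)" by simp
  also have "\<dots> \<le> norm (grad V y) * norm (grad V y)" by (intro mult_left_mono 3) auto
  finally show ?thesis by (simp add: power2_eq_square)
qed

end

section \<open>The potential near the wells and at infinity\<close>

lemma multi_well_potential_nonneg:
  assumes "multi_well_potential V" shows "0 \<le> V y"
  using assms cINF_lower[of V UNIV y] unfolding multi_well_potential_def by auto

text \<open>Away from small balls around the wells, \<open>V\<close> has a positive minimum on the
  compact set {V <= 1}, so any smaller value forces \<open>y\<close> into a ball where the Hessian
  is uniformly positive. Smallness of V(u) alone thus gives convexity, and the later estimates need
  not know which well is near.\<close>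

lemma potential_near_wells:
  fixes V :: "real ^ 'k \<Rightarrow> real"
  assumes V: "multi_well_potential V" and \<mu>: "\<mu> > 0"
  obtains v0 \<kappa> where "v0 > 0" "\<kappa> > 0"
    "\<And>y. V y < v0 \<Longrightarrow> \<exists>\<sigma>\<in>wells V. y \<in> ball \<sigma> \<mu>"
    "\<And>y h. V y < v0 \<Longrightarrow> \<kappa> * (norm h)\<^sup>2 \<le> hess_apply V y h \<bullet> h"
    "\<And>y. V y < v0 \<Longrightarrow> \<kappa> * V y \<le> (norm (grad V y))\<^sup>2"
proof -
  have sm: "smooth_on UNIV V" and fin: "finite (wells V)" and ne: "wells V \<noteq> {}"
    and pd: "\<And>\<sigma>. \<sigma> \<in> wells V \<Longrightarrow> positive_definite (hessian V \<sigma>)"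
    and lim: "filterlim V at_top at_infinity"
    using V by (auto simp: multi_well_potential_def)
  note nn = multi_well_potential_nonneg[OF V]
  have "\<forall>\<sigma>\<in>wells V. \<exists>p. fst p > 0 \<and> snd p > 0 \<and> (\<forall>y\<in>ball \<sigma> (snd p). \<forall>h. fst p * (norm h)\<^sup>2 \<le> hess_apply V y h \<bullet> h)"
    using hess_pos_def_near[OF sm pd] by force
  then obtain p where p: "\<And>\<sigma>. \<sigma> \<in> wells V \<Longrightarrow> fst (p \<sigma>) > (0::real) \<and> snd (p \<sigma>) > 0 \<and>
     (\<forall>y\<in>ball \<sigma> (snd (p \<sigma>)). \<forall>h. fst (p \<sigma>) * (norm h)\<^sup>2 \<le> hess_apply V y h \<bullet> h)"
    by metis
  define \<kappa> where "\<kappa> = Min ((fst \<circ> p) ` wells V)"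
  define \<rho> where "\<rho> = min \<mu> (Min ((snd \<circ> p) ` wells V))"
  have \<kappa>: "\<kappa> > 0" "\<And>\<sigma>. \<sigma> \<in> wells V \<Longrightarrow> \<kappa> \<le> fst (p \<sigma>)"
    using fin ne p by (auto simp: \<kappa>_def)
  have \<rho>: "\<rho> > 0" "\<rho> \<le> \<mu>" "\<And>\<sigma>. \<sigma> \<in> wells V \<Longrightarrow> \<rho> \<le> snd (p \<sigma>)"
    using fin ne p \<mu> by (auto simp: \<rho>_def min_le_iff_disj)
  have H: "\<kappa> * (norm h)\<^sup>2 \<le> hess_apply V y h \<bullet> h" if "\<sigma> \<in> wells V" "y \<in> ball \<sigma> \<rho>" for \<sigma> y h
  proof -
    have "\<kappa> * (norm h)\<^sup>2 \<le> fst (p \<sigma>) * (norm h)\<^sup>2" by (intro mult_right_mono \<kappa> that) auto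
    also have "\<dots> \<le> hess_apply V y h \<bullet> h" using p[OF that(1)] that \<rho>(3)[OF that(1)] by auto
    finally show ?thesis .
  qed
  let ?K = "{y. V y \<le> 1} - (\<Union>\<sigma>\<in>wells V. ball \<sigma> \<rho>)"
  have "eventually (\<lambda>y. V y > 1) at_infinity" using lim by (simp add: filterlim_at_top_dense)
  then obtain b where b: "\<And>y. norm y \<ge> b \<Longrightarrow> V y > 1" unfolding eventually_at_infinity by auto
  have "bounded {y. V y \<le> 1}"
    unfolding bounded_iff by (rule exI[of _ b]) (use b in \<open>force simp: not_less[symmetric]\<close>)
  moreover have "closed {y. V y \<le> 1}"
    using continuous_on_potential[OF sm] by (intro closed_Collect_le) auto
  ultimately have K: "compact ?K"
    by (intro compact_diff) (auto simp: compact_eq_bounded_closed)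
  obtain m where m: "m > 0" "\<And>y. y \<in> ?K \<Longrightarrow> m \<le> V y"
  proof (cases "?K = {}")
    case True
    show ?thesis
    proof (rule that[of 1])
      show "1 \<le> V y" if "y \<in> ?K" for y using True that by blast
    qed simp
  next
    case False
    obtain y0 where y0: "y0 \<in> ?K" "\<forall>y\<in>?K. V y0 \<le> V y"
      using continuous_attains_inf[OF K False continuous_on_potential[OF sm]] by (elim bexE) (rule that)
    have "y0 \<notin> wells V" using y0(1) \<rho>(1) by auto
    then have "V y0 > 0" using nn[of y0] by (simp add: wells_def)
    then show ?thesis by (rule that) (use y0 in blast)
  qed
  have near: "\<exists>\<sigma>\<in>wells V. y \<in> ball \<sigma> \<rho>" if "V y < min 1 m" for y
    using m(2)[of y] that by fastforce
  show thesis
  proof (rule that[of "min 1 m" \<kappa>])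
    show "\<exists>\<sigma>\<in>wells V. y \<in> ball \<sigma> \<mu>" if "V y < min 1 m" for y
      using near[OF that] subset_ball[OF \<rho>(2)] by blast
    show "\<kappa> * (norm h)\<^sup>2 \<le> hess_apply V y h \<bullet> h" if "V y < min 1 m" for y h
      using near[OF that] H by blast
    show "\<kappa> * V y \<le> (norm (grad V y))\<^sup>2" if lt: "V y < min 1 m" for y
    proof -
      obtain \<sigma> where \<sigma>: "\<sigma> \<in> wells V" "y \<in> ball \<sigma> \<rho>" using near[OF lt] by blast
      show ?thesis
        by (rule potential_le_grad_sq[OF sm nn _ \<kappa>(1) H[OF \<sigma>(1)] \<sigma>(2)]) (use \<sigma> in \<open>auto simp: wells_def\<close>)
    qed
  qed (use m \<kappa> in auto)
qed

text \<open>Along the ray through \<open>y\<close>, the radial condition makes V(t y) - \<alpha> t^2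
  |y|^2 / 2 nondecreasing from the sphere of radius \<open>R\<close> outwards, so \<open>V\<close>
  dominates a quadratic there.\<close>

lemma potential_growth:
  fixes V :: "real ^ 'k \<Rightarrow> real"
  assumes V: "multi_well_potential V"
  obtains R \<beta> where "R > 0" "\<beta> > 0" "\<And>y. norm y > R \<Longrightarrow> 0 \<le> y \<bullet> grad V y"
    "\<And>y. (norm y)\<^sup>2 \<le> R\<^sup>2 + \<beta> * V y"
proof -
  have sm: "smooth_on UNIV V" using V by (auto simp: multi_well_potential_def)
  note nn = multi_well_potential_nonneg[OF V]
  obtain \<alpha> R where \<alpha>: "\<alpha> > 0" "R > 0" "\<And>y. norm y > R \<Longrightarrow> \<alpha> * (norm y)\<^sup>2 \<le> y \<bullet> grad V y"
    using V unfolding multi_well_potential_def by blast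
  have "(norm y)\<^sup>2 \<le> R\<^sup>2 + 2 / \<alpha> * V y" for y
  proof (cases "norm y \<le> R")
    case True
    then have "(norm y)\<^sup>2 \<le> R\<^sup>2" by (intro power_mono) auto
    moreover have "0 \<le> 2 / \<alpha> * V y" using nn \<alpha> by simp
    ultimately show ?thesis by linarith
  next
    case False
    then have ny: "norm y > R" by simp
    define t0 where "t0 = R / norm y"
    have t0: "0 < t0" "t0 < 1" "t0 * norm y = R" using ny \<alpha> by (auto simp: t0_def divide_less_eq_1 intro!: divide_pos_pos)
    have "\<exists>t\<in>{t0<..<1}. (V (1 *\<^sub>R y) - \<alpha> * 1\<^sup>2 * (norm y)\<^sup>2 / 2) - (V (t0 *\<^sub>R y) - \<alpha> * t0\<^sup>2 * (norm y)\<^sup>2 / 2)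
      = grad V (t *\<^sub>R y) \<bullet> ((1 - t0) *\<^sub>R y) - \<alpha> * t * (1 - t0) * (norm y)\<^sup>2"
    proof (rule mvt_simple[OF t0(2)])
      fix t :: real
      have "((\<lambda>t. V (t *\<^sub>R y)) has_derivative (\<lambda>s. grad V (t *\<^sub>R y) \<bullet> (s *\<^sub>R y))) (at t)"
        by (rule has_derivative_compose[where f="\<lambda>t. t *\<^sub>R y", OF _ has_derivative_potential[OF sm]])
          (auto intro!: derivative_eq_intros)
      then have "((\<lambda>t. V (t *\<^sub>R y) - \<alpha> * t\<^sup>2 * (norm y)\<^sup>2 / 2) has_derivative
         (\<lambda>s. grad V (t *\<^sub>R y) \<bullet> (s *\<^sub>R y) - \<alpha> * t * s * (norm y)\<^sup>2)) (at t)"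
        by (auto intro!: derivative_eq_intros simp: fun_eq_iff)
      then show "((\<lambda>t. V (t *\<^sub>R y) - \<alpha> * t\<^sup>2 * (norm y)\<^sup>2 / 2) has_derivative
         (\<lambda>s. grad V (t *\<^sub>R y) \<bullet> (s *\<^sub>R y) - \<alpha> * t * s * (norm y)\<^sup>2)) (at t within {t0..1})"
        by (rule has_derivative_at_withinI)
    qed
    then obtain t where t: "t \<in> {t0<..<1}" and
      e: "(V (1 *\<^sub>R y) - \<alpha> * 1\<^sup>2 * (norm y)\<^sup>2 / 2) - (V (t0 *\<^sub>R y) - \<alpha> * t0\<^sup>2 * (norm y)\<^sup>2 / 2)
      = grad V (t *\<^sub>R y) \<bullet> ((1 - t0) *\<^sub>R y) - \<alpha> * t * (1 - t0) * (norm y)\<^sup>2" by (elim bexE) (rule that)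
    have tn: "t * norm y > R" using t t0 ny \<alpha> by (metis greaterThanLessThan_iff mult_strict_right_mono less_trans)
    have "\<alpha> * (norm (t *\<^sub>R y))\<^sup>2 \<le> (t *\<^sub>R y) \<bullet> grad V (t *\<^sub>R y)"
      using t t0 tn by (intro \<alpha>(3)) auto
    then have "t * (\<alpha> * t * (norm y)\<^sup>2) \<le> t * (grad V (t *\<^sub>R y) \<bullet> y)"
      by (simp add: power_mult_distrib power2_eq_square inner_commute mult_ac)
    then have "\<alpha> * t * (norm y)\<^sup>2 \<le> grad V (t *\<^sub>R y) \<bullet> y" using t t0 by simp
    then have "(1 - t0) * (\<alpha> * t * (norm y)\<^sup>2) \<le> (1 - t0) * (grad V (t *\<^sub>R y) \<bullet> y)"
      using t0 by (intro mult_left_mono) auto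
    then have "\<alpha> * (norm y)\<^sup>2 / 2 - \<alpha> * t0\<^sup>2 * (norm y)\<^sup>2 / 2 \<le> V y - V (t0 *\<^sub>R y)"
      using e by (simp add: mult_ac)
    moreover have "t0\<^sup>2 * (norm y)\<^sup>2 = R\<^sup>2" using t0(3) by (metis power_mult_distrib)
    ultimately have "\<alpha> * (norm y)\<^sup>2 - \<alpha> * R\<^sup>2 \<le> 2 * V y"
      using nn[of "t0 *\<^sub>R y"] by (simp add: mult.assoc)
    then show ?thesis using \<alpha>(1) by (simp add: field_simps)
  qed
  moreover have "0 \<le> y \<bullet> grad V y" if "norm y > R" for y
    using order_trans[OF _ \<alpha>(3)[OF that], of 0] \<alpha>(1) by simp
  ultimately show thesis using \<alpha> by (intro that[of R "2 / \<alpha>"]) auto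
qed

subsection \<open>Weighted energy estimates\<close>

lemma norm_real2_sq: "(norm (x :: real ^ 2))\<^sup>2 = (x \<bullet> e1)\<^sup>2 + (x \<bullet> e2)\<^sup>2"
  unfolding power2_norm_eq_inner by (subst euclidean_inner) (simp add: sum_Basis_real2 power2_eq_square)

lemma cbox_subset_cball_real2: "0 \<le> r \<Longrightarrow> cbox (x0 - r *\<^sub>R One) (x0 + r *\<^sub>R One) \<subseteq> cball (x0 :: real ^ 2) (2 * r)"
proof
  fix x assume "x \<in> cbox (x0 - r *\<^sub>R One) (x0 + r *\<^sub>R One)"
  then have b: "\<bar>(x - x0) \<bullet> b\<bar> \<le> r" if "b \<in> Basis" for b
    using that by (force simp: mem_box inner_simps abs_le_iff)
  have "norm (x - x0) \<le> (\<Sum>b\<in>Basis. \<bar>(x - x0) \<bullet> b\<bar>)" by (rule norm_le_l1)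
  also have "\<dots> \<le> 2 * r" using b[of e1] b[of e2] by (simp add: sum_Basis_real2 Basis_real2)
  finally show "x \<in> cball x0 (2 * r)" by (simp add: dist_norm norm_minus_commute)
qed

lemma measure_cball_real2: "0 \<le> r \<Longrightarrow> measure lborel (cball (x0 :: real ^ 2) r) = pi * r\<^sup>2"
  using content_cball[of r x0] by (simp add: unit_ball_vol_2)

lemma bump_divergence_real2:
  fixes U :: "(real ^ 2) set"
  assumes U: "open U" "cball x0 r \<subseteq> U" and r: "0 \<le> r"
    and p1: "\<And>x. x \<in> U \<Longrightarrow> (p1 has_derivative D1 x) (at x)"
    and p2: "\<And>x. x \<in> U \<Longrightarrow> (p2 has_derivative D2 x) (at x)"
    and c: "continuous_on U (\<lambda>x. D1 x e1)" "continuous_on U (\<lambda>x. D2 x e2)"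
  shows "integral (cball x0 r) (\<lambda>x. bump_base x0 r x ^ 3 * (D1 x e1 + D2 x e2))
       = 6 * integral (cball x0 r) (\<lambda>x. (bump_base x0 r x)\<^sup>2 * (((x - x0) \<bullet> e1) * p1 x + ((x - x0) \<bullet> e2) * p2 x))"
proof -
  have "integral (cball x0 r) (\<lambda>x. bump_base x0 r x ^ 3 * (\<Sum>b\<in>Basis. (D1 x b *\<^sub>R e1 + D2 x b *\<^sub>R e2) \<bullet> b))
      = 6 * integral (cball x0 r) (\<lambda>x. (bump_base x0 r x)\<^sup>2 * ((x - x0) \<bullet> (p1 x *\<^sub>R e1 + p2 x *\<^sub>R e2)))"
  proof (rule integral_bump_divergence[OF U r])
    fix x assume "x \<in> U"
    then show "((\<lambda>x. p1 x *\<^sub>R e1 + p2 x *\<^sub>R e2) has_derivative (\<lambda>b. D1 x b *\<^sub>R e1 + D2 x b *\<^sub>R e2)) (at x)"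
      by (intro has_derivative_add has_derivative_scaleR_left p1 p2)
  next
    fix b :: "real ^ 2" assume "b \<in> Basis"
    then have "b = e1 \<or> b = e2" by (simp add: Basis_real2)
    then show "continuous_on U (\<lambda>x. (D1 x b *\<^sub>R e1 + D2 x b *\<^sub>R e2) \<bullet> b)"
      using c by (auto simp: inner_add_left)
  qed
  then show ?thesis by (simp add: sum_Basis_real2 inner_add_left inner_add_right mult.commute)
qed

lemma mean_value_real2:
  fixes w :: "real ^ 2 \<Rightarrow> real"
  assumes U: "open U" "cball x0 (2 * r) \<subseteq> U" and r: "r > 0"
    and w: "\<And>x. x \<in> U \<Longrightarrow> (w has_derivative (\<lambda>h. (h \<bullet> e1) * p1 x + (h \<bullet> e2) * p2 x)) (at x)"
    and p1: "\<And>x. x \<in> U \<Longrightarrow> (p1 has_derivative D1 x) (at x)"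
    and p2: "\<And>x. x \<in> U \<Longrightarrow> (p2 has_derivative D2 x) (at x)"
    and c: "continuous_on U (\<lambda>x. D1 x e1)" "continuous_on U (\<lambda>x. D2 x e2)"
    and div: "\<And>x. x \<in> U \<Longrightarrow> D1 x e1 + D2 x e2 \<ge> - A" and A: "A \<ge> 0"
    and pos: "\<And>x. x \<in> U \<Longrightarrow> w x \<ge> 0"
  shows "integral (cball 0 1) (\<lambda>y::real^2. (bump_base 0 1 y)\<^sup>2) * w x0
    \<le> integral (cball x0 r) w / r\<^sup>2 + pi * A * r\<^sup>2"
proof -
  have "integral (cball 0 1) (\<lambda>y::real^2. (bump_base 0 1 y)\<^sup>2) * w x0
    \<le> integral (cball x0 r) w / r ^ DIM(real^2) + measure lborel (cball (0::real^2) 1) * A * r\<^sup>2"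
  proof (rule mean_value_inequality[OF U(1) _ r, where Y="\<lambda>x. p1 x *\<^sub>R e1 + p2 x *\<^sub>R e2"
        and DY="\<lambda>x b. D1 x b *\<^sub>R e1 + D2 x b *\<^sub>R e2"])
    show "cbox (x0 - r *\<^sub>R One) (x0 + r *\<^sub>R One) \<subseteq> U"
      using cbox_subset_cball_real2[of r x0] r U by auto
    fix x assume x: "x \<in> U"
    show "(w has_derivative (\<lambda>h. (p1 x *\<^sub>R e1 + p2 x *\<^sub>R e2) \<bullet> h)) (at x)"
      using w[OF x] by (simp add: inner_add_left inner_commute[of e1] inner_commute[of e2] mult.commute)
    show "((\<lambda>x. p1 x *\<^sub>R e1 + p2 x *\<^sub>R e2) has_derivative (\<lambda>b. D1 x b *\<^sub>R e1 + D2 x b *\<^sub>R e2)) (at x)"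
      by (intro has_derivative_add has_derivative_scaleR_left p1 p2 x)
    show "- A \<le> (\<Sum>b\<in>Basis. (D1 x b *\<^sub>R e1 + D2 x b *\<^sub>R e2) \<bullet> b)"
      using div[OF x] by (simp add: sum_Basis_real2 inner_add_left)
  next
    fix b :: "real ^ 2" assume "b \<in> Basis"
    then have "b = e1 \<or> b = e2" by (simp add: Basis_real2)
    then show "continuous_on U (\<lambda>x. (D1 x b *\<^sub>R e1 + D2 x b *\<^sub>R e2) \<bullet> b)"
      using c by (auto simp: inner_add_left)
  qed (use A pos in auto)
  then show ?thesis by (simp add: measure_cball_real2)
qed

text \<open>The domain \<open>U\<close> is a parameter because uniform bounds on the solution hold
  only on smaller discs, on which the estimates are then instantiated again.\<close>

locale solution =
  fixes V :: "real ^ 'k \<Rightarrow> real" and \<epsilon> :: real and u :: "real ^ 2 \<Rightarrow> real ^ 'k" and U :: "(real ^ 2) set"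
  assumes V_smooth: "smooth_on UNIV V" and V_nonneg: "\<And>y. 0 \<le> V y"
    and eps_pos: "\<epsilon> > 0" and U_open: "open U" and sol: "is_solution V \<epsilon> U u"
begin

abbreviation "u1 \<equiv> pd u e1"
abbreviation "u2 \<equiv> pd u e2"

definition "w x = V (u x)"
definition "a x = (norm (u1 x))\<^sup>2 + (norm (u2 x))\<^sup>2"
definition "A x = w x + \<epsilon>\<^sup>2 / 2 * a x"

lemma u_smooth: "smooth_on U u" using sol by (simp add: is_solution_def)

lemma laplace: "x \<in> U \<Longrightarrow> pd u1 e1 x + pd u2 e2 x = (1 / \<epsilon>\<^sup>2) *\<^sub>R grad V (u x)"
  using sol unfolding is_solution_def laplacian_def sum_Basis_real2 neg_equal_iff_equal by blast

lemmas u_der = smooth_on_has_derivative[OF u_smooth]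
  and u1_der = smooth_on_has_derivative[OF smooth_on_pd[OF u_smooth, of e1]]
  and u2_der = smooth_on_has_derivative[OF smooth_on_pd[OF u_smooth, of e2]]

lemmas u_cont = smooth_on_continuous_on[OF u_smooth]
  and u1_cont = smooth_on_continuous_on[OF smooth_on_pd[OF u_smooth, of e1]]
  and u2_cont = smooth_on_continuous_on[OF smooth_on_pd[OF u_smooth, of e2]]
  and pdpd_cont = smooth_on_continuous_on[OF smooth_on_pd[OF smooth_on_pd[OF u_smooth]]]
  and pdpdpd_cont = smooth_on_continuous_on[OF smooth_on_pd[OF smooth_on_pd[OF smooth_on_pd[OF u_smooth]]]]

lemma pd_expand:
  assumes "smooth_on U f" "x \<in> U"
  shows "pd f h x = (h \<bullet> e1) *\<^sub>R pd f e1 x + (h \<bullet> e2) *\<^sub>R pd f e2 x"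
proof -
  have "pd f h x = pd f ((h \<bullet> e1) *\<^sub>R e1 + (h \<bullet> e2) *\<^sub>R e2) x" using vec2_eta[of h] by (simp add: vec2_def)
  also have "\<dots> = (h \<bullet> e1) *\<^sub>R pd f e1 x + (h \<bullet> e2) *\<^sub>R pd f e2 x"
    using has_derivative_linear[OF smooth_on_has_derivative[OF assms]]
    by (simp only: linear_add linear_scale)
  finally show ?thesis .
qed

lemma w_nonneg: "0 \<le> w x" by (simp add: w_def V_nonneg)
lemma a_nonneg: "0 \<le> a x" by (simp add: a_def)
lemma A_nonneg: "0 \<le> A x" by (simp add: A_def w_nonneg a_nonneg)
lemma w_le_A: "w x \<le> A x" by (simp add: A_def a_nonneg)
lemma a_le_A: "\<epsilon>\<^sup>2 * a x \<le> 2 * A x" using w_nonneg[of x] by (simp add: A_def)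

lemma w_cont: "continuous_on U w"
  unfolding w_def by (intro continuous_on_compose2[OF continuous_on_potential[OF V_smooth, of UNIV] u_cont]) auto
lemma a_cont: "continuous_on U a"
  unfolding a_def by (intro continuous_intros u1_cont u2_cont)
lemma A_cont: "continuous_on U A"
  unfolding A_def by (intro continuous_intros w_cont a_cont)

definition "w1 x = grad V (u x) \<bullet> u1 x"
definition "w2 x = grad V (u x) \<bullet> u2 x"

lemma gradu_cont: "continuous_on U (\<lambda>x. grad V (u x))"
  by (intro continuous_on_compose2[OF continuous_on_grad[OF V_smooth, of UNIV] u_cont]) auto

lemma w12_cont: "continuous_on U w1" "continuous_on U w2"
  unfolding w1_def w2_def by (intro continuous_intros gradu_cont u1_cont u2_cont)+

lemma w_der: "x \<in> U \<Longrightarrow> (w has_derivative (\<lambda>h. (h \<bullet> e1) * w1 x + (h \<bullet> e2) * w2 x)) (at x)"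
proof -
  assume x: "x \<in> U"
  have "(w has_derivative (\<lambda>h. grad V (u x) \<bullet> pd u h x)) (at x)"
    unfolding w_def by (rule has_derivative_compose[OF u_der[OF x] has_derivative_potential[OF V_smooth]])
  then show ?thesis
    by (subst (asm) pd_expand[OF u_smooth x]) (simp add: w1_def w2_def inner_add_right)
qed

lemma gradu_der: "x \<in> U \<Longrightarrow> ((\<lambda>x. grad V (u x)) has_derivative (\<lambda>h. hess_apply V (u x) (pd u h x))) (at x)"
  by (rule has_derivative_compose[OF u_der has_derivative_grad[OF V_smooth]])

definition "Dw1 x h = hess_apply V (u x) (pd u h x) \<bullet> u1 x + grad V (u x) \<bullet> pd u1 h x"
definition "Dw2 x h = hess_apply V (u x) (pd u h x) \<bullet> u2 x + grad V (u x) \<bullet> pd u2 h x"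

lemma w1_der: "x \<in> U \<Longrightarrow> (w1 has_derivative Dw1 x) (at x)"
  unfolding w1_def Dw1_def
  by (rule has_derivative_eq_rhs[OF has_derivative_inner[OF gradu_der u1_der]]) (auto simp: add.commute)

lemma w2_der: "x \<in> U \<Longrightarrow> (w2 has_derivative Dw2 x) (at x)"
  unfolding w2_def Dw2_def
  by (rule has_derivative_eq_rhs[OF has_derivative_inner[OF gradu_der u2_der]]) (auto simp: add.commute)

lemma Dw_cont: "continuous_on U (\<lambda>x. Dw1 x e1)" "continuous_on U (\<lambda>x. Dw2 x e2)"
  unfolding Dw1_def Dw2_def
  by (intro continuous_intros continuous_on_hess_apply[OF V_smooth] u_cont u1_cont u2_cont gradu_cont pdpd_cont)+

text \<open>The second derivatives of \<open>u\<close> enter only through its Laplacian paired with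
  grad V(u), which the equation turns into a square. Near a well both the Hessian terms and this
  square are coercive: they control |grad u|^2 and V(u) respectively.\<close>

lemma laplace_w: "x \<in> U \<Longrightarrow> Dw1 x e1 + Dw2 x e2 =
    hess_apply V (u x) (u1 x) \<bullet> u1 x + hess_apply V (u x) (u2 x) \<bullet> u2 x + (norm (grad V (u x)))\<^sup>2 / \<epsilon>\<^sup>2"
proof -
  assume x: "x \<in> U"
  have "grad V (u x) \<bullet> pd u1 e1 x + grad V (u x) \<bullet> pd u2 e2 x = grad V (u x) \<bullet> (pd u1 e1 x + pd u2 e2 x)"
    by (simp add: inner_add_right)
  also have "\<dots> = (norm (grad V (u x)))\<^sup>2 / \<epsilon>\<^sup>2"
    by (subst laplace[OF x]) (simp add: power2_norm_eq_inner)
  finally show ?thesis by (simp add: Dw1_def Dw2_def)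
qed

lemma w_grad_sq: "(w1 x)\<^sup>2 + (w2 x)\<^sup>2 \<le> (norm (grad V (u x)))\<^sup>2 * a x"
proof -
  have "(w1 x)\<^sup>2 \<le> (norm (grad V (u x)) * norm (u1 x))\<^sup>2" "(w2 x)\<^sup>2 \<le> (norm (grad V (u x)) * norm (u2 x))\<^sup>2"
    unfolding w1_def w2_def by (intro abs_le_square_iff[THEN iffD1], simp add: Cauchy_Schwarz_ineq2)+
  then show ?thesis by (simp add: a_def power_mult_distrib algebra_simps)
qed

text \<open>The chain rule and |grad V|^2 <= K V bound |grad w|^2 by K w a; the inequality between
  arithmetic and geometric mean puts w a below (A / \<epsilon>)^2.\<close>

lemma w_grad_sq_le:
  assumes K: "K > 0" and gK: "(norm (grad V (u x)))\<^sup>2 \<le> K * w x"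
  shows "(w1 x)\<^sup>2 + (w2 x)\<^sup>2 \<le> (sqrt K * (A x / \<epsilon>))\<^sup>2"
proof -
  have "0 \<le> (w x - \<epsilon>\<^sup>2 * a x / 2)\<^sup>2" by simp
  then have "w x * (\<epsilon>\<^sup>2 * a x) * 2 \<le> (w x + \<epsilon>\<^sup>2 / 2 * a x)\<^sup>2"
    by (simp add: power2_eq_square algebra_simps)
  moreover have "0 \<le> w x * (\<epsilon>\<^sup>2 * a x)" using w_nonneg a_nonneg by simp
  ultimately have "w x * (\<epsilon>\<^sup>2 * a x) \<le> (A x)\<^sup>2" unfolding A_def by linarith
  then have wa: "w x * a x \<le> (A x / \<epsilon>)\<^sup>2" using eps_pos by (simp add: power_divide pos_le_divide_eq mult_ac)
  have "(w1 x)\<^sup>2 + (w2 x)\<^sup>2 \<le> K * w x * a x"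
    using w_grad_sq[of x] mult_right_mono[OF gK a_nonneg[of x]] by linarith
  also have "\<dots> \<le> K * (A x / \<epsilon>)\<^sup>2"
    using K wa by (simp add: mult.assoc)
  also have "\<dots> = (sqrt K * (A x / \<epsilon>))\<^sup>2" unfolding power_mult_distrib using K by simp
  finally show ?thesis .
qed

text \<open>The weight \<open>h\<close> localises to the set where \<open>V (u x)\<close> is small and \<open>V\<close> is uniformly convex.\<close>

lemma weighted_energy_bound:
  assumes B: "cball x0 r \<subseteq> U" and r: "r > 0" and K: "K > 0" and \<kappa>: "\<kappa> > 0"
    and gK: "\<And>x. x \<in> cball x0 r \<Longrightarrow> (norm (grad V (u x)))\<^sup>2 \<le> K * w x"
    and h: "\<And>s. s \<ge> 0 \<Longrightarrow> (h has_real_derivative h' s) (at s)" "continuous_on {0..} h'"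
    and h_nn: "\<And>s. s \<ge> 0 \<Longrightarrow> 0 \<le> h s" and h_le: "\<And>s. s \<ge> 0 \<Longrightarrow> h s \<le> H"
    and convex: "\<And>x \<xi>. x \<in> cball x0 r \<Longrightarrow> h (w x) \<noteq> 0 \<Longrightarrow> \<kappa> * (norm \<xi>)\<^sup>2 \<le> hess_apply V (u x) \<xi> \<bullet> \<xi>"
    and coercive: "\<And>x. x \<in> cball x0 r \<Longrightarrow> h (w x) \<noteq> 0 \<Longrightarrow> \<kappa> * w x \<le> (norm (grad V (u x)))\<^sup>2"
  shows "\<kappa> * integral (cball x0 r) (\<lambda>x. bump_base x0 r x ^ 3 * h (w x) * A x)
    \<le> K * integral (cball x0 r) (\<lambda>x. bump_base x0 r x ^ 3 * (\<bar>h' (w x)\<bar> * w x) * (\<epsilon>\<^sup>2 * a x))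
      + 6 * r ^ 5 * H * sqrt K * \<epsilon> * integral (cball x0 r) A"
proof -
  let ?B = "cball x0 r" and ?m = "bump_base x0 r"
  have hc: "continuous_on {0..} h"
    using h(1) by (intro continuous_at_imp_continuous_on ballI DERIV_isCont) auto
  have hw: "continuous_on U (\<lambda>x. h (w x))" and h'w: "continuous_on U (\<lambda>x. h' (w x))"
    by (rule continuous_on_compose2[OF hc w_cont] continuous_on_compose2[OF h(2) w_cont]; simp add: w_nonneg image_subset_iff)+
  \<comment> \<open>Derivatives of the components of the field h(w) grad w, whose divergence is h(w)
    \<Delta>w + h'(w) |grad w|^2.\<close>
  define D1 where "D1 x t = h (w x) * Dw1 x t + h' (w x) * ((t \<bullet> e1) * w1 x + (t \<bullet> e2) * w2 x) * w1 x" for x t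
  define D2 where "D2 x t = h (w x) * Dw2 x t + h' (w x) * ((t \<bullet> e1) * w1 x + (t \<bullet> e2) * w2 x) * w2 x" for x t
  have hder: "((\<lambda>x. h (w x)) has_derivative (\<lambda>t. h' (w x) * ((t \<bullet> e1) * w1 x + (t \<bullet> e2) * w2 x))) (at x)"
    if "x \<in> U" for x
    using has_derivative_compose[OF w_der[OF that] h(1)[OF w_nonneg, unfolded has_field_derivative_def]] .
  have id: "integral ?B (\<lambda>x. ?m x ^ 3 * (D1 x e1 + D2 x e2))
       = 6 * integral ?B (\<lambda>x. (?m x)\<^sup>2 * (((x - x0) \<bullet> e1) * (h (w x) * w1 x) + ((x - x0) \<bullet> e2) * (h (w x) * w2 x)))"
  proof (rule bump_divergence_real2[OF U_open B])
    show "((\<lambda>x. h (w x) * w1 x) has_derivative D1 x) (at x)" if "x \<in> U" for x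
      unfolding D1_def by (rule has_derivative_eq_rhs[OF has_derivative_mult[OF hder[OF that] w1_der[OF that]]]) simp
    show "((\<lambda>x. h (w x) * w2 x) has_derivative D2 x) (at x)" if "x \<in> U" for x
      unfolding D2_def by (rule has_derivative_eq_rhs[OF has_derivative_mult[OF hder[OF that] w2_der[OF that]]]) simp
    show "continuous_on U (\<lambda>x. D1 x e1)" "continuous_on U (\<lambda>x. D2 x e2)"
      unfolding D1_def D2_def by (intro continuous_intros hw h'w Dw_cont w12_cont)+
  qed (use r in auto)
  note cB = continuous_on_subset[OF _ B]
  have int[simp, intro]: "f integrable_on ?B" if "continuous_on U f" for f :: "real ^ 2 \<Rightarrow> real"
    using cB[OF that] by (rule integrable_on_compact(1)[OF compact_cball])
  note cint = continuous_intros hw h'w Dw_cont w12_cont w_cont a_cont A_cont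
  define P where "P x = ?m x ^ 3 * h (w x) * A x" for x
  define Q where "Q x = ?m x ^ 3 * (\<bar>h' (w x)\<bar> * w x) * (\<epsilon>\<^sup>2 * a x)" for x
  have Pc: "continuous_on U P" and Qc: "continuous_on U Q"
    unfolding P_def Q_def by (intro cint)+
  \<comment> \<open>After multiplication by \<epsilon>^2 the term with \<Delta>w dominates \<kappa>
    h A, because convexity and coercivity hold wherever h(w) is nonzero; the term with h' has no
    sign and is moved into \<open>Q\<close>.\<close>
  have lower: "\<kappa> * P x - K * Q x \<le> \<epsilon>\<^sup>2 * (?m x ^ 3 * (D1 x e1 + D2 x e2))" if x: "x \<in> ?B" for x
  proof -
    have xU: "x \<in> U" using x B by auto
    have D: "D1 x e1 + D2 x e2 = h (w x) * (Dw1 x e1 + Dw2 x e2) + h' (w x) * ((w1 x)\<^sup>2 + (w2 x)\<^sup>2)"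
      by (simp add: D1_def D2_def power2_eq_square algebra_simps)
    have 1: "\<kappa> * (h (w x) * A x) \<le> \<epsilon>\<^sup>2 * (h (w x) * (Dw1 x e1 + Dw2 x e2))"
    proof (cases "h (w x) = 0")
      case False
      have "\<kappa> * (a x + w x / \<epsilon>\<^sup>2) \<le> Dw1 x e1 + Dw2 x e2"
      proof -
        have "\<kappa> * w x / \<epsilon>\<^sup>2 \<le> (norm (grad V (u x)))\<^sup>2 / \<epsilon>\<^sup>2"
          by (rule divide_right_mono[OF coercive[OF x False]]) simp
        then show ?thesis
          using convex[OF x False, of "u1 x"] convex[OF x False, of "u2 x"]
          unfolding laplace_w[OF xU] a_def by (simp add: algebra_simps)
      qed
      then have "\<epsilon>\<^sup>2 * (\<kappa> * (a x + w x / \<epsilon>\<^sup>2)) \<le> \<epsilon>\<^sup>2 * (Dw1 x e1 + Dw2 x e2)" by (intro mult_left_mono) auto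
      then have "\<kappa> * (w x + \<epsilon>\<^sup>2 * a x) \<le> \<epsilon>\<^sup>2 * (Dw1 x e1 + Dw2 x e2)"
        using eps_pos by (simp add: algebra_simps)
      moreover have "\<kappa> * A x \<le> \<kappa> * (w x + \<epsilon>\<^sup>2 * a x)"
        using \<kappa> a_nonneg[of x] by (simp add: A_def)
      ultimately have "\<kappa> * A x \<le> \<epsilon>\<^sup>2 * (Dw1 x e1 + Dw2 x e2)" by linarith
      then have "h (w x) * (\<kappa> * A x) \<le> h (w x) * (\<epsilon>\<^sup>2 * (Dw1 x e1 + Dw2 x e2))"
        using h_nn[OF w_nonneg] by (intro mult_left_mono) auto
      then show ?thesis by (simp add: mult_ac)
    qed simp
    have "(w1 x)\<^sup>2 + (w2 x)\<^sup>2 \<le> K * w x * a x"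
      using w_grad_sq[of x] mult_right_mono[OF gK[OF x] a_nonneg[of x]] by linarith
    then have "\<bar>h' (w x)\<bar> * ((w1 x)\<^sup>2 + (w2 x)\<^sup>2) \<le> \<bar>h' (w x)\<bar> * (K * w x * a x)"
      by (intro mult_left_mono) auto
    moreover have "- \<bar>h' (w x)\<bar> * ((w1 x)\<^sup>2 + (w2 x)\<^sup>2) \<le> h' (w x) * ((w1 x)\<^sup>2 + (w2 x)\<^sup>2)"
      by (intro mult_right_mono, linarith, simp)
    ultimately have "- (\<bar>h' (w x)\<bar> * (K * w x * a x)) \<le> h' (w x) * ((w1 x)\<^sup>2 + (w2 x)\<^sup>2)" by simp
    then have 2: "\<epsilon>\<^sup>2 * - (\<bar>h' (w x)\<bar> * (K * w x * a x)) \<le> \<epsilon>\<^sup>2 * (h' (w x) * ((w1 x)\<^sup>2 + (w2 x)\<^sup>2))"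
      by (intro mult_left_mono) auto
    have "\<kappa> * (h (w x) * A x) - K * (\<bar>h' (w x)\<bar> * w x * (\<epsilon>\<^sup>2 * a x)) \<le> \<epsilon>\<^sup>2 * (D1 x e1 + D2 x e2)"
      using 1 2 unfolding D by (simp add: algebra_simps)
    then have "?m x ^ 3 * (\<kappa> * (h (w x) * A x) - K * (\<bar>h' (w x)\<bar> * w x * (\<epsilon>\<^sup>2 * a x))) \<le> ?m x ^ 3 * (\<epsilon>\<^sup>2 * (D1 x e1 + D2 x e2))"
      by (intro mult_left_mono) auto
    then show ?thesis by (simp add: P_def Q_def algebra_simps)
  qed
  \<comment> \<open>The flux term: r^4 bounds m^2, another r bounds |x - x0|, and |grad w| <= sqrt K
    A / \<epsilon> leaves a single factor \<epsilon> after multiplication by \<epsilon>^2.\<close>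
  have upper: "\<epsilon>\<^sup>2 * (6 * ((?m x)\<^sup>2 * (((x - x0) \<bullet> e1) * (h (w x) * w1 x) + ((x - x0) \<bullet> e2) * (h (w x) * w2 x))))
      \<le> 6 * r ^ 5 * H * sqrt K * \<epsilon> * A x" if x: "x \<in> ?B" for x
  proof -
    let ?v = "w1 x *\<^sub>R e1 + w2 x *\<^sub>R e2"
    have vn: "norm ?v \<le> sqrt K * (A x / \<epsilon>)"
    proof -
      have "(norm ?v)\<^sup>2 = (w1 x)\<^sup>2 + (w2 x)\<^sup>2"
        by (simp add: norm_real2_sq inner_add_left)
      also note w_grad_sq_le[OF K gK[OF x]]
      finally have sq: "(norm ?v)\<^sup>2 \<le> (sqrt K * (A x / \<epsilon>))\<^sup>2" .
      have "0 \<le> sqrt K * (A x / \<epsilon>)" using K A_nonneg[of x] eps_pos by simp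
      with sq show ?thesis by (rule power2_le_imp_le)
    qed
    have xr: "norm (x - x0) \<le> r" using x by (simp add: dist_norm norm_minus_commute)
    have Hn: "0 \<le> H" using h_nn[OF w_nonneg] h_le[OF w_nonneg] by (rule order_trans)
    have "((x - x0) \<bullet> e1) * (h (w x) * w1 x) + ((x - x0) \<bullet> e2) * (h (w x) * w2 x) = h (w x) * ((x - x0) \<bullet> ?v)"
      by (simp add: inner_add_right algebra_simps)
    also have "\<dots> \<le> h (w x) * (norm (x - x0) * norm ?v)"
      by (intro mult_left_mono norm_cauchy_schwarz h_nn w_nonneg)
    also have "\<dots> \<le> H * (r * (sqrt K * (A x / \<epsilon>)))"
      using r Hn by (intro mult_mono h_le w_nonneg xr vn) auto
    finally have 1: "((x - x0) \<bullet> e1) * (h (w x) * w1 x) + ((x - x0) \<bullet> e2) * (h (w x) * w2 x) \<le> H * (r * (sqrt K * (A x / \<epsilon>)))" .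
    have nn: "0 \<le> H * (r * (sqrt K * (A x / \<epsilon>)))"
      using Hn r K A_nonneg[of x] eps_pos by simp
    have "(?m x)\<^sup>2 \<le> (r\<^sup>2)\<^sup>2" by (intro power_mono bump_base_le) auto
    then have "(?m x)\<^sup>2 * (H * (r * (sqrt K * (A x / \<epsilon>)))) \<le> (r\<^sup>2)\<^sup>2 * (H * (r * (sqrt K * (A x / \<epsilon>))))"
      using nn by (intro mult_right_mono)
    with mult_left_mono[OF 1, of "(?m x)\<^sup>2"]
    have "(?m x)\<^sup>2 * (((x - x0) \<bullet> e1) * (h (w x) * w1 x) + ((x - x0) \<bullet> e2) * (h (w x) * w2 x)) \<le> (r\<^sup>2)\<^sup>2 * (H * (r * (sqrt K * (A x / \<epsilon>))))"
      by simp
    then have "\<epsilon>\<^sup>2 * (6 * ((?m x)\<^sup>2 * (((x - x0) \<bullet> e1) * (h (w x) * w1 x) + ((x - x0) \<bullet> e2) * (h (w x) * w2 x))))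
      \<le> \<epsilon>\<^sup>2 * (6 * ((r\<^sup>2)\<^sup>2 * (H * (r * (sqrt K * (A x / \<epsilon>))))))"
      by (intro mult_left_mono) auto
    also have "\<dots> = 6 * r ^ 5 * H * sqrt K * \<epsilon> * A x"
      using eps_pos by (simp add: power2_eq_square eval_nat_numeral)
    finally show ?thesis .
  qed
  have "\<kappa> * integral ?B P - K * integral ?B Q = integral ?B (\<lambda>x. \<kappa> * P x - K * Q x)"
    by (simp add: Henstock_Kurzweil_Integration.integral_diff Pc Qc continuous_on_mult_left)
  also have "\<dots> \<le> integral ?B (\<lambda>x. \<epsilon>\<^sup>2 * (?m x ^ 3 * (D1 x e1 + D2 x e2)))"
    by (intro integral_le int lower) (auto simp: D1_def D2_def intro!: cint Pc Qc)
  also have "\<dots> = integral ?B (\<lambda>x. \<epsilon>\<^sup>2 * (6 * ((?m x)\<^sup>2 * (((x - x0) \<bullet> e1) * (h (w x) * w1 x) + ((x - x0) \<bullet> e2) * (h (w x) * w2 x)))))"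
    using id by simp
  also have "\<dots> \<le> integral ?B (\<lambda>x. 6 * r ^ 5 * H * sqrt K * \<epsilon> * A x)"
    by (intro integral_le int upper) (auto intro!: cint)
  also have "\<dots> = 6 * r ^ 5 * H * sqrt K * \<epsilon> * integral ?B A" by simp
  finally show ?thesis unfolding P_def[abs_def] Q_def[abs_def] by linarith
qed

end

subsection \<open>Uniform bounds\<close>

text \<open>A convex C2 substitute for the positive part, lying between s - 2 and max 0 s. Vanishing
  to third order makes two derivatives match at 0, and the denominator keeps the growth
  linear.\<close>

definition ramp :: "real \<Rightarrow> real" where "ramp s = (max 0 s) ^ 3 / (1 + max 0 s)\<^sup>2"
definition ramp' :: "real \<Rightarrow> real" where "ramp' s = (max 0 s)\<^sup>2 * (max 0 s + 3) / (1 + max 0 s) ^ 3"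
definition ramp'' :: "real \<Rightarrow> real" where "ramp'' s = 6 * max 0 s / (1 + max 0 s) ^ 4"

text \<open>Only the point 0 is delicate: since \<open>f\<close> vanishes there, f(max 0 z) is a
  continuous slope function from both sides and Caratheodory's criterion applies.\<close>

lemma DERIV_max_0_product:
  fixes f F :: "real \<Rightarrow> real"
  assumes F: "\<And>s. F s = max 0 s * f (max 0 s)" and f: "continuous_on {0..} f" "f 0 = 0"
    and D: "\<And>s. s > 0 \<Longrightarrow> ((\<lambda>s. s * f s) has_real_derivative d s) (at s)"
    and d: "\<And>s. s \<le> 0 \<Longrightarrow> d s = 0"
  shows "(F has_real_derivative d s) (at s)"
proof -
  consider "s < 0" | "s = 0" | "s > 0" by linarith
  then show ?thesis
  proof cases
    case 1
    show ?thesis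
      by (rule has_field_derivative_transform_within_open[of "\<lambda>_. 0" _ _ "{..<0}"]) (use 1 in \<open>auto simp: F d\<close>)
  next
    case 2
    have "\<forall>z. F z - F s = f (max 0 z) * (z - s)"
      using 2 f(2) by (auto simp: F max_def)
    moreover have "isCont (\<lambda>z. f (max 0 z)) s"
    proof -
      have "continuous_on UNIV (\<lambda>z. f (max 0 z))"
        by (intro continuous_on_compose2[OF f(1)] continuous_intros) auto
      then show ?thesis by (simp add: continuous_on_eq_continuous_at)
    qed
    moreover have "f (max 0 s) = d s" using 2 f(2) d[of s] by simp
    ultimately show ?thesis
      unfolding CARAT_DERIV by (intro exI[of _ "\<lambda>z. f (max 0 z)"]) simp
  next
    case 3
    show ?thesis
      by (rule has_field_derivative_transform_within_open[OF D[OF 3], of "{0<..}"]) (use 3 in \<open>auto simp: F\<close>)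
  qed
qed

lemma DERIV_ramp: "(ramp has_real_derivative ramp' s) (at s)"
proof (rule DERIV_max_0_product[where f="\<lambda>s. s\<^sup>2 / (1 + s)\<^sup>2"])
  fix s :: real assume s: "s > 0"
  define p where "p = 1 + s"
  have p: "p \<noteq> 0" using s by (simp add: p_def)
  have "((\<lambda>s. s ^ 3 / (1 + s)\<^sup>2) has_real_derivative (3 * s\<^sup>2 * p\<^sup>2 - s ^ 3 * (2 * p)) / (p\<^sup>2 * p\<^sup>2)) (at s)"
    using p unfolding p_def by (auto intro!: derivative_eq_intros)
  also have "3 * s\<^sup>2 * p\<^sup>2 - s ^ 3 * (2 * p) = (s\<^sup>2 * (s + 3)) * p"
    by (simp add: p_def power2_eq_square power3_eq_cube algebra_simps)
  also have "(s\<^sup>2 * (s + 3)) * p / (p\<^sup>2 * p\<^sup>2) = ramp' s"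
    using p s by (simp add: ramp'_def p_def[symmetric] power2_eq_square power3_eq_cube)
  finally show "((\<lambda>s. s * (s\<^sup>2 / (1 + s)\<^sup>2)) has_real_derivative ramp' s) (at s)"
    by (simp add: power2_eq_square power3_eq_cube mult.assoc)
qed (auto intro!: continuous_intros simp: ramp_def ramp'_def power2_eq_square power3_eq_cube)

lemma DERIV_ramp': "(ramp' has_real_derivative ramp'' s) (at s)"
proof (rule DERIV_max_0_product[where f="\<lambda>s. s * (s + 3) / (1 + s) ^ 3"])
  fix s :: real assume s: "s > 0"
  define p where "p = 1 + s"
  have p: "p \<noteq> 0" using s by (simp add: p_def)
  have "((\<lambda>s. (s ^ 3 + 3 * s\<^sup>2) / (1 + s) ^ 3) has_real_derivative
     ((3 * s\<^sup>2 + 6 * s) * p ^ 3 - (s ^ 3 + 3 * s\<^sup>2) * (3 * p\<^sup>2)) / (p ^ 3 * p ^ 3)) (at s)"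
    using p unfolding p_def by (auto intro!: derivative_eq_intros)
  also have "(3 * s\<^sup>2 + 6 * s) * p ^ 3 - (s ^ 3 + 3 * s\<^sup>2) * (3 * p\<^sup>2) = (6 * s) * p\<^sup>2"
    by (simp add: p_def power2_eq_square power3_eq_cube algebra_simps)
  also have "(6 * s) * p\<^sup>2 / (p ^ 3 * p ^ 3) = ramp'' s"
    using p s by (simp add: ramp''_def p_def[symmetric] eval_nat_numeral)
  finally show "((\<lambda>s. s * (s * (s + 3) / (1 + s) ^ 3)) has_real_derivative ramp'' s) (at s)"
    by (simp add: power2_eq_square power3_eq_cube algebra_simps)
qed (auto intro!: continuous_intros simp: ramp'_def ramp''_def power2_eq_square power3_eq_cube)

lemma ramp_nonneg: "0 \<le> ramp s" "0 \<le> ramp' s" "0 \<le> ramp'' s"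
  by (auto simp: ramp_def ramp'_def ramp''_def)

lemma ramp'_eq_0: "s \<le> 0 \<Longrightarrow> ramp' s = 0" by (simp add: ramp'_def)

lemma continuous_on_ramp: "continuous_on S ramp'" "continuous_on S ramp''"
  unfolding ramp'_def ramp''_def by (intro continuous_intros; auto simp: add_nonneg_eq_0_iff)+

lemma ramp_le: "ramp s \<le> max 0 s"
proof -
  define p where "p = max 0 s"
  have p: "p \<ge> 0" by (simp add: p_def)
  have "p ^ 3 \<le> p * (1 + p)\<^sup>2" using p by (simp add: power2_eq_square power3_eq_cube algebra_simps)
  then show ?thesis using p by (simp add: ramp_def p_def[symmetric] divide_le_eq)
qed

lemma ramp_ge: "s - 2 \<le> ramp s"
proof -
  define p where "p = max 0 s"
  have p: "p \<ge> 0" "s \<le> p" by (auto simp: p_def)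
  have "(p - 2) * (1 + p)\<^sup>2 \<le> p ^ 3" using p by (simp add: power2_eq_square power3_eq_cube algebra_simps)
  then have "p - 2 \<le> p ^ 3 / (1 + p)\<^sup>2" using p by (simp add: pos_le_divide_eq)
  then show ?thesis using p by (simp add: ramp_def p_def[symmetric])
qed

abbreviation bump_mass :: real where
  "bump_mass \<equiv> integral (cball 0 1) (\<lambda>y::real^2. (bump_base 0 1 y)\<^sup>2)"

context solution
begin

lemma a_inner: "a x = u1 x \<bullet> u1 x + u2 x \<bullet> u2 x"
  by (simp add: a_def power2_norm_eq_inner)

text \<open>The Laplacian of |u|^2 is 2 |grad u|^2 + 2 u . grad V(u) / \<epsilon>^2, which is
  nonnegative where |u| > R. Composing |u|^2 - R^2 with a convex nondecreasing function that
  vanishes for negative arguments makes it subharmonic on all of \<open>U\<close>, and the growth of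
  \<open>V\<close> bounds its average by the potential energy.\<close>

lemma sup_bound:
  assumes B: "cball x0 (2 * r) \<subseteq> U" and r: "r > 0" and R: "R > 0" and \<beta>: "\<beta> > 0"
    and out: "\<And>y. norm y > R \<Longrightarrow> 0 \<le> y \<bullet> grad V y"
    and growth: "\<And>y. (norm y)\<^sup>2 \<le> R\<^sup>2 + \<beta> * V y"
  shows "bump_mass * ((norm (u x0))\<^sup>2 - R\<^sup>2 - 2) \<le> \<beta> * integral (cball x0 r) w / r\<^sup>2"
proof -
  define s where "s x = u x \<bullet> u x - R\<^sup>2" for x
  define W where "W x = ramp (s x)" for x
  define p1 where "p1 x = ramp' (s x) * (2 * (u x \<bullet> u1 x))" for x
  define p2 where "p2 x = ramp' (s x) * (2 * (u x \<bullet> u2 x))" for x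
  define D1 where "D1 x t = ramp'' (s x) * (2 * (u x \<bullet> pd u t x)) * (2 * (u x \<bullet> u1 x))
    + ramp' (s x) * (2 * (pd u t x \<bullet> u1 x + u x \<bullet> pd u1 t x))" for x t
  define D2 where "D2 x t = ramp'' (s x) * (2 * (u x \<bullet> pd u t x)) * (2 * (u x \<bullet> u2 x))
    + ramp' (s x) * (2 * (pd u t x \<bullet> u2 x + u x \<bullet> pd u2 t x))" for x t
  have sder: "(s has_derivative (\<lambda>t. 2 * (u x \<bullet> pd u t x))) (at x)" if "x \<in> U" for x
    unfolding s_def
    by (rule has_derivative_eq_rhs[OF has_derivative_diff[OF has_derivative_inner[OF u_der[OF that] u_der[OF that]] has_derivative_const]])
      (simp add: inner_commute)
  have rder: "((\<lambda>x. ramp' (s x)) has_derivative (\<lambda>t. ramp'' (s x) * (2 * (u x \<bullet> pd u t x)))) (at x)" if "x \<in> U" for x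
    using has_derivative_compose[OF sder[OF that] DERIV_ramp'[unfolded has_field_derivative_def]] .
  have sc: "continuous_on U s" unfolding s_def by (intro continuous_intros u_cont)
  have cU: "cball x0 r \<subseteq> U" using B r by (auto intro: order_trans[rotated])
  have "bump_mass * W x0 \<le> integral (cball x0 r) W / r\<^sup>2 + pi * 0 * r\<^sup>2"
  proof (rule mean_value_real2[OF U_open B r, where ?p1.0=p1 and ?p2.0=p2 and ?D1.0=D1 and ?D2.0=D2])
    fix x assume x: "x \<in> U"
    have "(W has_derivative (\<lambda>t. ramp' (s x) * (2 * (u x \<bullet> pd u t x)))) (at x)"
      unfolding W_def using has_derivative_compose[OF sder[OF x] DERIV_ramp[unfolded has_field_derivative_def]] .
    then show "(W has_derivative (\<lambda>h. (h \<bullet> e1) * p1 x + (h \<bullet> e2) * p2 x)) (at x)"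
      by (subst (asm) pd_expand[OF u_smooth x]) (simp add: p1_def p2_def inner_add_right algebra_simps)
    show "(p1 has_derivative D1 x) (at x)"
      unfolding p1_def D1_def
      by (rule has_derivative_eq_rhs[OF has_derivative_mult[OF rder[OF x]
            has_derivative_mult_right[OF has_derivative_inner[OF u_der[OF x] u1_der[OF x]]]]])
        (simp add: algebra_simps)
    show "(p2 has_derivative D2 x) (at x)"
      unfolding p2_def D2_def
      by (rule has_derivative_eq_rhs[OF has_derivative_mult[OF rder[OF x]
            has_derivative_mult_right[OF has_derivative_inner[OF u_der[OF x] u2_der[OF x]]]]])
        (simp add: algebra_simps)
    have "D1 x e1 + D2 x e2 = 4 * ramp'' (s x) * ((u x \<bullet> u1 x)\<^sup>2 + (u x \<bullet> u2 x)\<^sup>2)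
        + 2 * (ramp' (s x) * a x) + 2 * (ramp' (s x) * (u x \<bullet> (pd u1 e1 x + pd u2 e2 x)))"
      by (simp add: D1_def D2_def a_inner inner_add_right power2_eq_square algebra_simps)
    moreover have "0 \<le> 4 * ramp'' (s x) * ((u x \<bullet> u1 x)\<^sup>2 + (u x \<bullet> u2 x)\<^sup>2)" by (simp add: ramp_nonneg)
    moreover have "0 \<le> ramp' (s x) * a x" by (simp add: ramp_nonneg a_nonneg)
    moreover have "0 \<le> ramp' (s x) * (u x \<bullet> (pd u1 e1 x + pd u2 e2 x))"
    proof (cases "s x \<le> 0")
      case True then show ?thesis by (simp add: ramp'_eq_0)
    next
      case False
      then have "R\<^sup>2 < (norm (u x))\<^sup>2" by (simp add: s_def power2_norm_eq_inner)
      then have "R < norm (u x)" by (rule power2_less_imp_less) simp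
      then have "0 \<le> u x \<bullet> grad V (u x)" by (rule out)
      then show ?thesis unfolding laplace[OF x] by (simp add: ramp_nonneg)
    qed
    ultimately show "- 0 \<le> D1 x e1 + D2 x e2" by linarith
    show "0 \<le> W x" by (simp add: W_def ramp_nonneg)
  next
    have c: "continuous_on U (\<lambda>x. ramp' (s x))" "continuous_on U (\<lambda>x. ramp'' (s x))"
      by (rule continuous_on_compose2[OF continuous_on_ramp(1)[of UNIV] sc] continuous_on_compose2[OF continuous_on_ramp(2)[of UNIV] sc]; simp)+
    show "continuous_on U (\<lambda>x. D1 x e1)" "continuous_on U (\<lambda>x. D2 x e2)"
      unfolding D1_def D2_def by (intro continuous_intros c u_cont u1_cont u2_cont pdpd_cont)+
  qed simp
  moreover have "integral (cball x0 r) W \<le> integral (cball x0 r) (\<lambda>x. \<beta> * w x)"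
  proof (rule integral_le)
    have "continuous_on U W"
      unfolding W_def using DERIV_ramp
      by (intro continuous_on_compose2[OF _ sc, of UNIV] continuous_at_imp_continuous_on ballI DERIV_isCont) auto
    then show "W integrable_on cball x0 r" by (intro integrable_on_compact continuous_on_subset[OF _ cU]) auto
    show "(\<lambda>x. \<beta> * w x) integrable_on cball x0 r"
      by (intro integrable_on_compact continuous_on_subset[OF _ cU] continuous_intros w_cont) auto
    fix x
    have "0 \<le> \<beta> * w x" using \<beta> w_nonneg by simp
    moreover have "s x \<le> \<beta> * w x" using growth[of "u x"] by (simp add: s_def w_def power2_norm_eq_inner)
    ultimately show "W x \<le> \<beta> * w x" using ramp_le[of "s x"] by (simp add: W_def)
  qed
  then have "integral (cball x0 r) W / r\<^sup>2 \<le> \<beta> * integral (cball x0 r) w / r\<^sup>2" by (intro divide_right_mono) auto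
  moreover have "bump_mass * ((norm (u x0))\<^sup>2 - R\<^sup>2 - 2) \<le> bump_mass * W x0"
    using ramp_ge[of "s x0"] less_imp_le[OF bump_mass_pos] by (intro mult_left_mono) (auto simp: W_def s_def power2_norm_eq_inner)
  ultimately show ?thesis by simp
qed

section \<open>The linearised equation and interior gradient bounds\<close>

lemma pd_cong: "x \<in> U \<Longrightarrow> (\<And>y. y \<in> U \<Longrightarrow> f y = g y) \<Longrightarrow> smooth_on U f \<Longrightarrow> pd f h x = pd g h x"
  using frechet_derivative_transform_within_open[of f x U g] U_open smooth_on_has_derivative
  by (metis differentiableI)

text \<open>Differentiate the equation in direction \<open>b\<close> and interchange derivatives:
  directional derivatives of a solution solve the linearised system.\<close>

lemma laplace_pd:
  assumes x: "x \<in> U"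
  shows "pd (pd (pd u b) e1) e1 x + pd (pd (pd u b) e2) e2 x = (1 / \<epsilon>\<^sup>2) *\<^sub>R hess_apply V (u x) (pd u b x)"
proof -
  have sm: "smooth_on U (pd u c)" "smooth_on U (pd (pd u c) d)" for c d
    by (intro smooth_on_pd u_smooth)+
  have c: "pd (pd (pd u b) e) e x = pd (pd (pd u e) e) b x" for e
    using pd_cong[OF x pd_commute[OF U_open u_smooth] sm(2)] pd_commute[OF U_open sm(1) x] by metis
  have d1: "((\<lambda>x. pd u1 e1 x + pd u2 e2 x) has_derivative (\<lambda>h. pd (pd u1 e1) h x + pd (pd u2 e2) h x)) (at x)"
    by (intro has_derivative_add smooth_on_has_derivative[OF sm(2) x])
  have d2: "((\<lambda>x. pd u1 e1 x + pd u2 e2 x) has_derivative (\<lambda>h. (1 / \<epsilon>\<^sup>2) *\<^sub>R hess_apply V (u x) (pd u h x))) (at x)"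
    by (rule has_derivative_transform_within_open[OF has_derivative_scaleR_right[OF gradu_der[OF x]] U_open x])
      (simp only: laplace)
  have "pd (pd u1 e1) b x + pd (pd u2 e2) b x = (1 / \<epsilon>\<^sup>2) *\<^sub>R hess_apply V (u x) (pd u b x)"
    by (rule fun_cong[OF has_derivative_unique[OF d1 d2]])
  then show ?thesis by (simp only: c)
qed

text \<open>The equation is tested with \<open>u\<close> itself: the field with components u . u1
  and u . u2 has divergence |grad u|^2 + u . grad V(u) / \<epsilon>^2, and Young's inequality
  absorbs the flux into half of the weighted gradient integral.\<close>

lemma caccioppoli_inequality:
  assumes B: "cball x0 (2 * r) \<subseteq> U" and r: "r > 0"
    and M: "M \<ge> 0" "\<And>x. x \<in> U \<Longrightarrow> norm (u x) \<le> M" and G: "G \<ge> 0" "\<And>x. x \<in> U \<Longrightarrow> norm (grad V (u x)) \<le> G"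
  shows "integral (cball x0 r) a \<le> 4 * pi * (22 * M\<^sup>2 + 5 * M * G * r\<^sup>2 / \<epsilon>\<^sup>2)"
proof -
  let ?B = "cball x0 (2 * r)" and ?m = "bump_base x0 (2 * r)"
  define D1 where "D1 x t = pd u t x \<bullet> u1 x + u x \<bullet> pd u1 t x" for x t
  define D2 where "D2 x t = pd u t x \<bullet> u2 x + u x \<bullet> pd u2 t x" for x t
  have id: "integral ?B (\<lambda>x. ?m x ^ 3 * (D1 x e1 + D2 x e2))
       = 6 * integral ?B (\<lambda>x. (?m x)\<^sup>2 * (((x - x0) \<bullet> e1) * (u x \<bullet> u1 x) + ((x - x0) \<bullet> e2) * (u x \<bullet> u2 x)))"
  proof (rule bump_divergence_real2[OF U_open B])
    fix x assume x: "x \<in> U"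
    show "((\<lambda>x. u x \<bullet> u1 x) has_derivative D1 x) (at x)"
      unfolding D1_def by (rule has_derivative_eq_rhs[OF has_derivative_inner[OF u_der[OF x] u1_der[OF x]]]) (simp add: add.commute)
    show "((\<lambda>x. u x \<bullet> u2 x) has_derivative D2 x) (at x)"
      unfolding D2_def by (rule has_derivative_eq_rhs[OF has_derivative_inner[OF u_der[OF x] u2_der[OF x]]]) (simp add: add.commute)
  next
    show "continuous_on U (\<lambda>x. D1 x e1)" "continuous_on U (\<lambda>x. D2 x e2)"
      unfolding D1_def D2_def by (intro continuous_intros u_cont u1_cont u2_cont pdpd_cont)+
  qed (use r in auto)
  \<comment> \<open>\<open>C1\<close> comes from m <= 4 r^2 on the disc of radius 2 r, hence m^3 <=
    64 r^6; \<open>C2\<close> is 4 r^2 times the remainder 72 r^2 M^2 of Young's inequality.\<close>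
  define C1 where "C1 = 64 * r ^ 6 * M * G / \<epsilon>\<^sup>2"
  define C2 where "C2 = 288 * r ^ 4 * M\<^sup>2"
  have m4: "?m x \<le> 4 * r\<^sup>2" for x using bump_base_le[of x0 "2 * r" x] by (simp add: power_mult_distrib)
  have int: "f integrable_on ?B" if "continuous_on U f" for f :: "real ^ 2 \<Rightarrow> real"
    using continuous_on_subset[OF that B] by (rule integrable_on_compact(1)[OF compact_cball])
  note cint = continuous_intros u_cont u1_cont u2_cont pdpd_cont a_cont
  have lower: "?m x ^ 3 * a x - C1 \<le> ?m x ^ 3 * (D1 x e1 + D2 x e2)" if x: "x \<in> ?B" for x
  proof -
    have xU: "x \<in> U" using x B by auto
    have "D1 x e1 + D2 x e2 = a x + u x \<bullet> (pd u1 e1 x + pd u2 e2 x)"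
      by (simp add: D1_def D2_def a_def power2_norm_eq_inner inner_add_right)
    then have D: "D1 x e1 + D2 x e2 = a x + (u x \<bullet> grad V (u x)) / \<epsilon>\<^sup>2" unfolding laplace[OF xU] by simp
    have "\<bar>u x \<bullet> grad V (u x)\<bar> \<le> norm (u x) * norm (grad V (u x))" by (rule Cauchy_Schwarz_ineq2)
    also have "\<dots> \<le> M * G" by (intro mult_mono M G xU) auto
    finally have "- (M * G) \<le> u x \<bullet> grad V (u x)" by linarith
    then have "- (M * G) / \<epsilon>\<^sup>2 \<le> (u x \<bullet> grad V (u x)) / \<epsilon>\<^sup>2" by (rule divide_right_mono) simp
    then have "?m x ^ 3 * (a x + - (M * G) / \<epsilon>\<^sup>2) \<le> ?m x ^ 3 * (D1 x e1 + D2 x e2)"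
      unfolding D by (intro mult_left_mono) auto
    moreover have "?m x ^ 3 * (M * G / \<epsilon>\<^sup>2) \<le> (4 * r\<^sup>2) ^ 3 * (M * G / \<epsilon>\<^sup>2)"
      by (intro mult_right_mono power_mono m4) (use M G in auto)
    moreover have "(4 * r\<^sup>2) ^ 3 * (M * G / \<epsilon>\<^sup>2) = C1"
      by (simp add: C1_def power_mult_distrib power_mult[symmetric])
    ultimately show ?thesis by (simp add: algebra_simps)
  qed
  have upper: "6 * ((?m x)\<^sup>2 * (((x - x0) \<bullet> e1) * (u x \<bullet> u1 x) + ((x - x0) \<bullet> e2) * (u x \<bullet> u2 x))) \<le> ?m x ^ 3 * a x / 2 + C2"
    if x: "x \<in> ?B" for x
  proof -
    have xU: "x \<in> U" using x B by auto
    let ?v = "(u x \<bullet> u1 x) *\<^sub>R e1 + (u x \<bullet> u2 x) *\<^sub>R e2"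
    have "(norm ?v)\<^sup>2 = (u x \<bullet> u1 x)\<^sup>2 + (u x \<bullet> u2 x)\<^sup>2"
      by (simp add: norm_real2_sq inner_add_left)
    also have "\<dots> \<le> (norm (u x) * norm (u1 x))\<^sup>2 + (norm (u x) * norm (u2 x))\<^sup>2"
      by (intro add_mono abs_le_square_iff[THEN iffD1]) (simp_all add: Cauchy_Schwarz_ineq2)
    also have "\<dots> = (norm (u x))\<^sup>2 * a x" by (simp add: a_def power_mult_distrib algebra_simps)
    also have "\<dots> \<le> M\<^sup>2 * a x" using M xU a_nonneg by (intro mult_right_mono power_mono) auto
    finally have "(norm ?v)\<^sup>2 \<le> (M * sqrt (a x))\<^sup>2" using a_nonneg by (simp add: power_mult_distrib)
    then have v: "norm ?v \<le> M * sqrt (a x)" by (rule power2_le_imp_le) (use M a_nonneg in simp)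
    have "((x - x0) \<bullet> e1) * (u x \<bullet> u1 x) + ((x - x0) \<bullet> e2) * (u x \<bullet> u2 x) = (x - x0) \<bullet> ?v"
      by (simp add: inner_add_right algebra_simps)
    also have "\<dots> \<le> norm (x - x0) * norm ?v" by (rule norm_cauchy_schwarz)
    also have "\<dots> \<le> (2 * r) * (M * sqrt (a x))"
      using r x by (intro mult_mono v) (auto simp: dist_norm norm_minus_commute)
    finally have "6 * ((?m x)\<^sup>2 * (((x - x0) \<bullet> e1) * (u x \<bullet> u1 x) + ((x - x0) \<bullet> e2) * (u x \<bullet> u2 x)))
      \<le> 6 * ((?m x)\<^sup>2 * ((2 * r) * (M * sqrt (a x))))"
      by (intro mult_left_mono) auto
    also have "\<dots> \<le> ?m x * (((?m x) * sqrt (a x))\<^sup>2 / 2 + 72 * r\<^sup>2 * M\<^sup>2)"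
    proof -
      define Z where "Z = ?m x * sqrt (a x)"
      have "0 \<le> (Z - 12 * r * M)\<^sup>2" by simp
      then have "2 * (12 * r * M * Z) \<le> Z\<^sup>2 + 2 * (72 * r\<^sup>2 * M\<^sup>2)"
        by (simp add: power2_eq_square algebra_simps)
      then have "12 * r * M * Z \<le> Z\<^sup>2 / 2 + 72 * r\<^sup>2 * M\<^sup>2" by linarith
      then have "12 * r * M * (?m x * sqrt (a x)) \<le> ((?m x) * sqrt (a x))\<^sup>2 / 2 + 72 * r\<^sup>2 * M\<^sup>2"
        unfolding Z_def .
      then have "?m x * (12 * r * M * (?m x * sqrt (a x))) \<le> ?m x * (((?m x) * sqrt (a x))\<^sup>2 / 2 + 72 * r\<^sup>2 * M\<^sup>2)"
        by (intro mult_left_mono) auto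
      then show ?thesis by (simp add: power2_eq_square mult_ac)
    qed
    also have "\<dots> = ?m x ^ 3 * a x / 2 + ?m x * (72 * r\<^sup>2 * M\<^sup>2)"
      using a_nonneg[of x] by (simp add: power_mult_distrib power2_eq_square power3_eq_cube algebra_simps)
    also have "\<dots> \<le> ?m x ^ 3 * a x / 2 + 4 * r\<^sup>2 * (72 * r\<^sup>2 * M\<^sup>2)"
      by (intro add_left_mono mult_right_mono m4) auto
    also have "4 * r\<^sup>2 * (72 * r\<^sup>2 * M\<^sup>2) = C2" by (simp add: C2_def eval_nat_numeral)
    finally show ?thesis .
  qed
  have I1: "(\<lambda>x. ?m x ^ 3 * a x) integrable_on ?B" by (intro int cint)
  have I2: "(\<lambda>x. c) integrable_on ?B" for c :: real by (intro int cint)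
  have "integral ?B (\<lambda>x. ?m x ^ 3 * a x) - C1 * measure lborel ?B = integral ?B (\<lambda>x. ?m x ^ 3 * a x - C1)"
    by (simp only: Henstock_Kurzweil_Integration.integral_diff[OF I1 I2] integral_const_cball)
  also have "\<dots> \<le> integral ?B (\<lambda>x. ?m x ^ 3 * (D1 x e1 + D2 x e2))"
    by (intro integral_le int lower) (auto simp: D1_def D2_def intro!: cint)
  also have "\<dots> = integral ?B (\<lambda>x. 6 * ((?m x)\<^sup>2 * (((x - x0) \<bullet> e1) * (u x \<bullet> u1 x) + ((x - x0) \<bullet> e2) * (u x \<bullet> u2 x))))"
    using id by simp
  also have "\<dots> \<le> integral ?B (\<lambda>x. ?m x ^ 3 * a x / 2 + C2)"
    by (intro integral_le int upper) (auto intro!: cint)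
  also have "\<dots> = integral ?B (\<lambda>x. ?m x ^ 3 * a x) / 2 + C2 * measure lborel ?B"
    using Henstock_Kurzweil_Integration.integral_add[of "\<lambda>x. ?m x ^ 3 * a x / 2" ?B "\<lambda>_. C2"] I1 I2
    by (simp add: integral_const_cball)
  finally have 1: "integral ?B (\<lambda>x. ?m x ^ 3 * a x) \<le> 2 * (C1 + C2) * (4 * pi * r\<^sup>2)"
    using r by (simp add: measure_cball_real2 power_mult_distrib algebra_simps)
  have cU: "cball x0 r \<subseteq> ?B" using r by auto
  have "27 * r ^ 6 * integral (cball x0 r) a = integral (cball x0 r) (\<lambda>x. 27 * r ^ 6 * a x)" by simp
  also have "\<dots> \<le> integral (cball x0 r) (\<lambda>x. ?m x ^ 3 * a x)"
  proof (rule integral_le)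
    show "(\<lambda>x. 27 * r ^ 6 * a x) integrable_on cball x0 r" "(\<lambda>x. ?m x ^ 3 * a x) integrable_on cball x0 r"
      by (intro integrable_on_compact continuous_on_subset[OF _ order_trans[OF cU B]] cint compact_cball)+
    fix x assume "x \<in> cball x0 r"
    then have "(norm (x - x0))\<^sup>2 \<le> r\<^sup>2" by (intro power_mono) (auto simp: dist_norm norm_minus_commute)
    then have "3 * r\<^sup>2 \<le> ?m x" by (simp add: bump_base_def power_mult_distrib)
    then have "(3 * r\<^sup>2) ^ 3 \<le> ?m x ^ 3" by (intro power_mono) auto
    then have "27 * r ^ 6 \<le> ?m x ^ 3" by (simp add: power_mult_distrib power_mult[symmetric])
    then show "27 * r ^ 6 * a x \<le> ?m x ^ 3 * a x" using a_nonneg by (intro mult_right_mono)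
  qed
  also have "\<dots> \<le> integral ?B (\<lambda>x. ?m x ^ 3 * a x)"
    by (intro integral_subset_le cU I1 integrable_on_compact continuous_on_subset[OF _ order_trans[OF cU B]] cint compact_cball)
      (auto simp: a_nonneg)
  also note 1
  finally have 2: "27 * r ^ 6 * integral (cball x0 r) a \<le> 2 * (C1 + C2) * (4 * pi * r\<^sup>2)" .
  \<comment> \<open>22 and 5 are 576 / 27 and 128 / 27 rounded up, where 27 r^6 is the lower bound
    of m^3 on the inner disc.\<close>
  have "2 * (C1 + C2) * (4 * pi * r\<^sup>2) \<le> 27 * r ^ 6 * (4 * pi * (22 * M\<^sup>2 + 5 * M * G * r\<^sup>2 / \<epsilon>\<^sup>2))"
  proof -
    have "2 * (C1 + C2) * r\<^sup>2 = r ^ 6 * (576 * M\<^sup>2 + 128 * (M * G * r\<^sup>2 / \<epsilon>\<^sup>2))"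
      by (simp add: C1_def C2_def eval_nat_numeral algebra_simps)
    also have "\<dots> \<le> r ^ 6 * (27 * (22 * M\<^sup>2 + 5 * (M * G * r\<^sup>2 / \<epsilon>\<^sup>2)))"
    proof (rule mult_left_mono)
      have key: "576 * s + 128 * t \<le> 27 * (22 * s + 5 * t)" if "0 \<le> s" "0 \<le> t" for s t :: real using that by simp
      show "576 * M\<^sup>2 + 128 * (M * G * r\<^sup>2 / \<epsilon>\<^sup>2) \<le> 27 * (22 * M\<^sup>2 + 5 * (M * G * r\<^sup>2 / \<epsilon>\<^sup>2))"
        by (rule key) (use M(1) G(1) in simp_all)
    qed simp
    finally have "2 * (C1 + C2) * r\<^sup>2 \<le> r ^ 6 * (27 * (22 * M\<^sup>2 + 5 * (M * G * r\<^sup>2 / \<epsilon>\<^sup>2)))" .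
    then have "(4 * pi) * (2 * (C1 + C2) * r\<^sup>2) \<le> (4 * pi) * (r ^ 6 * (27 * (22 * M\<^sup>2 + 5 * (M * G * r\<^sup>2 / \<epsilon>\<^sup>2))))"
      by (rule mult_left_mono) simp
    moreover have "2 * (C1 + C2) * (4 * pi * r\<^sup>2) = (4 * pi) * (2 * (C1 + C2) * r\<^sup>2)" by (simp only: mult_ac)
    moreover have "27 * r ^ 6 * (4 * pi * (22 * M\<^sup>2 + 5 * M * G * r\<^sup>2 / \<epsilon>\<^sup>2))
        = (4 * pi) * (r ^ 6 * (27 * (22 * M\<^sup>2 + 5 * (M * G * r\<^sup>2 / \<epsilon>\<^sup>2))))"
      by (simp only: mult_ac times_divide_eq_right)
    ultimately show ?thesis by (simp only:)
  qed
  with 2 have "27 * r ^ 6 * integral (cball x0 r) a \<le> 27 * r ^ 6 * (4 * pi * (22 * M\<^sup>2 + 5 * M * G * r\<^sup>2 / \<epsilon>\<^sup>2))" by (rule order_trans)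
  then show ?thesis by (rule mult_left_le_imp_le) (use r in simp)
qed

text \<open>Bernstein's method: the Bochner term controls \<open>\<Delta>|\<nabla>u|\<^sup>2\<close> from below up to \<open>|\<nabla>u|\<^sup>2\<close>, which is absorbed by \<open>\<Delta>|u|\<^sup>2\<close>.\<close>

lemma gradient_bound:
  assumes B: "cball x0 (2 * r) \<subseteq> U" and r: "r > 0"
    and M: "M \<ge> 0" "\<And>x. x \<in> U \<Longrightarrow> norm (u x) \<le> M" and G: "G \<ge> 0" "\<And>x. x \<in> U \<Longrightarrow> norm (grad V (u x)) \<le> G"
    and L: "L \<ge> 0" "\<And>x \<xi>. x \<in> U \<Longrightarrow> \<bar>hess_apply V (u x) \<xi> \<bullet> \<xi>\<bar> \<le> L * (norm \<xi>)\<^sup>2"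
  shows "bump_mass * (\<epsilon>\<^sup>2 * a x0 / 2) \<le> 2 * pi * \<epsilon>\<^sup>2 / r\<^sup>2 * (22 * M\<^sup>2 + 5 * M * G * r\<^sup>2 / \<epsilon>\<^sup>2)
    + L * M\<^sup>2 * pi / 2 + pi * (L * M * G / \<epsilon>\<^sup>2) * r\<^sup>2"
proof -
  \<comment> \<open>The coefficient of |u|^2 is tuned to the Hessian bound: its Laplacian supplies
    exactly L |grad u|^2, and only L u . grad V(u) / \<epsilon>^2 is left as a possibly negative
    term.\<close>
  define W where "W x = \<epsilon>\<^sup>2 / 2 * a x + L / 2 * (u x \<bullet> u x)" for x
  define p where "p i x = \<epsilon>\<^sup>2 * (u1 x \<bullet> pd u1 i x + u2 x \<bullet> pd u2 i x) + L * (u x \<bullet> pd u i x)" for i x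
  define D where "D i x t = \<epsilon>\<^sup>2 * ((pd u1 t x \<bullet> pd u1 i x + u1 x \<bullet> pd (pd u1 i) t x)
      + (pd u2 t x \<bullet> pd u2 i x + u2 x \<bullet> pd (pd u2 i) t x)) + L * (pd u t x \<bullet> pd u i x + u x \<bullet> pd (pd u i) t x)" for i x t
  have cU: "cball x0 r \<subseteq> U" using B r by (auto intro: order_trans[rotated])
  have ider: "((\<lambda>x. f x \<bullet> g x) has_derivative (\<lambda>t. pd f t x \<bullet> g x + f x \<bullet> pd g t x)) (at x)"
    if "smooth_on U f" "smooth_on U g" "x \<in> U" for f g :: "real ^ 2 \<Rightarrow> real ^ 'k" and x
    by (rule has_derivative_eq_rhs[OF has_derivative_inner[OF smooth_on_has_derivative[OF that(1,3)] smooth_on_has_derivative[OF that(2,3)]]])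
      (simp add: add.commute)
  have sm: "smooth_on U (pd u c)" "smooth_on U (pd (pd u c) d)" for c d
    by (intro smooth_on_pd u_smooth)+
  have "bump_mass * W x0 \<le> integral (cball x0 r) W / r\<^sup>2 + pi * (L * M * G / \<epsilon>\<^sup>2) * r\<^sup>2"
  proof (rule mean_value_real2[OF U_open B r, where ?p1.0="p e1" and ?p2.0="p e2" and ?D1.0="D e1" and ?D2.0="D e2"])
    fix x assume x: "x \<in> U"
    have "(W has_derivative (\<lambda>t. \<epsilon>\<^sup>2 / 2 * ((pd u1 t x \<bullet> u1 x + u1 x \<bullet> pd u1 t x) + (pd u2 t x \<bullet> u2 x + u2 x \<bullet> pd u2 t x))
        + L / 2 * (pd u t x \<bullet> u x + u x \<bullet> pd u t x))) (at x)"
      unfolding W_def a_def power2_norm_eq_inner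
      by (intro has_derivative_add has_derivative_mult_right ider sm u_smooth x)
    then show "(W has_derivative (\<lambda>h. (h \<bullet> e1) * p e1 x + (h \<bullet> e2) * p e2 x)) (at x)"
    proof (rule has_derivative_eq_rhs, intro ext)
      fix t
      show "\<epsilon>\<^sup>2 / 2 * ((pd u1 t x \<bullet> u1 x + u1 x \<bullet> pd u1 t x) + (pd u2 t x \<bullet> u2 x + u2 x \<bullet> pd u2 t x))
        + L / 2 * (pd u t x \<bullet> u x + u x \<bullet> pd u t x) = (t \<bullet> e1) * p e1 x + (t \<bullet> e2) * p e2 x"
        unfolding p_def pd_expand[OF u_smooth x, of t] pd_expand[OF sm(1) x, of _ t]
        by (simp add: inner_add_right inner_add_left inner_commute algebra_simps)
    qed
    show "(p e1 has_derivative D e1 x) (at x)" "(p e2 has_derivative D e2 x) (at x)"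
      unfolding p_def D_def by (intro has_derivative_add has_derivative_mult_right ider sm u_smooth x)+
    have "D e1 x e1 + D e2 x e2 = \<epsilon>\<^sup>2 * ((norm (pd u1 e1 x))\<^sup>2 + (norm (pd u2 e1 x))\<^sup>2 + (norm (pd u1 e2 x))\<^sup>2 + (norm (pd u2 e2 x))\<^sup>2)
       + \<epsilon>\<^sup>2 * (u1 x \<bullet> (pd (pd u1 e1) e1 x + pd (pd u1 e2) e2 x)) + \<epsilon>\<^sup>2 * (u2 x \<bullet> (pd (pd u2 e1) e1 x + pd (pd u2 e2) e2 x))
       + L * (a x + u x \<bullet> (pd u1 e1 x + pd u2 e2 x))"
      by (simp add: D_def a_def power2_norm_eq_inner inner_add_right algebra_simps)
    also have "\<dots> = \<epsilon>\<^sup>2 * ((norm (pd u1 e1 x))\<^sup>2 + (norm (pd u2 e1 x))\<^sup>2 + (norm (pd u1 e2 x))\<^sup>2 + (norm (pd u2 e2 x))\<^sup>2)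
       + hess_apply V (u x) (u1 x) \<bullet> u1 x + hess_apply V (u x) (u2 x) \<bullet> u2 x + L * a x + L * (u x \<bullet> grad V (u x)) / \<epsilon>\<^sup>2"
      unfolding laplace_pd[OF x] laplace[OF x] using eps_pos by (simp add: inner_commute algebra_simps)
    finally have D: "D e1 x e1 + D e2 x e2 = \<epsilon>\<^sup>2 * ((norm (pd u1 e1 x))\<^sup>2 + (norm (pd u2 e1 x))\<^sup>2 + (norm (pd u1 e2 x))\<^sup>2 + (norm (pd u2 e2 x))\<^sup>2)
       + hess_apply V (u x) (u1 x) \<bullet> u1 x + hess_apply V (u x) (u2 x) \<bullet> u2 x + L * a x + L * (u x \<bullet> grad V (u x)) / \<epsilon>\<^sup>2" .
    have "0 \<le> \<epsilon>\<^sup>2 * ((norm (pd u1 e1 x))\<^sup>2 + (norm (pd u2 e1 x))\<^sup>2 + (norm (pd u1 e2 x))\<^sup>2 + (norm (pd u2 e2 x))\<^sup>2)" by simp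
    moreover have "- (L * a x) \<le> hess_apply V (u x) (u1 x) \<bullet> u1 x + hess_apply V (u x) (u2 x) \<bullet> u2 x"
      using L(2)[OF x, of "u1 x"] L(2)[OF x, of "u2 x"] by (simp add: a_def abs_le_iff algebra_simps)
    moreover have "- (L * M * G / \<epsilon>\<^sup>2) \<le> L * (u x \<bullet> grad V (u x)) / \<epsilon>\<^sup>2"
    proof -
      have "\<bar>u x \<bullet> grad V (u x)\<bar> \<le> norm (u x) * norm (grad V (u x))" by (rule Cauchy_Schwarz_ineq2)
      also have "\<dots> \<le> M * G" by (intro mult_mono M G x) auto
      finally have "- (M * G) \<le> u x \<bullet> grad V (u x)" by linarith
      then have "L * (- (M * G)) / \<epsilon>\<^sup>2 \<le> L * (u x \<bullet> grad V (u x)) / \<epsilon>\<^sup>2"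
        using L(1) by (intro divide_right_mono mult_left_mono) auto
      then show ?thesis by simp
    qed
    ultimately show "- (L * M * G / \<epsilon>\<^sup>2) \<le> D e1 x e1 + D e2 x e2" unfolding D by linarith
    show "0 \<le> W x" using L(1) a_nonneg[of x] by (simp add: W_def)
  next
    show "continuous_on U (\<lambda>x. D e1 x e1)" "continuous_on U (\<lambda>x. D e2 x e2)"
      unfolding D_def by (intro continuous_intros u_cont u1_cont u2_cont pdpd_cont pdpdpd_cont)+
  qed (use L M G in auto)
  moreover have "integral (cball x0 r) W \<le> \<epsilon>\<^sup>2 / 2 * (4 * pi * (22 * M\<^sup>2 + 5 * M * G * r\<^sup>2 / \<epsilon>\<^sup>2)) + L / 2 * M\<^sup>2 * (pi * r\<^sup>2)"
  proof -
    have I: "a integrable_on cball x0 r"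
      by (intro integrable_on_compact continuous_on_subset[OF _ cU] a_cont compact_cball)
    have Ic: "(\<lambda>_. c::real) integrable_on cball x0 r" for c by (intro integrable_on_compact) auto
    have "integral (cball x0 r) W \<le> integral (cball x0 r) (\<lambda>x. \<epsilon>\<^sup>2 / 2 * a x + L / 2 * M\<^sup>2)"
    proof (rule integral_le)
      show "W integrable_on cball x0 r"
        unfolding W_def by (intro integrable_on_compact continuous_on_subset[OF _ cU] continuous_intros a_cont u_cont compact_cball)
      show "(\<lambda>x. \<epsilon>\<^sup>2 / 2 * a x + L / 2 * M\<^sup>2) integrable_on cball x0 r"
        by (intro integrable_on_compact continuous_on_subset[OF _ cU] continuous_intros a_cont u_cont compact_cball)
      fix x assume "x \<in> cball x0 r"
      then have "(norm (u x))\<^sup>2 \<le> M\<^sup>2" using M cU by (intro power_mono) auto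
      then show "W x \<le> \<epsilon>\<^sup>2 / 2 * a x + L / 2 * M\<^sup>2"
        unfolding W_def power2_norm_eq_inner using L(1) by (intro add_left_mono mult_left_mono) auto
    qed
    also have "\<dots> = integral (cball x0 r) (\<lambda>x. \<epsilon>\<^sup>2 / 2 * a x) + integral (cball x0 r) (\<lambda>_. L / 2 * M\<^sup>2)"
      by (intro Henstock_Kurzweil_Integration.integral_add Ic integrable_on_mult_right I)
    also have "\<dots> = \<epsilon>\<^sup>2 / 2 * integral (cball x0 r) a + L / 2 * M\<^sup>2 * (pi * r\<^sup>2)"
      using r by (simp add: integral_const_cball measure_cball_real2)
    also have "\<epsilon>\<^sup>2 / 2 * integral (cball x0 r) a \<le> \<epsilon>\<^sup>2 / 2 * (4 * pi * (22 * M\<^sup>2 + 5 * M * G * r\<^sup>2 / \<epsilon>\<^sup>2))"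
      by (intro mult_left_mono caccioppoli_inequality[OF B r M G]) auto
    finally show ?thesis by simp
  qed
  then have "integral (cball x0 r) W / r\<^sup>2 \<le> (\<epsilon>\<^sup>2 / 2 * (4 * pi * (22 * M\<^sup>2 + 5 * M * G * r\<^sup>2 / \<epsilon>\<^sup>2)) + L / 2 * M\<^sup>2 * (pi * r\<^sup>2)) / r\<^sup>2"
    by (intro divide_right_mono) auto
  also have "\<dots> = 2 * pi * \<epsilon>\<^sup>2 / r\<^sup>2 * (22 * M\<^sup>2 + 5 * M * G * r\<^sup>2 / \<epsilon>\<^sup>2) + L * M\<^sup>2 * pi / 2"
    using r by (simp add: add_divide_distrib)
  moreover have "bump_mass * (\<epsilon>\<^sup>2 * a x0 / 2) \<le> bump_mass * W x0"
    using L(1) less_imp_le[OF bump_mass_pos] by (intro mult_left_mono) (auto simp: W_def)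
  ultimately show ?thesis by linarith
qed

end

subsection \<open>Concentration of the energy near the wells\<close>

lemma integral_inner_cball_le_bump:
  fixes f :: "'a::euclidean_space \<Rightarrow> real"
  assumes f: "continuous_on (cball x0 r) f" and f_nn: "\<And>x. x \<in> cball x0 r \<Longrightarrow> 0 \<le> f x" and r: "r > 0"
  shows "27 / 64 * r ^ 6 * integral (cball x0 (r / 2)) f \<le> integral (cball x0 r) (\<lambda>x. bump_base x0 r x ^ 3 * f x)"
proof -
  let ?m = "bump_base x0 r"
  have sub: "cball x0 (r / 2) \<subseteq> cball x0 r" using r by auto
  note c = continuous_on_subset[OF f sub]
  have "27 / 64 * r ^ 6 * integral (cball x0 (r / 2)) f = integral (cball x0 (r / 2)) (\<lambda>x. 27 / 64 * r ^ 6 * f x)" by simp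
  also have "\<dots> \<le> integral (cball x0 (r / 2)) (\<lambda>x. ?m x ^ 3 * f x)"
  proof (rule integral_le)
    show "(\<lambda>x. 27 / 64 * r ^ 6 * f x) integrable_on cball x0 (r / 2)" "(\<lambda>x. ?m x ^ 3 * f x) integrable_on cball x0 (r / 2)"
      by (intro integrable_on_compact continuous_intros c compact_cball)+
    fix x assume x: "x \<in> cball x0 (r / 2)"
    then have "(norm (x - x0))\<^sup>2 \<le> (r / 2)\<^sup>2" by (intro power_mono) (auto simp: dist_norm norm_minus_commute)
    then have "3 / 4 * r\<^sup>2 \<le> r\<^sup>2 - (norm (x - x0))\<^sup>2" by (simp add: power_divide)
    also have "\<dots> \<le> ?m x" by (simp add: bump_base_def)
    finally have "3 / 4 * r\<^sup>2 \<le> ?m x" .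
    then have "(3 / 4 * r\<^sup>2) ^ 3 \<le> ?m x ^ 3" by (intro power_mono) auto
    then have "27 / 64 * r ^ 6 \<le> ?m x ^ 3" by (simp add: power_mult_distrib power_divide power_mult[symmetric])
    then show "27 / 64 * r ^ 6 * f x \<le> ?m x ^ 3 * f x" using f_nn x sub by (intro mult_right_mono) auto
  qed
  also have "\<dots> \<le> integral (cball x0 r) (\<lambda>x. ?m x ^ 3 * f x)"
    by (intro integral_subset_le sub integrable_on_compact continuous_intros c f compact_cball) (use f_nn in auto)
  finally show ?thesis .
qed

lemma integral_bump_le:
  fixes f :: "'a::euclidean_space \<Rightarrow> real"
  assumes f: "continuous_on (cball x0 r) f" and f_nn: "\<And>x. x \<in> cball x0 r \<Longrightarrow> 0 \<le> f x"
  shows "integral (cball x0 r) (\<lambda>x. bump_base x0 r x ^ 3 * f x) \<le> r ^ 6 * integral (cball x0 r) f"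
proof -
  have "integral (cball x0 r) (\<lambda>x. bump_base x0 r x ^ 3 * f x) \<le> integral (cball x0 r) (\<lambda>x. r ^ 6 * f x)"
  proof (rule integral_le)
    show "(\<lambda>x. bump_base x0 r x ^ 3 * f x) integrable_on cball x0 r" "(\<lambda>x. r ^ 6 * f x) integrable_on cball x0 r"
      by (intro integrable_on_compact continuous_intros f compact_cball)+
    fix x assume x: "x \<in> cball x0 r"
    have "bump_base x0 r x ^ 3 \<le> (r\<^sup>2) ^ 3" by (intro power_mono bump_base_le) auto
    then show "bump_base x0 r x ^ 3 * f x \<le> r ^ 6 * f x"
      using f_nn[OF x] by (intro mult_right_mono) (auto simp: power_mult[symmetric])
  qed
  then show ?thesis by simp
qed

text \<open>Product of a rising step on the left quarter of the interval and a reflected one on the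
  right quarter; both inherit the smallness of the integral of \<open>a\<close>, and 6 / l adds
  their slopes.\<close>

lemma C1_cutoff_avoiding_large_values:
  fixes a :: "real \<Rightarrow> real"
  assumes l: "l > 0" and \<tau>: "\<tau> > 0"
    and a: "continuous_on {c - 2 * l..c + 2 * l} a" "\<And>t. t \<in> {c - 2 * l..c + 2 * l} \<Longrightarrow> 0 \<le> a t"
    and small: "integral {c - 2 * l..c + 2 * l} a \<le> \<tau> * l / 3"
  obtains f f' where "\<And>t. (f has_real_derivative f' t) (at t)" "continuous_on UNIV f'"
    "\<And>t. t \<notin> {c - 2 * l..c + 2 * l} \<Longrightarrow> f t = 0" "\<And>t. t \<in> {c - l..c + l} \<Longrightarrow> f t = 1"
    "\<And>t. 0 \<le> f t" "\<And>t. f t \<le> 1" "\<And>t. \<bar>f' t\<bar> \<le> 6 / l"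
    "\<And>t. f' t \<noteq> 0 \<Longrightarrow> t \<in> {c - 2 * l..c + 2 * l} \<and> a t < \<tau>"
proof -
  have small1: "integral {(c - 2 * l)..(c - 2 * l) + l} a \<le> \<tau> * l / 3"
  proof -
    have "integral {(c - 2 * l)..(c - 2 * l) + l} a \<le> integral {c - 2 * l..c + 2 * l} a"
      by (intro integral_subset_le integrable_continuous_interval continuous_on_subset[OF a(1)]) (use l a(2) in auto)
    with small show ?thesis by linarith
  qed
  have small2: "integral {(- c - 2 * l)..(- c - 2 * l) + l} (\<lambda>t. a (- t)) \<le> \<tau> * l / 3"
  proof -
    have "integral {- (c + 2 * l)..- (c + l)} (\<lambda>t. a (- t)) = integral {c + l..c + 2 * l} a"
      by (rule Henstock_Kurzweil_Integration.integral_reflect_real)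
    also have "\<dots> \<le> integral {c - 2 * l..c + 2 * l} a"
      by (intro integral_subset_le integrable_continuous_interval continuous_on_subset[OF a(1)]) (use l a(2) in auto)
    finally show ?thesis using small by (simp add: algebra_simps)
  qed
  obtain P P' where P: "\<And>t. (P has_real_derivative P' t) (at t)" "continuous_on UNIV P'"
    "\<And>t. t \<le> c - 2 * l \<Longrightarrow> P t = 0" "\<And>t. (c - 2 * l) + l \<le> t \<Longrightarrow> P t = 1"
    "\<And>t. 0 \<le> P t" "\<And>t. P t \<le> 1" "\<And>t. 0 \<le> P' t" "\<And>t. P' t \<le> 3 / l"
    "\<And>t. P' t \<noteq> 0 \<Longrightarrow> c - 2 * l < t \<and> t < (c - 2 * l) + l \<and> a t < \<tau>"
    by (rule C1_step_avoiding_large_values[OF l \<tau> _ _ small1]) (use l a(2) in \<open>auto intro: continuous_on_subset[OF a(1)]\<close>)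
  have ac: "continuous_on {(- c - 2 * l)..(- c - 2 * l) + l} (\<lambda>t. a (- t))"
    by (rule continuous_on_compose2[OF a(1)]) (use l in \<open>auto intro!: continuous_intros\<close>)
  obtain S S' where S: "\<And>t. (S has_real_derivative S' t) (at t)" "continuous_on UNIV S'"
    "\<And>t. t \<le> - c - 2 * l \<Longrightarrow> S t = 0" "\<And>t. (- c - 2 * l) + l \<le> t \<Longrightarrow> S t = 1"
    "\<And>t. 0 \<le> S t" "\<And>t. S t \<le> 1" "\<And>t. 0 \<le> S' t" "\<And>t. S' t \<le> 3 / l"
    "\<And>t. S' t \<noteq> 0 \<Longrightarrow> - c - 2 * l < t \<and> t < (- c - 2 * l) + l \<and> a (- t) < \<tau>"
    by (rule C1_step_avoiding_large_values[OF l \<tau> ac _ small2]) (use l a(2) in auto)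
  have Pc: "continuous_on UNIV P" and Sc: "continuous_on UNIV S"
    using P(1) S(1) by (auto intro!: continuous_at_imp_continuous_on DERIV_isCont)
  define f where "f t = P t * S (- t)" for t
  define f' where "f' t = P' t * S (- t) - P t * S' (- t)" for t
  show thesis
  proof (rule that[of f f'])
    show "(f has_real_derivative f' t) (at t)" for t
    proof -
      have "((\<lambda>t. S (- t)) has_real_derivative S' (- t) * (- 1)) (at t)"
        by (rule DERIV_chain2[OF S(1)]) (auto intro!: derivative_eq_intros)
      then show ?thesis
        unfolding f_def f'_def by (rule DERIV_cong[OF DERIV_mult[OF P(1)]]) simp
    qed
    show "continuous_on UNIV f'"
      unfolding f'_def
      by (intro continuous_intros P(2) Pc continuous_on_compose2[OF S(2)] continuous_on_compose2[OF Sc]) auto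
    show "f t = 0" if "t \<notin> {c - 2 * l..c + 2 * l}" for t
      using that P(3)[of t] S(3)[of "- t"] by (auto simp: f_def)
    show "f t = 1" if "t \<in> {c - l..c + l}" for t
      using that P(4)[of t] S(4)[of "- t"] by (auto simp: f_def)
    show "0 \<le> f t" "f t \<le> 1" for t
      using P(5,6)[of t] S(5,6)[of "- t"] by (auto simp: f_def intro: mult_le_one)
    show "\<bar>f' t\<bar> \<le> 6 / l" for t
    proof -
      have "\<bar>P' t * S (- t)\<bar> \<le> 3 / l * 1" unfolding abs_mult using P(7,8)[of t] S(5,6)[of "- t"] l
        by (intro mult_mono) auto
      moreover have "\<bar>P t * S' (- t)\<bar> \<le> 1 * (3 / l)" unfolding abs_mult using P(5,6)[of t] S(7,8)[of "- t"] l
        by (intro mult_mono) auto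
      ultimately show ?thesis unfolding f'_def by (simp add: abs_le_iff)
    qed
    show "t \<in> {c - 2 * l..c + 2 * l} \<and> a t < \<tau>" if "f' t \<noteq> 0" for t
    proof -
      have "P' t \<noteq> 0 \<or> S' (- t) \<noteq> 0" using that by (auto simp: f'_def)
      then show ?thesis using P(9)[of t] S(9)[of "- t"] l by auto
    qed
  qed
qed

section \<open>Weighted estimates at small and at moderate values of the potential\<close>

context solution
begin

lemma w_grad_le:
  assumes K: "K > 0" and gK: "(norm (grad V (u x)))\<^sup>2 \<le> K * w x"
  shows "\<bar>w1 x\<bar> \<le> sqrt K / \<epsilon> * A x" "\<bar>w2 x\<bar> \<le> sqrt K / \<epsilon> * A x"
proof -
  note sq = w_grad_sq_le[OF assms]
  have nn: "0 \<le> sqrt K * (A x / \<epsilon>)" using K A_nonneg[of x] eps_pos by simp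
  have "\<bar>w1 x\<bar>\<^sup>2 \<le> (sqrt K * (A x / \<epsilon>))\<^sup>2" "\<bar>w2 x\<bar>\<^sup>2 \<le> (sqrt K * (A x / \<epsilon>))\<^sup>2"
    using sq zero_le_power2[of "w1 x"] zero_le_power2[of "w2 x"] unfolding power2_abs by linarith+
  then have "\<bar>w1 x\<bar> \<le> sqrt K * (A x / \<epsilon>)" "\<bar>w2 x\<bar> \<le> sqrt K * (A x / \<epsilon>)"
    using nn by (auto intro: power2_le_imp_le)
  then show "\<bar>w1 x\<bar> \<le> sqrt K / \<epsilon> * A x" "\<bar>w2 x\<bar> \<le> sqrt K / \<epsilon> * A x" by simp_all
qed

text \<open>For 0 < k < v0 it equals ln (v0 / k) at s = 0, loses at most ln 2 up to s = k, and
  vanishes from s = v0 - k on. The shift by \<open>k\<close> keeps it finite at the wells.\<close>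

definition log_weight :: "real \<Rightarrow> real \<Rightarrow> real \<Rightarrow> real" where
  "log_weight v0 k s = max 0 (ln v0 - ln (s + k))"

text \<open>The logarithmic cutoff makes \<open>s * h' s\<close> negligible compared with \<open>h\<close>, at the price of a small \<open>k\<close>.\<close>

lemma near_energy_bound:
  assumes B: "cball x0 r \<subseteq> U" and r: "r > 0" and K: "K > 0" and \<kappa>: "\<kappa> > 0" and k: "0 < k" "k < v0"
    and gK: "\<And>x. x \<in> U \<Longrightarrow> (norm (grad V (u x)))\<^sup>2 \<le> K * w x"
    and convex: "\<And>x \<xi>. x \<in> U \<Longrightarrow> w x < v0 \<Longrightarrow> \<kappa> * (norm \<xi>)\<^sup>2 \<le> hess_apply V (u x) \<xi> \<bullet> \<xi>"
    and coercive: "\<And>x. x \<in> U \<Longrightarrow> w x < v0 \<Longrightarrow> \<kappa> * w x \<le> (norm (grad V (u x)))\<^sup>2"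
    and L: "L = ln v0 - ln k"
  shows "\<kappa> * integral (cball x0 r) (\<lambda>x. bump_base x0 r x ^ 3 * ((log_weight v0 k (w x))\<^sup>2 * A x))
    \<le> r ^ 6 * (4 * K * L + 6 * L\<^sup>2 * sqrt K * \<epsilon> / r) * integral (cball x0 r) A"
proof -
  let ?B = "cball x0 r" and ?m = "bump_base x0 r" and ?l = "log_weight v0 k"
  \<comment> \<open>Derivative of the squared weight. For s >= 0 it satisfies |h'(s)| s <= 2 L, one
    power of \<open>L\<close> below the maximum L^2 of the weight; this is the source of the gain 1
    / L.\<close>
  define h' where "h' s = - 2 * ?l s / (s + k)" for s
  have L0: "L > 0" using k L by simp
  have l_le: "?l s \<le> L" if "s \<ge> 0" for s
  proof -
    have "ln k \<le> ln (s + k)" using that k by simp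
    then show ?thesis using L0 unfolding log_weight_def L by simp
  qed
  have l_nn: "0 \<le> ?l s" for s by (simp add: log_weight_def)
  have lt: "s < v0" if "(?l s)\<^sup>2 \<noteq> 0" "s \<ge> 0" for s
  proof -
    have "ln (s + k) < ln v0" using that by (auto simp: log_weight_def max_def split: if_splits)
    then have "s + k < v0" using that k by simp
    then show ?thesis using k by simp
  qed
  have main: "\<kappa> * integral ?B (\<lambda>x. ?m x ^ 3 * (?l (w x))\<^sup>2 * A x)
    \<le> K * integral ?B (\<lambda>x. ?m x ^ 3 * (\<bar>h' (w x)\<bar> * w x) * (\<epsilon>\<^sup>2 * a x))
      + 6 * r ^ 5 * L\<^sup>2 * sqrt K * \<epsilon> * integral ?B A"
  proof (rule weighted_energy_bound[OF B r K \<kappa>])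
    show "(norm (grad V (u x)))\<^sup>2 \<le> K * w x" if "x \<in> ?B" for x using gK that B by auto
    show "((\<lambda>s. (?l s)\<^sup>2) has_real_derivative h' s) (at s)" if "0 \<le> s" for s
    proof -
      have "((\<lambda>s. ln v0 - ln (s + k)) has_real_derivative - 1 / (s + k)) (at s)"
        using that k by (auto intro!: derivative_eq_intros simp: field_simps)
      from DERIV_chain2[OF DERIV_max_0_power[of 0 "ln v0 - ln (s + k)"] this]
      show ?thesis unfolding log_weight_def h'_def by (simp add: power2_eq_square)
    qed
    have "continuous_on {0..} (\<lambda>s. ?l s)"
      unfolding log_weight_def by (intro continuous_intros) (use k in auto)
    then show "continuous_on {0..} h'"
      unfolding h'_def by (intro continuous_intros) (use k in auto)
    show "0 \<le> (?l s)\<^sup>2" for s by simp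
    show "(?l s)\<^sup>2 \<le> L\<^sup>2" if "0 \<le> s" for s using l_le[OF that] l_nn by (intro power_mono)
    fix x assume x: "x \<in> ?B" "(?l (w x))\<^sup>2 \<noteq> 0"
    then have xU: "x \<in> U" "w x < v0" using B lt[OF x(2) w_nonneg] by auto
    show "\<kappa> * (norm \<xi>)\<^sup>2 \<le> hess_apply V (u x) \<xi> \<bullet> \<xi>" for \<xi> by (rule convex[OF xU])
    show "\<kappa> * w x \<le> (norm (grad V (u x)))\<^sup>2" by (rule coercive[OF xU])
  qed
  have "integral ?B (\<lambda>x. ?m x ^ 3 * (\<bar>h' (w x)\<bar> * w x) * (\<epsilon>\<^sup>2 * a x)) \<le> integral ?B (\<lambda>x. ?m x ^ 3 * (4 * L * A x))"
  proof (rule integral_le)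
    have "continuous_on {0..} (\<lambda>s. ?l s)"
      unfolding log_weight_def by (intro continuous_intros) (use k in auto)
    then have "continuous_on {0..} h'"
      unfolding h'_def by (intro continuous_intros) (use k in auto)
    then have h'c: "continuous_on U (\<lambda>x. h' (w x))"
      by (rule continuous_on_compose2[OF _ w_cont]) (auto simp: w_nonneg)
    show "(\<lambda>x. ?m x ^ 3 * (\<bar>h' (w x)\<bar> * w x) * (\<epsilon>\<^sup>2 * a x)) integrable_on ?B"
      by (intro integrable_on_compact continuous_on_subset[OF _ B] continuous_intros h'c w_cont a_cont compact_cball)
    show "(\<lambda>x. ?m x ^ 3 * (4 * L * A x)) integrable_on ?B"
      by (intro integrable_on_compact continuous_on_subset[OF _ B] continuous_intros A_cont compact_cball)
    fix x
    have "\<bar>h' (w x)\<bar> * w x = 2 * ?l (w x) * (w x / (w x + k))"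
      using w_nonneg[of x] k l_nn by (simp add: h'_def abs_mult)
    also have "\<dots> \<le> 2 * L * 1"
      using w_nonneg[of x] k l_nn l_le[OF w_nonneg] L0 by (intro mult_mono) (auto simp: divide_le_eq_1)
    finally have "(\<bar>h' (w x)\<bar> * w x) * (\<epsilon>\<^sup>2 * a x) \<le> (2 * L) * (2 * A x)"
      using a_le_A[of x] a_nonneg[of x] L0 by (intro mult_mono[of "\<bar>h' (w x)\<bar> * w x" "2 * L"]) auto
    then have "?m x ^ 3 * ((\<bar>h' (w x)\<bar> * w x) * (\<epsilon>\<^sup>2 * a x)) \<le> ?m x ^ 3 * ((2 * L) * (2 * A x))"
      by (intro mult_left_mono) auto
    then show "?m x ^ 3 * (\<bar>h' (w x)\<bar> * w x) * (\<epsilon>\<^sup>2 * a x) \<le> ?m x ^ 3 * (4 * L * A x)"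
      by (simp add: mult.assoc)
  qed
  moreover have "integral ?B (\<lambda>x. ?m x ^ 3 * (4 * L * A x)) \<le> r ^ 6 * integral ?B (\<lambda>x. 4 * L * A x)"
    using L0 by (intro integral_bump_le continuous_on_subset[OF _ B] continuous_intros A_cont) (auto simp: A_nonneg)
  moreover have "r ^ 6 * integral ?B (\<lambda>x. 4 * L * A x) = r ^ 6 * (4 * L * integral ?B A)" by simp
  ultimately have "integral ?B (\<lambda>x. ?m x ^ 3 * (\<bar>h' (w x)\<bar> * w x) * (\<epsilon>\<^sup>2 * a x)) \<le> r ^ 6 * (4 * L * integral ?B A)"
    by linarith
  from mult_left_mono[OF this, of K] K main
  have "\<kappa> * integral ?B (\<lambda>x. ?m x ^ 3 * (?l (w x))\<^sup>2 * A x)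
    \<le> K * (r ^ 6 * (4 * L * integral ?B A)) + 6 * r ^ 5 * L\<^sup>2 * sqrt K * \<epsilon> * integral ?B A"
    by linarith
  also have "\<dots> = r ^ 6 * (4 * K * L + 6 * L\<^sup>2 * sqrt K * \<epsilon> / r) * integral ?B A"
    using r by (simp add: field_simps eval_nat_numeral)
  finally show ?thesis by (simp add: mult.assoc)
qed

text \<open>Where \<open>V (u x)\<close> is not small the gradient is controlled by its pointwise bound \<open>\<epsilon>\<^sup>2 |\<nabla>u|\<^sup>2 \<le> C\<close>.\<close>

lemma energy_le_potential:
  assumes B: "cball x0 r \<subseteq> U" and r: "r > 0" and K: "K > 0" and \<kappa>: "\<kappa> > 0" and v0: "v0 > 0"
    and gK: "\<And>x. x \<in> U \<Longrightarrow> (norm (grad V (u x)))\<^sup>2 \<le> K * w x"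
    and convex: "\<And>x \<xi>. x \<in> U \<Longrightarrow> w x < v0 \<Longrightarrow> \<kappa> * (norm \<xi>)\<^sup>2 \<le> hess_apply V (u x) \<xi> \<bullet> \<xi>"
    and coercive: "\<And>x. x \<in> U \<Longrightarrow> w x < v0 \<Longrightarrow> \<kappa> * w x \<le> (norm (grad V (u x)))\<^sup>2"
    and C: "\<And>x. x \<in> U \<Longrightarrow> \<epsilon>\<^sup>2 * a x \<le> C" "C \<ge> 0"
  shows "integral (cball x0 (r / 2)) A \<le> 64 / 27 * ((8 * K * C / (v0 * \<kappa>) + 1 + C / v0) * integral (cball x0 r) w
      + 24 * sqrt K / \<kappa> * (\<epsilon> / r) * integral (cball x0 r) A)"
proof -
  let ?B = "cball x0 r" and ?m = "bump_base x0 r"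
  \<comment> \<open>The cutoff is at least v0^2 / 4 on {w <= v0 / 2} and vanishes from v0 on. Since
    |h'(w)| w <= 2 v0 w, the error term is already an integral of the potential.\<close>
  define h where "h s = (max 0 (v0 - s))\<^sup>2" for s
  define h' where "h' s = - 2 * max 0 (v0 - s)" for s
  note cint = continuous_intros w_cont a_cont A_cont
  note int = integrable_on_compact(1)[OF compact_cball continuous_on_subset[OF _ B]]
  have hc: "continuous_on U (\<lambda>x. h (w x))" "continuous_on U (\<lambda>x. h' (w x))"
    unfolding h_def h'_def by (intro cint)+
  have h_le: "h s \<le> v0\<^sup>2" if "0 \<le> s" for s
    unfolding h_def using v0 that by (intro power_mono) auto
  have "\<kappa> * integral ?B (\<lambda>x. ?m x ^ 3 * h (w x) * A x)
    \<le> K * integral ?B (\<lambda>x. ?m x ^ 3 * (\<bar>h' (w x)\<bar> * w x) * (\<epsilon>\<^sup>2 * a x))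
      + 6 * r ^ 5 * v0\<^sup>2 * sqrt K * \<epsilon> * integral ?B A"
  proof (rule weighted_energy_bound[OF B r K \<kappa>])
    show "(norm (grad V (u x)))\<^sup>2 \<le> K * w x" if "x \<in> ?B" for x using gK that B by auto
    show "(h has_real_derivative h' s) (at s)" for s
    proof -
      have "((\<lambda>s. v0 - s) has_real_derivative - 1) (at s)" by (auto intro!: derivative_eq_intros)
      from DERIV_chain2[OF DERIV_max_0_power[of 0 "v0 - s"] this]
      show ?thesis unfolding h_def[abs_def] h'_def by (simp add: power2_eq_square)
    qed
    show "continuous_on {0..} h'" unfolding h'_def by (intro continuous_intros)
    show "0 \<le> h s" for s by (simp add: h_def)
    show "h s \<le> v0\<^sup>2" if "0 \<le> s" for s by (rule h_le[OF that])
    fix x assume x: "x \<in> ?B" "h (w x) \<noteq> 0"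
    then have xU: "x \<in> U" "w x < v0" using B by (auto simp: h_def max_def split: if_splits)
    show "\<kappa> * (norm \<xi>)\<^sup>2 \<le> hess_apply V (u x) \<xi> \<bullet> \<xi>" for \<xi> by (rule convex[OF xU])
    show "\<kappa> * w x \<le> (norm (grad V (u x)))\<^sup>2" by (rule coercive[OF xU])
  qed
  moreover
  have "integral ?B (\<lambda>x. ?m x ^ 3 * (\<bar>h' (w x)\<bar> * w x) * (\<epsilon>\<^sup>2 * a x)) \<le> integral ?B (\<lambda>x. 2 * v0 * C * (?m x ^ 3 * w x))"
  proof (intro integral_le int)
    fix x assume "x \<in> ?B"
    then have x: "x \<in> U" using B by auto
    have "\<bar>h' (w x)\<bar> \<le> 2 * v0" using v0 w_nonneg[of x] by (simp add: h'_def abs_mult)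
    then have "(\<bar>h' (w x)\<bar> * w x) * (\<epsilon>\<^sup>2 * a x) \<le> (2 * v0 * w x) * C"
      using C x v0 w_nonneg[of x] a_nonneg[of x] by (intro mult_mono) auto
    then have "?m x ^ 3 * ((\<bar>h' (w x)\<bar> * w x) * (\<epsilon>\<^sup>2 * a x)) \<le> ?m x ^ 3 * ((2 * v0 * w x) * C)"
      by (intro mult_left_mono) auto
    then show "?m x ^ 3 * (\<bar>h' (w x)\<bar> * w x) * (\<epsilon>\<^sup>2 * a x) \<le> 2 * v0 * C * (?m x ^ 3 * w x)"
      by (simp add: mult_ac)
  qed (intro cint hc)+
  then have "integral ?B (\<lambda>x. ?m x ^ 3 * (\<bar>h' (w x)\<bar> * w x) * (\<epsilon>\<^sup>2 * a x)) \<le> 2 * v0 * C * integral ?B (\<lambda>x. ?m x ^ 3 * w x)"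
    by simp
  from mult_left_mono[OF this, of K] K
  have "K * integral ?B (\<lambda>x. ?m x ^ 3 * (\<bar>h' (w x)\<bar> * w x) * (\<epsilon>\<^sup>2 * a x)) \<le> K * (2 * v0 * C * integral ?B (\<lambda>x. ?m x ^ 3 * w x))"
    by simp
  ultimately have "\<kappa> * integral ?B (\<lambda>x. ?m x ^ 3 * h (w x) * A x)
    \<le> K * (2 * v0 * C * integral ?B (\<lambda>x. ?m x ^ 3 * w x)) + 6 * r ^ 5 * v0\<^sup>2 * sqrt K * \<epsilon> * integral ?B A"
    by linarith
  then have 1: "integral ?B (\<lambda>x. ?m x ^ 3 * h (w x) * A x)
    \<le> (K * (2 * v0 * C * integral ?B (\<lambda>x. ?m x ^ 3 * w x)) + 6 * r ^ 5 * v0\<^sup>2 * sqrt K * \<epsilon> * integral ?B A) / \<kappa>"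
    using \<kappa> by (simp add: pos_le_divide_eq mult.commute)
  have "27 / 64 * r ^ 6 * integral (cball x0 (r / 2)) A \<le> integral ?B (\<lambda>x. ?m x ^ 3 * A x)"
    by (intro integral_inner_cball_le_bump continuous_on_subset[OF A_cont B] r A_nonneg)
  also have "\<dots> \<le> integral ?B (\<lambda>x. 4 / v0\<^sup>2 * (?m x ^ 3 * h (w x) * A x) + (1 + C / v0) * (?m x ^ 3 * w x))"
  proof (intro integral_le int)
    fix x assume "x \<in> ?B"
    then have x: "x \<in> U" using B by auto
    have "A x \<le> 4 / v0\<^sup>2 * (h (w x) * A x) + (1 + C / v0) * w x"
    proof (cases "w x \<le> v0 / 2")
      case True
      then have "(v0 / 2)\<^sup>2 \<le> h (w x)" unfolding h_def using v0 by (intro power_mono) auto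
      then have "1 \<le> 4 / v0\<^sup>2 * h (w x)" using v0 by (simp add: field_simps power2_eq_square)
      then have "1 * A x \<le> 4 / v0\<^sup>2 * h (w x) * A x" using A_nonneg by (intro mult_right_mono)
      moreover have "0 \<le> (1 + C / v0) * w x" using C v0 w_nonneg by simp
      ultimately show ?thesis by simp
    next
      case False
      \<comment> \<open>Where w > v0 / 2, the gradient part of \<open>A\<close> is at most C / 2 <=
        C w / v0.\<close>
      have "C / 2 * 1 \<le> C / 2 * (2 * w x / v0)" using False C v0 by (intro mult_left_mono) auto
      then have "A x \<le> (1 + C / v0) * w x"
        using C(1)[OF x] by (simp add: A_def algebra_simps)
      moreover have "0 \<le> 4 / v0\<^sup>2 * (h (w x) * A x)" using A_nonneg by (simp add: h_def)
      ultimately show ?thesis by simp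
    qed
    then have "?m x ^ 3 * A x \<le> ?m x ^ 3 * (4 / v0\<^sup>2 * (h (w x) * A x) + (1 + C / v0) * w x)"
      by (intro mult_left_mono) auto
    then show "?m x ^ 3 * A x \<le> 4 / v0\<^sup>2 * (?m x ^ 3 * h (w x) * A x) + (1 + C / v0) * (?m x ^ 3 * w x)"
      by (simp add: algebra_simps)
  qed (intro cint hc)+
  also have "\<dots> = 4 / v0\<^sup>2 * integral ?B (\<lambda>x. ?m x ^ 3 * h (w x) * A x) + (1 + C / v0) * integral ?B (\<lambda>x. ?m x ^ 3 * w x)"
  proof -
    have "(\<lambda>x. 4 / v0\<^sup>2 * (?m x ^ 3 * h (w x) * A x)) integrable_on ?B" "(\<lambda>x. (1 + C / v0) * (?m x ^ 3 * w x)) integrable_on ?B"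
      by (intro int cint hc)+
    from Henstock_Kurzweil_Integration.integral_add[OF this] show ?thesis by simp
  qed
  also have "\<dots> \<le> 4 / v0\<^sup>2 * ((K * (2 * v0 * C * integral ?B (\<lambda>x. ?m x ^ 3 * w x)) + 6 * r ^ 5 * v0\<^sup>2 * sqrt K * \<epsilon> * integral ?B A) / \<kappa>)
      + (1 + C / v0) * integral ?B (\<lambda>x. ?m x ^ 3 * w x)"
    by (intro add_right_mono mult_left_mono 1) auto
  also have "\<dots> = (8 * K * C / (v0 * \<kappa>) + 1 + C / v0) * integral ?B (\<lambda>x. ?m x ^ 3 * w x) + 24 * sqrt K / \<kappa> * r ^ 5 * \<epsilon> * integral ?B A"
    using v0 \<kappa> by (simp add: field_simps power2_eq_square)
  also have "\<dots> \<le> (8 * K * C / (v0 * \<kappa>) + 1 + C / v0) * (r ^ 6 * integral ?B w) + 24 * sqrt K / \<kappa> * r ^ 5 * \<epsilon> * integral ?B A"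
    using K C v0 \<kappa>
    by (intro add_right_mono mult_left_mono integral_bump_le continuous_on_subset[OF w_cont B] w_nonneg) auto
  also have "\<dots> = 27 / 64 * r ^ 6 * (64 / 27 * ((8 * K * C / (v0 * \<kappa>) + 1 + C / v0) * integral ?B w
      + 24 * sqrt K / \<kappa> * (\<epsilon> / r) * integral ?B A))"
    using r by (simp add: field_simps eval_nat_numeral)
  finally show ?thesis using r by simp
qed

subsection \<open>Pohozaev's identity and decay of the potential\<close>


lemma A_der: "x \<in> U \<Longrightarrow> (A has_derivative (\<lambda>h. ((h \<bullet> e1) * w1 x + (h \<bullet> e2) * w2 x)
    + \<epsilon>\<^sup>2 * (u1 x \<bullet> pd u1 h x + u2 x \<bullet> pd u2 h x))) (at x)"
proof -
  assume x: "x \<in> U"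
  have 1: "((\<lambda>x. u1 x \<bullet> u1 x) has_derivative (\<lambda>h. u1 x \<bullet> pd u1 h x + pd u1 h x \<bullet> u1 x)) (at x)"
    "((\<lambda>x. u2 x \<bullet> u2 x) has_derivative (\<lambda>h. u2 x \<bullet> pd u2 h x + pd u2 h x \<bullet> u2 x)) (at x)"
    by (rule has_derivative_inner[OF u1_der[OF x] u1_der[OF x]] has_derivative_inner[OF u2_der[OF x] u2_der[OF x]])+
  have "((\<lambda>x. w x + \<epsilon>\<^sup>2 / 2 * (u1 x \<bullet> u1 x + u2 x \<bullet> u2 x)) has_derivative
    (\<lambda>h. ((h \<bullet> e1) * w1 x + (h \<bullet> e2) * w2 x) + \<epsilon>\<^sup>2 / 2 * ((u1 x \<bullet> pd u1 h x + pd u1 h x \<bullet> u1 x) + (u2 x \<bullet> pd u2 h x + pd u2 h x \<bullet> u2 x)))) (at x)"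
    by (intro has_derivative_add has_derivative_mult_right w_der[OF x] 1)
  then show ?thesis
    unfolding A_def[abs_def] a_inner
    by (rule has_derivative_eq_rhs) (simp add: fun_eq_iff inner_commute algebra_simps)
qed

text \<open>
  The stress-energy tensor is divergence free. It is tested against the vector field
  \<open>\<phi> x * (x - x0)\<close> with \<open>\<phi> x = \<alpha> (x \<bullet> e1) * \<beta> (x \<bullet> e2)\<close>; in dimension two
  the gradient terms cancel where \<open>\<phi>\<close> is constant.
\<close>

lemma pohozaev_inequality:
  fixes \<alpha> \<alpha>' \<beta> \<beta>' :: "real \<Rightarrow> real"
  defines "Q \<equiv> \<lambda>x0 l. cbox (vec2 (x0 \<bullet> e1 - 2 * l) (x0 \<bullet> e2 - 2 * l)) (vec2 (x0 \<bullet> e1 + 2 * l) (x0 \<bullet> e2 + 2 * l))"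
  assumes l: "l > 0" and QU: "Q x0 l \<subseteq> U"
    and \<alpha>: "\<And>t. (\<alpha> has_real_derivative \<alpha>' t) (at t)" "continuous_on UNIV \<alpha>'"
      "\<And>t. t \<notin> {x0 \<bullet> e1 - 2 * l..x0 \<bullet> e1 + 2 * l} \<Longrightarrow> \<alpha> t = 0" "\<And>t. 0 \<le> \<alpha> t" "\<And>t. \<alpha> t \<le> 1" "\<And>t. \<bar>\<alpha>' t\<bar> \<le> 6 / l"
    and \<beta>: "\<And>t. (\<beta> has_real_derivative \<beta>' t) (at t)" "continuous_on UNIV \<beta>'"
      "\<And>t. t \<notin> {x0 \<bullet> e2 - 2 * l..x0 \<bullet> e2 + 2 * l} \<Longrightarrow> \<beta> t = 0" "\<And>t. 0 \<le> \<beta> t" "\<And>t. \<beta> t \<le> 1" "\<And>t. \<bar>\<beta>' t\<bar> \<le> 6 / l"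
    and N: "continuous_on U N" "\<And>x. x \<in> Q x0 l \<Longrightarrow> 0 \<le> N x"
      "\<And>x. x \<in> Q x0 l \<Longrightarrow> \<alpha>' (x \<bullet> e1) \<noteq> 0 \<Longrightarrow> 1 \<le> N x" "\<And>x. x \<in> Q x0 l \<Longrightarrow> \<beta>' (x \<bullet> e2) \<noteq> 0 \<Longrightarrow> 1 \<le> N x"
  shows "integral (Q x0 l) (\<lambda>x. \<alpha> (x \<bullet> e1) * \<beta> (x \<bullet> e2) * w x) \<le> 60 * integral (Q x0 l) (\<lambda>x. N x * A x)"
proof -
  let ?Q = "Q x0 l"
  have Q: "x \<in> ?Q \<longleftrightarrow> x \<bullet> e1 \<in> {x0 \<bullet> e1 - 2 * l..x0 \<bullet> e1 + 2 * l} \<and> x \<bullet> e2 \<in> {x0 \<bullet> e2 - 2 * l..x0 \<bullet> e2 + 2 * l}" for x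
    using cbox_vec2[of "x \<bullet> e1" "x \<bullet> e2"] unfolding vec2_eta Q_def by blast
  have Qc: "compact ?Q" by (simp add: Q_def)
  define z1 where "z1 x = x \<bullet> e1 - x0 \<bullet> e1" for x
  define z2 where "z2 x = x \<bullet> e2 - x0 \<bullet> e2" for x
  define d where "d x = z1 x *\<^sub>R u1 x + z2 x *\<^sub>R u2 x" for x
  define Dd where "Dd x h = (z1 x *\<^sub>R pd u1 h x + (h \<bullet> e1) *\<^sub>R u1 x) + (z2 x *\<^sub>R pd u2 h x + (h \<bullet> e2) *\<^sub>R u2 x)" for x h
  define DA where "DA x h = ((h \<bullet> e1) * w1 x + (h \<bullet> e2) * w2 x) + \<epsilon>\<^sup>2 * (u1 x \<bullet> pd u1 h x + u2 x \<bullet> pd u2 h x)" for x h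
  \<comment> \<open>\<open>F1\<close> and \<open>F2\<close> are the components of the stress-energy
    tensor, A times the identity minus \<epsilon>^2 times the matrix of products of partial
    derivatives, applied to x - x0; \<open>d\<close> is the derivative of \<open>u\<close> along x -
    x0.\<close>
  define F1 where "F1 x = z1 x * A x - \<epsilon>\<^sup>2 * (d x \<bullet> u1 x)" for x
  define F2 where "F2 x = z2 x * A x - \<epsilon>\<^sup>2 * (d x \<bullet> u2 x)" for x
  define DF1 where "DF1 x h = (z1 x * DA x h + (h \<bullet> e1) * A x) - \<epsilon>\<^sup>2 * (d x \<bullet> pd u1 h x + Dd x h \<bullet> u1 x)" for x h
  define DF2 where "DF2 x h = (z2 x * DA x h + (h \<bullet> e2) * A x) - \<epsilon>\<^sup>2 * (d x \<bullet> pd u2 h x + Dd x h \<bullet> u2 x)" for x h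
  define \<phi> where "\<phi> x = \<alpha> (x \<bullet> e1) * \<beta> (x \<bullet> e2)" for x
  define D\<phi> where "D\<phi> x h = \<alpha> (x \<bullet> e1) * (\<beta>' (x \<bullet> e2) * (h \<bullet> e2)) + (\<alpha>' (x \<bullet> e1) * (h \<bullet> e1)) * \<beta> (x \<bullet> e2)" for x h
  have z_der: "(z1 has_derivative (\<lambda>h. h \<bullet> e1)) (at x)" "(z2 has_derivative (\<lambda>h. h \<bullet> e2)) (at x)" for x
    unfolding z1_def[abs_def] z2_def[abs_def] by (auto intro!: derivative_eq_intros)
  have d_der: "(d has_derivative Dd x) (at x)" if "x \<in> U" for x
    unfolding d_def[abs_def] Dd_def[abs_def]
    by (intro has_derivative_add has_derivative_scaleR z_der u1_der u2_der that)
  have F_der: "(F1 has_derivative DF1 x) (at x)" "(F2 has_derivative DF2 x) (at x)" if x: "x \<in> U" for x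
    unfolding F1_def[abs_def] F2_def[abs_def] DF1_def[abs_def] DF2_def[abs_def] DA_def[abs_def]
    by (intro has_derivative_diff has_derivative_mult has_derivative_mult_right has_derivative_inner d_der u1_der u2_der A_der z_der x)+
  have \<phi>_der: "(\<phi> has_derivative D\<phi> x) (at x)" for x
    unfolding \<phi>_def[abs_def] D\<phi>_def[abs_def]
    by (intro has_derivative_mult has_derivative_compose[OF _ \<alpha>(1)[unfolded has_field_derivative_def]]
        has_derivative_compose[OF _ \<beta>(1)[unfolded has_field_derivative_def]]) (auto intro!: derivative_eq_intros)
  have \<alpha>c: "continuous_on S (\<lambda>x. \<alpha> (x \<bullet> e1))" "continuous_on S (\<lambda>x. \<alpha>' (x \<bullet> e1))"
    and \<beta>c: "continuous_on S (\<lambda>x. \<beta> (x \<bullet> e2))" "continuous_on S (\<lambda>x. \<beta>' (x \<bullet> e2))" for S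
  proof -
    have a: "continuous_on UNIV \<alpha>" "continuous_on UNIV \<beta>"
      using \<alpha>(1) \<beta>(1) by (auto intro!: continuous_at_imp_continuous_on DERIV_isCont)
    show "continuous_on S (\<lambda>x. \<alpha> (x \<bullet> e1))" by (rule continuous_on_compose2[OF a(1)]) (auto intro!: continuous_intros)
    show "continuous_on S (\<lambda>x. \<alpha>' (x \<bullet> e1))" by (rule continuous_on_compose2[OF \<alpha>(2)]) (auto intro!: continuous_intros)
    show "continuous_on S (\<lambda>x. \<beta> (x \<bullet> e2))" by (rule continuous_on_compose2[OF a(2)]) (auto intro!: continuous_intros)
    show "continuous_on S (\<lambda>x. \<beta>' (x \<bullet> e2))" by (rule continuous_on_compose2[OF \<beta>(2)]) (auto intro!: continuous_intros)
  qed
  have zc: "continuous_on S z1" "continuous_on S z2" for S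
    unfolding z1_def[abs_def] z2_def[abs_def] by (intro continuous_intros)+
  note c0 = continuous_intros u_cont u1_cont u2_cont pdpd_cont A_cont w_cont w12_cont zc \<alpha>c \<beta>c N(1)
  have Fc: "continuous_on U F1" "continuous_on U F2"
    unfolding F1_def[abs_def] F2_def[abs_def] d_def by (intro c0)+
  have Dc: "continuous_on U (\<lambda>x. DF1 x e1)" "continuous_on U (\<lambda>x. DF2 x e2)"
    unfolding DF1_def DF2_def Dd_def DA_def d_def by (intro c0)+
  have D\<phi>c: "continuous_on U (\<lambda>x. D\<phi> x e1)" "continuous_on U (\<lambda>x. D\<phi> x e2)" "continuous_on U \<phi>"
    unfolding D\<phi>_def \<phi>_def[abs_def] by (intro c0)+
  note c1 = c0 Fc Dc D\<phi>c
  note int = integrable_on_compact(1)[OF Qc continuous_on_subset[OF _ QU]]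
  have \<phi>0: "\<phi> x = 0" if "x \<notin> ?Q" for x
    using that \<alpha>(3)[of "x \<bullet> e1"] \<beta>(3)[of "x \<bullet> e2"] unfolding Q \<phi>_def by auto
  have i1: "integral ?Q (\<lambda>x. \<phi> x * DF1 x e1 + D\<phi> x e1 * F1 x) = 0"
    by (rule integral_directional_derivative_eq_0_on[OF U_open Qc QU, where g="\<lambda>x. \<phi> x * F1 x" and D="\<lambda>x h. \<phi> x * DF1 x h + D\<phi> x h * F1 x"])
      (auto intro!: has_derivative_mult[OF \<phi>_der F_der(1)] c1 simp: \<phi>0)
  have i2: "integral ?Q (\<lambda>x. \<phi> x * DF2 x e2 + D\<phi> x e2 * F2 x) = 0"
    by (rule integral_directional_derivative_eq_0_on[OF U_open Qc QU, where g="\<lambda>x. \<phi> x * F2 x" and D="\<lambda>x h. \<phi> x * DF2 x h + D\<phi> x h * F2 x"])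
      (auto intro!: has_derivative_mult[OF \<phi>_der F_der(2)] c1 simp: \<phi>0)
  \<comment> \<open>The divergence of the tensor vanishes by the equation, so only its trace 2 A -
    \<epsilon>^2 a is left, and in dimension two that is 2 w.\<close>
  have div: "DF1 x e1 + DF2 x e2 = 2 * w x" if x: "x \<in> U" for x
  proof -
    have comm: "pd u2 e1 x = pd u1 e2 x" by (rule pd_commute[OF U_open u_smooth x])
    have lap: "\<epsilon>\<^sup>2 * (d x \<bullet> pd u1 e1 x + d x \<bullet> pd u2 e2 x) = z1 x * w1 x + z2 x * w2 x"
    proof -
      have "\<epsilon>\<^sup>2 * (d x \<bullet> pd u1 e1 x + d x \<bullet> pd u2 e2 x) = \<epsilon>\<^sup>2 * (d x \<bullet> (pd u1 e1 x + pd u2 e2 x))"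
        by (simp add: inner_add_right)
      also have "\<dots> = d x \<bullet> grad V (u x)" unfolding laplace[OF x] using eps_pos by simp
      also have "\<dots> = z1 x * w1 x + z2 x * w2 x"
        by (simp add: d_def w1_def w2_def inner_add_left inner_commute[of "grad V (u x)"])
      finally show ?thesis .
    qed
    have "DF1 x e1 + DF2 x e2 = 2 * A x - \<epsilon>\<^sup>2 * a x + (z1 x * w1 x + z2 x * w2 x) - \<epsilon>\<^sup>2 * (d x \<bullet> pd u1 e1 x + d x \<bullet> pd u2 e2 x)"
      by (simp add: DF1_def DF2_def Dd_def DA_def comm a_inner inner_add_left inner_commute algebra_simps)
    then show ?thesis unfolding lap by (simp add: A_def)
  qed
  \<comment> \<open>2 l comes from (x - x0) A, and 8 l from |d . v| <= 4 l a with \<epsilon>^2 a <=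
    2 A. Together with the slope 6 / l this gives 60 per direction; the factor 2 in 2 w compensates
    for the two directions.\<close>
  have bound: "\<bar>F1 x\<bar> \<le> 10 * l * A x" "\<bar>F2 x\<bar> \<le> 10 * l * A x" if x: "x \<in> ?Q" for x
  proof -
    have z: "\<bar>z1 x\<bar> \<le> 2 * l" "\<bar>z2 x\<bar> \<le> 2 * l" using x unfolding Q z1_def z2_def by auto
    have "norm (d x) \<le> norm (z1 x *\<^sub>R u1 x) + norm (z2 x *\<^sub>R u2 x)" unfolding d_def by (rule norm_triangle_ineq)
    also have "\<dots> \<le> 2 * l * norm (u1 x) + 2 * l * norm (u2 x)"
      using z by (auto intro!: add_mono mult_right_mono)
    finally have dn: "norm (d x) \<le> 2 * l * (norm (u1 x) + norm (u2 x))" by (simp add: algebra_simps)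
    have key: "(norm (u1 x) + norm (u2 x)) * norm (u1 x) \<le> 2 * a x" "(norm (u1 x) + norm (u2 x)) * norm (u2 x) \<le> 2 * a x"
    proof -
      have "(p + q) * p \<le> 2 * (p\<^sup>2 + q\<^sup>2)" for p q :: real
      proof -
        have eq: "(p + q) * p = p\<^sup>2 + p * q" by (simp add: power2_eq_square algebra_simps)
        have "2 * (p * q) \<le> p\<^sup>2 + q\<^sup>2" using sum_squares_bound[of p q] by simp
        moreover have "0 \<le> p\<^sup>2" "0 \<le> q\<^sup>2" by simp_all
        moreover have "x + y \<le> 2 * (x + z)" if "2 * y \<le> x + z" "0 \<le> x" "0 \<le> z" for x y z :: real
          using that by simp
        ultimately have "p\<^sup>2 + p * q \<le> 2 * (p\<^sup>2 + q\<^sup>2)" by blast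
        with eq show ?thesis by (simp only:)
      qed
      from this[of "norm (u1 x)" "norm (u2 x)"] this[of "norm (u2 x)" "norm (u1 x)"]
      show "(norm (u1 x) + norm (u2 x)) * norm (u1 x) \<le> 2 * a x" "(norm (u1 x) + norm (u2 x)) * norm (u2 x) \<le> 2 * a x"
        by (simp_all add: a_def add.commute)
    qed
    have dv: "\<bar>d x \<bullet> v\<bar> \<le> 4 * l * a x" if "(norm (u1 x) + norm (u2 x)) * norm v \<le> 2 * a x" for v
    proof -
      have "\<bar>d x \<bullet> v\<bar> \<le> norm (d x) * norm v" by (rule Cauchy_Schwarz_ineq2)
      also have "\<dots> \<le> 2 * l * (norm (u1 x) + norm (u2 x)) * norm v" by (intro mult_right_mono dn) simp
      also have "\<dots> = 2 * l * ((norm (u1 x) + norm (u2 x)) * norm v)" by simp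
      also have "\<dots> \<le> 2 * l * (2 * a x)" using l that by (intro mult_left_mono) auto
      finally show ?thesis by simp
    qed
    have e: "\<epsilon>\<^sup>2 * (4 * l * a x) \<le> 8 * l * A x"
      using mult_left_mono[OF a_le_A[of x], of "4 * l"] l by (simp add: mult_ac)
    have zA: "\<bar>z1 x * A x\<bar> \<le> 2 * l * A x" "\<bar>z2 x * A x\<bar> \<le> 2 * l * A x"
      using z A_nonneg[of x] by (auto simp: abs_mult intro!: mult_right_mono)
    have "\<bar>\<epsilon>\<^sup>2 * (d x \<bullet> u1 x)\<bar> \<le> \<epsilon>\<^sup>2 * (4 * l * a x)" "\<bar>\<epsilon>\<^sup>2 * (d x \<bullet> u2 x)\<bar> \<le> \<epsilon>\<^sup>2 * (4 * l * a x)"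
      using dv[OF key(1)] dv[OF key(2)] unfolding abs_mult by (auto intro!: mult_left_mono)
    then show "\<bar>F1 x\<bar> \<le> 10 * l * A x" "\<bar>F2 x\<bar> \<le> 10 * l * A x"
      using e zA unfolding F1_def F2_def by linarith+
  qed
  \<comment> \<open>\<open>N\<close> is a continuous majorant of the indicator of the set where a
    cutoff varies, so all integrands stay continuous.\<close>
  have cut: "\<bar>D\<phi> x e1 * F1 x\<bar> \<le> 60 * (N x * A x)" "\<bar>D\<phi> x e2 * F2 x\<bar> \<le> 60 * (N x * A x)" if x: "x \<in> ?Q" for x
  proof -
    have nn: "0 \<le> 60 * (N x * A x)" using N(2)[OF x] A_nonneg by simp
    have gen: "\<bar>p * F\<bar> \<le> 60 * (N x * A x)" if "\<bar>p\<bar> \<le> 6 / l" "p \<noteq> 0 \<Longrightarrow> 1 \<le> N x" "\<bar>F\<bar> \<le> 10 * l * A x" for p F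
    proof (cases "p = 0")
      case False
      have "\<bar>p * F\<bar> \<le> 6 / l * (10 * l * A x)"
        unfolding abs_mult using that l by (intro mult_mono) auto
      also have "\<dots> = 60 * (1 * A x)" using l by simp
      also have "\<dots> \<le> 60 * (N x * A x)" using that(2)[OF False] A_nonneg by (intro mult_left_mono mult_right_mono) auto
      finally show ?thesis .
    qed (use nn in simp)
    have "\<bar>\<alpha>' (x \<bullet> e1) * \<beta> (x \<bullet> e2)\<bar> \<le> 6 / l * 1"
      unfolding abs_mult by (rule mult_mono) (use \<alpha>(6) \<beta>(4,5) l in auto)
    moreover have "\<bar>\<alpha> (x \<bullet> e1) * \<beta>' (x \<bullet> e2)\<bar> \<le> 1 * (6 / l)"
      unfolding abs_mult by (rule mult_mono) (use \<beta>(6) \<alpha>(4,5) l in auto)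
    ultimately have "\<bar>D\<phi> x e1\<bar> \<le> 6 / l" "\<bar>D\<phi> x e2\<bar> \<le> 6 / l" by (simp_all add: D\<phi>_def)
    moreover have "1 \<le> N x" if "D\<phi> x e1 \<noteq> 0" using that N(3)[OF x] by (auto simp: D\<phi>_def)
    moreover have "1 \<le> N x" if "D\<phi> x e2 \<noteq> 0" using that N(4)[OF x] by (auto simp: D\<phi>_def)
    ultimately show "\<bar>D\<phi> x e1 * F1 x\<bar> \<le> 60 * (N x * A x)" "\<bar>D\<phi> x e2 * F2 x\<bar> \<le> 60 * (N x * A x)"
      using bound[OF x] by (auto intro!: gen)
  qed
  have "0 = integral ?Q (\<lambda>x. (\<phi> x * DF1 x e1 + D\<phi> x e1 * F1 x) + (\<phi> x * DF2 x e2 + D\<phi> x e2 * F2 x))"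
    using i1 i2 by (subst Henstock_Kurzweil_Integration.integral_add) (auto intro!: int c1)
  also have "\<dots> \<ge> integral ?Q (\<lambda>x. 2 * (\<phi> x * w x) - 120 * (N x * A x))"
  proof (intro integral_le int)
    fix x assume x: "x \<in> ?Q"
    then have "\<phi> x * (DF1 x e1 + DF2 x e2) = \<phi> x * (2 * w x)" using div QU by auto
    then show "2 * (\<phi> x * w x) - 120 * (N x * A x) \<le> (\<phi> x * DF1 x e1 + D\<phi> x e1 * F1 x) + (\<phi> x * DF2 x e2 + D\<phi> x e2 * F2 x)"
      using cut[OF x] by (simp add: abs_le_iff algebra_simps)
  qed (intro c1)+
  finally have "integral ?Q (\<lambda>x. 2 * (\<phi> x * w x) - 120 * (N x * A x)) \<le> 0" .
  moreover have "integral ?Q (\<lambda>x. 2 * (\<phi> x * w x) - 120 * (N x * A x)) = 2 * integral ?Q (\<lambda>x. \<phi> x * w x) - 120 * integral ?Q (\<lambda>x. N x * A x)"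
    by (subst Henstock_Kurzweil_Integration.integral_diff) (auto intro!: int c1)
  ultimately show ?thesis unfolding \<phi>_def by linarith
qed

text \<open>Along the segment the derivative of w is at most sqrt K / \<epsilon> times A, so a line
  integral of A below a small multiple of \<epsilon> keeps w uniformly small. The condition
  \<epsilon> <= 8 l lets 2 / \<epsilon> dominate the reciprocal length 1 / (4 l).\<close>

lemma potential_small_on_segment:
  assumes l: "l > 0" and K: "K > 0" and el: "\<epsilon> \<le> 8 * l" and e: "e = e1 \<or> e = e2"
    and gK: "\<And>x. x \<in> U \<Longrightarrow> (norm (grad V (u x)))\<^sup>2 \<le> K * w x"
    and U: "\<And>t. t \<in> {c - 2 * l..c + 2 * l} \<Longrightarrow> p + t *\<^sub>R e \<in> U" and t: "t \<in> {c - 2 * l..c + 2 * l}"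
    and small: "integral {c - 2 * l..c + 2 * l} (\<lambda>t. A (p + t *\<^sub>R e)) < \<tau>" and \<tau>: "(2 + sqrt K) * \<tau> \<le> k * \<epsilon>"
  shows "w (p + t *\<^sub>R e) < k"
proof -
  let ?I = "integral {c - 2 * l..c + 2 * l} (\<lambda>t. A (p + t *\<^sub>R e))"
  define g' where "g' t = (if e = e1 then w1 (p + t *\<^sub>R e) else w2 (p + t *\<^sub>R e))" for t
  have ne: "e1 \<noteq> e2" by (simp add: Basis_real2)
  have "w (p + t *\<^sub>R e) \<le> (1 / ((c + 2 * l) - (c - 2 * l)) + sqrt K / \<epsilon>) * ?I"
  proof (rule pointwise_le_integral_of_density[where g="\<lambda>t. w (p + t *\<^sub>R e)" and g'=g'])
    fix s assume s: "s \<in> {c - 2 * l..c + 2 * l}"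
    note sU = U[OF s]
    have "((\<lambda>s. w (p + s *\<^sub>R e)) has_derivative (\<lambda>h. ((h *\<^sub>R e) \<bullet> e1) * w1 (p + s *\<^sub>R e) + ((h *\<^sub>R e) \<bullet> e2) * w2 (p + s *\<^sub>R e))) (at s)"
      by (rule has_derivative_compose[where f="\<lambda>s. p + s *\<^sub>R e", OF _ w_der[OF sU]]) (auto intro!: derivative_eq_intros)
    moreover have "(\<lambda>h. ((h *\<^sub>R e) \<bullet> e1) * w1 (p + s *\<^sub>R e) + ((h *\<^sub>R e) \<bullet> e2) * w2 (p + s *\<^sub>R e)) = (*) (g' s)"
      using e ne by (auto simp: g'_def fun_eq_iff)
    ultimately show "((\<lambda>s. w (p + s *\<^sub>R e)) has_real_derivative g' s) (at s within {c - 2 * l..c + 2 * l})"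
      by (simp add: has_field_derivative_def has_derivative_at_withinI)
    show "\<bar>g' s\<bar> \<le> sqrt K / \<epsilon> * A (p + s *\<^sub>R e)"
    proof -
      have "g' s = w1 (p + s *\<^sub>R e) \<or> g' s = w2 (p + s *\<^sub>R e)" by (simp add: g'_def)
      then show ?thesis using w_grad_le[OF K gK[OF sU]] by (elim disjE) (simp_all only:)
    qed
  qed (use l t K eps_pos w_le_A A_nonneg U in \<open>auto intro!: continuous_on_compose2[OF A_cont] continuous_intros\<close>)
  also have "\<dots> \<le> ((2 + sqrt K) / \<epsilon>) * ?I"
  proof (rule mult_right_mono)
    show "0 \<le> ?I"
    proof (rule Henstock_Kurzweil_Integration.integral_nonneg)
      show "(\<lambda>t. A (p + t *\<^sub>R e)) integrable_on {c - 2 * l..c + 2 * l}"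
        by (intro integrable_continuous_interval continuous_on_compose2[OF A_cont] continuous_intros) (use U in auto)
    qed (simp add: A_nonneg)
    have "1 / (4 * l) \<le> 2 / \<epsilon>" using el l eps_pos by (simp add: divide_simps)
    then show "1 / ((c + 2 * l) - (c - 2 * l)) + sqrt K / \<epsilon> \<le> (2 + sqrt K) / \<epsilon>"
      by (simp add: add_divide_distrib)
  qed
  also have "\<dots> < (2 + sqrt K) / \<epsilon> * \<tau>"
    using small eps_pos K by (intro mult_strict_left_mono) (auto intro!: divide_pos_pos add_pos_nonneg)
  also have "\<dots> \<le> k" using \<tau> eps_pos by (simp add: divide_le_eq)
  finally show ?thesis .
qed

text \<open>4 K / L is what the logarithmic weight gains, and 6 sqrt K \<epsilon> / r is the cost of
  its spatial cutoff. In \<open>small\<close>, the denominator collects 8 from l = r / 8, 3 from the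
  mass condition of the one-variable cutoffs, and 2 + sqrt K from the pointwise bound on a
  line.\<close>

lemma potential_decay:
  assumes B: "cball x0 r \<subseteq> U" and r: "r > 0" and K: "K > 0" and \<kappa>: "\<kappa> > 0" and k: "0 < k" "k < v0"
    and gK: "\<And>x. x \<in> U \<Longrightarrow> (norm (grad V (u x)))\<^sup>2 \<le> K * w x"
    and convex: "\<And>x \<xi>. x \<in> U \<Longrightarrow> w x < v0 \<Longrightarrow> \<kappa> * (norm \<xi>)\<^sup>2 \<le> hess_apply V (u x) \<xi> \<bullet> \<xi>"
    and coercive: "\<And>x. x \<in> U \<Longrightarrow> w x < v0 \<Longrightarrow> \<kappa> * w x \<le> (norm (grad V (u x)))\<^sup>2"
    and L: "L = ln v0 - ln k" "2 * ln 2 \<le> L" and er: "\<epsilon> \<le> r"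
    and small: "integral (cball x0 r) A \<le> k * \<epsilon> * r / (24 * (2 + sqrt K))"
  shows "integral (cball x0 (r / 8)) w \<le> 569 / \<kappa> * (4 * K / L + 6 * sqrt K * (\<epsilon> / r)) * integral (cball x0 r) A"
proof -
  \<comment> \<open>The square of half side 2 l lies in the disc of radius 4 l = r / 2, on which the
    bump is bounded below, and the cutoffs equal 1 on the disc of radius l = r / 8.\<close>
  define l where "l = r / 8"
  have l: "l > 0" "r = 8 * l" using r by (auto simp: l_def)
  define \<tau> where "\<tau> = k * \<epsilon> / (2 + sqrt K)"
  have sK: "2 + sqrt K > 0" using K by (simp add: add_pos_nonneg)
  have \<tau>: "\<tau> > 0" "(2 + sqrt K) * \<tau> \<le> k * \<epsilon>" using k eps_pos sK by (auto simp: \<tau>_def)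
  let ?c1 = "x0 \<bullet> e1" and ?c2 = "x0 \<bullet> e2"
  define Q where "Q = cbox (vec2 (?c1 - 2 * l) (?c2 - 2 * l)) (vec2 (?c1 + 2 * l) (?c2 + 2 * l))"
  have Q: "vec2 s t \<in> Q \<longleftrightarrow> s \<in> {?c1 - 2 * l..?c1 + 2 * l} \<and> t \<in> {?c2 - 2 * l..?c2 + 2 * l}" for s t
    unfolding Q_def by (rule cbox_vec2)
  have Qr2: "Q \<subseteq> cball x0 (r / 2)"
  proof
    fix x assume "x \<in> Q"
    then have "vec2 (x \<bullet> e1) (x \<bullet> e2) \<in> Q" by (simp add: vec2_eta)
    then have b: "\<bar>(x - x0) \<bullet> e1\<bar> \<le> 2 * l" "\<bar>(x - x0) \<bullet> e2\<bar> \<le> 2 * l"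
      unfolding Q by (auto simp: inner_diff_left)
    have "norm (x - x0) \<le> (\<Sum>b\<in>Basis. \<bar>(x - x0) \<bullet> b\<bar>)" by (rule norm_le_l1)
    also have "\<dots> \<le> r / 2" using b by (simp add: sum_Basis_real2 l(2))
    finally show "x \<in> cball x0 (r / 2)" by (simp add: dist_norm norm_minus_commute)
  qed
  have r2: "cball x0 (r / 2) \<subseteq> cball x0 r" using r by auto
  have QU: "Q \<subseteq> U" using Qr2 r2 B by blast
  have intA: "integral Q A \<le> \<tau> * l / 3"
  proof -
    have "integral Q A \<le> integral (cball x0 r) A"
      by (intro integral_subset_le integrable_on_compact continuous_on_subset[OF A_cont] compact_cball)
        (use Qr2 r2 QU B A_nonneg in \<open>auto simp: Q_def\<close>)
    also note small
    also have "k * \<epsilon> * r / (24 * (2 + sqrt K)) = \<tau> * l / 3"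
    proof -
      have "k * \<epsilon> * (8 * l) / (24 * s) = k * \<epsilon> / s * l / 3" for s by (simp add: mult_ac)
      then show ?thesis unfolding \<tau>_def l(2) .
    qed
    finally show ?thesis .
  qed
  have AQ: "continuous_on Q A" by (rule continuous_on_subset[OF A_cont QU])
  \<comment> \<open>Energies of the vertical and of the horizontal lines; by Fubini both integrate
    to the energy of the square.\<close>
  define a1 where "a1 s = integral {?c2 - 2 * l..?c2 + 2 * l} (\<lambda>t. A (vec2 s t))" for s
  define a2 where "a2 t = integral {?c1 - 2 * l..?c1 + 2 * l} (\<lambda>s. A (vec2 s t))" for t
  have a1: "continuous_on {?c1 - 2 * l..?c1 + 2 * l} a1"
    unfolding a1_def box_real[symmetric]
    by (rule integral_continuous_on_param) (auto simp: split_beta Q intro!: continuous_on_compose2[OF AQ] continuous_intros)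
  have a2: "continuous_on {?c2 - 2 * l..?c2 + 2 * l} a2"
    unfolding a2_def box_real[symmetric]
    by (rule integral_continuous_on_param) (auto simp: split_beta Q intro!: continuous_on_compose2[OF AQ] continuous_intros)
  have a1_nn: "0 \<le> a1 s" if "s \<in> {?c1 - 2 * l..?c1 + 2 * l}" for s
    unfolding a1_def
    by (intro Henstock_Kurzweil_Integration.integral_nonneg integrable_continuous_interval continuous_on_compose2[OF AQ] continuous_intros)
      (use that in \<open>auto simp: Q A_nonneg\<close>)
  have a2_nn: "0 \<le> a2 t" if "t \<in> {?c2 - 2 * l..?c2 + 2 * l}" for t
    unfolding a2_def
    by (intro Henstock_Kurzweil_Integration.integral_nonneg integrable_continuous_interval continuous_on_compose2[OF AQ] continuous_intros)
      (use that in \<open>auto simp: Q A_nonneg\<close>)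
  have s1: "integral {?c1 - 2 * l..?c1 + 2 * l} a1 \<le> \<tau> * l / 3"
    using intA integral_square_real2(1)[OF AQ[unfolded Q_def]] unfolding a1_def Q_def by simp
  have s2: "integral {?c2 - 2 * l..?c2 + 2 * l} a2 \<le> \<tau> * l / 3"
    using intA integral_square_real2(2)[OF AQ[unfolded Q_def]] unfolding a2_def Q_def by simp
  obtain \<alpha> \<alpha>' where \<alpha>: "\<And>t. (\<alpha> has_real_derivative \<alpha>' t) (at t)" "continuous_on UNIV \<alpha>'"
    "\<And>t. t \<notin> {?c1 - 2 * l..?c1 + 2 * l} \<Longrightarrow> \<alpha> t = 0" "\<And>t. t \<in> {?c1 - l..?c1 + l} \<Longrightarrow> \<alpha> t = 1"
    "\<And>t. 0 \<le> \<alpha> t" "\<And>t. \<alpha> t \<le> 1" "\<And>t. \<bar>\<alpha>' t\<bar> \<le> 6 / l"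
    "\<And>t. \<alpha>' t \<noteq> 0 \<Longrightarrow> t \<in> {?c1 - 2 * l..?c1 + 2 * l} \<and> a1 t < \<tau>"
    by (rule C1_cutoff_avoiding_large_values[OF l(1) \<tau>(1) a1 _ s1], erule a1_nn, (rule that; assumption))
  obtain \<beta> \<beta>' where \<beta>: "\<And>t. (\<beta> has_real_derivative \<beta>' t) (at t)" "continuous_on UNIV \<beta>'"
    "\<And>t. t \<notin> {?c2 - 2 * l..?c2 + 2 * l} \<Longrightarrow> \<beta> t = 0" "\<And>t. t \<in> {?c2 - l..?c2 + l} \<Longrightarrow> \<beta> t = 1"
    "\<And>t. 0 \<le> \<beta> t" "\<And>t. \<beta> t \<le> 1" "\<And>t. \<bar>\<beta>' t\<bar> \<le> 6 / l"
    "\<And>t. \<beta>' t \<noteq> 0 \<Longrightarrow> t \<in> {?c2 - 2 * l..?c2 + 2 * l} \<and> a2 t < \<tau>"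
    by (rule C1_cutoff_avoiding_large_values[OF l(1) \<tau>(1) a2 _ s2], erule a2_nn, (rule that; assumption))
  have el: "\<epsilon> \<le> 8 * l" using er l by simp
  have v1: "vec2 s t = vec2 s 0 + t *\<^sub>R e2" and v2: "vec2 s t = vec2 0 t + s *\<^sub>R e1" for s t
    by (simp_all add: vec2_def)
  have near1: "w x < k" if x: "x \<in> Q" and d: "\<alpha>' (x \<bullet> e1) \<noteq> 0" for x
  proof -
    have xQ: "vec2 (x \<bullet> e1) (x \<bullet> e2) \<in> Q" using x by (simp add: vec2_eta)
    have "w (vec2 (x \<bullet> e1) 0 + (x \<bullet> e2) *\<^sub>R e2) < k"
    proof (rule potential_small_on_segment[OF l(1) K el _ gK _ _ _ \<tau>(2), where c="?c2"])
      show "vec2 (x \<bullet> e1) 0 + t *\<^sub>R e2 \<in> U" if "t \<in> {?c2 - 2 * l..?c2 + 2 * l}" for t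
        using xQ that QU Q[of "x \<bullet> e1" t] Q[of "x \<bullet> e1" "x \<bullet> e2"] unfolding v1[symmetric] by blast
      show "x \<bullet> e2 \<in> {?c2 - 2 * l..?c2 + 2 * l}" using xQ Q by blast
      show "integral {?c2 - 2 * l..?c2 + 2 * l} (\<lambda>t. A (vec2 (x \<bullet> e1) 0 + t *\<^sub>R e2)) < \<tau>"
        using \<alpha>(8)[OF d] unfolding a1_def v1[symmetric] by blast
    qed auto
    then show ?thesis by (simp only: v1[symmetric] vec2_eta)
  qed
  have near2: "w x < k" if x: "x \<in> Q" and d: "\<beta>' (x \<bullet> e2) \<noteq> 0" for x
  proof -
    have xQ: "vec2 (x \<bullet> e1) (x \<bullet> e2) \<in> Q" using x by (simp add: vec2_eta)
    have "w (vec2 0 (x \<bullet> e2) + (x \<bullet> e1) *\<^sub>R e1) < k"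
    proof (rule potential_small_on_segment[OF l(1) K el _ gK _ _ _ \<tau>(2), where c="?c1"])
      show "vec2 0 (x \<bullet> e2) + t *\<^sub>R e1 \<in> U" if "t \<in> {?c1 - 2 * l..?c1 + 2 * l}" for t
        using xQ that QU Q[of t "x \<bullet> e2"] Q[of "x \<bullet> e1" "x \<bullet> e2"] unfolding v2[symmetric] by blast
      show "x \<bullet> e1 \<in> {?c1 - 2 * l..?c1 + 2 * l}" using xQ Q by blast
      show "integral {?c1 - 2 * l..?c1 + 2 * l} (\<lambda>t. A (vec2 0 (x \<bullet> e2) + t *\<^sub>R e1)) < \<tau>"
        using \<beta>(8)[OF d] unfolding a2_def v2[symmetric] by blast
    qed auto
    then show ?thesis by (simp only: v2[symmetric] vec2_eta)
  qed
  let ?lw = "log_weight v0 k"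
  have L0: "L > 0" using L(2) ln_gt_zero[of "2::real"] by linarith
  \<comment> \<open>On {w < k} the weight is at least L - ln 2 >= L / 2, so \<open>N\<close> is at
    least 1 wherever a cutoff varies.\<close>
  define N where "N x = 4 / L\<^sup>2 * (?lw (w x))\<^sup>2" for x
  have lwc: "continuous_on U (\<lambda>x. ?lw (w x))"
    unfolding log_weight_def by (intro continuous_intros w_cont) (use k w_nonneg in \<open>auto simp: add_nonneg_eq_0_iff less_imp_le\<close>)
  have N1: "1 \<le> N x" if "w x < k" for x
  proof -
    have "ln (w x + k) \<le> ln (2 * k)" using that k w_nonneg[of x] by simp
    also have "\<dots> = ln 2 + ln k" using k by (simp add: ln_mult)
    finally have "L / 2 \<le> ?lw (w x)" using L unfolding log_weight_def by linarith
    then have "(L / 2)\<^sup>2 \<le> (?lw (w x))\<^sup>2" using L0 by (intro power_mono) auto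
    then show ?thesis using L0 by (simp add: N_def power_divide field_simps)
  qed
  have Nc: "continuous_on U N" unfolding N_def by (intro continuous_intros lwc)
  have N_nn: "0 \<le> N x" for x by (simp add: N_def)
  have poh: "integral Q (\<lambda>x. \<alpha> (x \<bullet> e1) * \<beta> (x \<bullet> e2) * w x) \<le> 60 * integral Q (\<lambda>x. N x * A x)"
    unfolding Q_def
    by (rule pohozaev_inequality[OF l(1) _ \<alpha>(1-3,5-7) \<beta>(1-3,5-7) Nc N_nn])
      (use QU N1 near1 near2 in \<open>auto simp: Q_def\<close>)
  have inner: "x \<bullet> e1 \<in> {?c1 - l..?c1 + l}" "x \<bullet> e2 \<in> {?c2 - l..?c2 + l}" if "x \<in> cball x0 (r / 8)" for x
  proof -
    have "norm (x - x0) \<le> l" using that by (simp add: dist_norm norm_minus_commute l(2))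
    moreover have "\<bar>(x - x0) \<bullet> b\<bar> \<le> norm (x - x0)" if "b \<in> Basis" for b using that by (rule Basis_le_norm)
    ultimately have "\<bar>(x - x0) \<bullet> e1\<bar> \<le> l" "\<bar>(x - x0) \<bullet> e2\<bar> \<le> l" by (auto simp: Basis_real2 intro: order_trans)
    then show "x \<bullet> e1 \<in> {?c1 - l..?c1 + l}" "x \<bullet> e2 \<in> {?c2 - l..?c2 + l}" by (auto simp: inner_diff_left)
  qed
  have sub8: "cball x0 (r / 8) \<subseteq> Q"
  proof
    fix x assume "x \<in> cball x0 (r / 8)"
    from inner[OF this] have "vec2 (x \<bullet> e1) (x \<bullet> e2) \<in> Q" unfolding Q using l(1) by auto
    then show "x \<in> Q" by (simp add: vec2_eta)
  qed
  have QC: "compact Q" by (simp add: Q_def)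
  have \<alpha>c: "continuous_on S (\<lambda>x. \<alpha> (x \<bullet> e1))" and \<beta>c: "continuous_on S (\<lambda>x. \<beta> (x \<bullet> e2))" for S
  proof -
    have a: "continuous_on UNIV \<alpha>" "continuous_on UNIV \<beta>"
      using \<alpha>(1) \<beta>(1) by (auto intro!: continuous_at_imp_continuous_on DERIV_isCont)
    show "continuous_on S (\<lambda>x. \<alpha> (x \<bullet> e1))" by (rule continuous_on_compose2[OF a(1)]) (auto intro!: continuous_intros)
    show "continuous_on S (\<lambda>x. \<beta> (x \<bullet> e2))" by (rule continuous_on_compose2[OF a(2)]) (auto intro!: continuous_intros)
  qed
  note intQ = integrable_on_compact(1)[OF QC continuous_on_subset[OF _ QU]]
  note c = continuous_intros A_cont w_cont Nc lwc \<alpha>c \<beta>c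
  have "integral (cball x0 (r / 8)) w = integral (cball x0 (r / 8)) (\<lambda>x. \<alpha> (x \<bullet> e1) * \<beta> (x \<bullet> e2) * w x)"
    by (rule integral_cong) (simp add: \<alpha>(4)[OF inner(1)] \<beta>(4)[OF inner(2)])
  also have "\<dots> \<le> integral Q (\<lambda>x. \<alpha> (x \<bullet> e1) * \<beta> (x \<bullet> e2) * w x)"
  proof (rule integral_subset_le[OF sub8])
    show "(\<lambda>x. \<alpha> (x \<bullet> e1) * \<beta> (x \<bullet> e2) * w x) integrable_on cball x0 (r / 8)"
      by (rule integrable_on_compact(1)[OF compact_cball continuous_on_subset[OF _ order_trans[OF sub8 QU]]]) (intro c)
    show "(\<lambda>x. \<alpha> (x \<bullet> e1) * \<beta> (x \<bullet> e2) * w x) integrable_on Q" by (intro intQ c)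
    show "\<forall>x\<in>Q. 0 \<le> \<alpha> (x \<bullet> e1) * \<beta> (x \<bullet> e2) * w x" using \<alpha>(5) \<beta>(5) w_nonneg by simp
  qed
  finally have i1: "integral (cball x0 (r / 8)) w \<le> integral Q (\<lambda>x. \<alpha> (x \<bullet> e1) * \<beta> (x \<bullet> e2) * w x)" .
  have i2: "integral Q (\<lambda>x. N x * A x) = 4 / L\<^sup>2 * integral Q (\<lambda>x. (?lw (w x))\<^sup>2 * A x)"
    unfolding N_def mult.assoc by simp
  have i3: "integral Q (\<lambda>x. (?lw (w x))\<^sup>2 * A x) \<le> integral (cball x0 (r / 2)) (\<lambda>x. (?lw (w x))\<^sup>2 * A x)"
  proof (rule integral_subset_le[OF Qr2])
    show "(\<lambda>x. (?lw (w x))\<^sup>2 * A x) integrable_on Q" by (intro intQ c)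
    show "(\<lambda>x. (?lw (w x))\<^sup>2 * A x) integrable_on cball x0 (r / 2)"
      by (rule integrable_on_compact(1)[OF compact_cball continuous_on_subset[OF _ order_trans[OF r2 B]]]) (intro c)
    show "\<forall>x\<in>cball x0 (r / 2). 0 \<le> (?lw (w x))\<^sup>2 * A x" using A_nonneg by simp
  qed
  have "4 / L\<^sup>2 * integral Q (\<lambda>x. (?lw (w x))\<^sup>2 * A x) \<le> 4 / L\<^sup>2 * integral (cball x0 (r / 2)) (\<lambda>x. (?lw (w x))\<^sup>2 * A x)"
    by (rule mult_left_mono[OF i3]) simp
  with i1 i2 poh have 1: "integral (cball x0 (r / 8)) w \<le> 60 * (4 / L\<^sup>2 * integral (cball x0 (r / 2)) (\<lambda>x. (?lw (w x))\<^sup>2 * A x))"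
    by linarith
  let ?J = "integral (cball x0 r) (\<lambda>x. bump_base x0 r x ^ 3 * ((?lw (w x))\<^sup>2 * A x))"
  let ?I2 = "integral (cball x0 (r / 2)) (\<lambda>x. (?lw (w x))\<^sup>2 * A x)"
  have 2: "27 / 64 * r ^ 6 * ?I2 \<le> ?J"
    by (rule integral_inner_cball_le_bump[OF continuous_on_subset[OF _ B] _ r]) (auto intro!: c simp: A_nonneg)
  have 3: "\<kappa> * ?J \<le> r ^ 6 * (4 * K * L + 6 * L\<^sup>2 * sqrt K * \<epsilon> / r) * integral (cball x0 r) A"
    by (rule near_energy_bound[OF B r K \<kappa> k gK convex coercive L(1)])
  have I_nn: "0 \<le> integral (cball x0 r) A"
    by (intro Henstock_Kurzweil_Integration.integral_nonneg integrable_on_compact compact_cball continuous_on_subset[OF A_cont B] A_nonneg)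
  have "r ^ 6 * (27 / 64 * \<kappa> * ?I2) \<le> r ^ 6 * ((4 * K * L + 6 * L\<^sup>2 * sqrt K * \<epsilon> / r) * integral (cball x0 r) A)"
  proof -
    have "\<kappa> * (27 / 64 * r ^ 6 * ?I2) \<le> \<kappa> * ?J" using 2 \<kappa> by (intro mult_left_mono) auto
    from order_trans[OF this 3]
    show ?thesis by (simp only: mult_ac)
  qed
  then have "27 / 64 * \<kappa> * ?I2 \<le> (4 * K * L + 6 * L\<^sup>2 * sqrt K * \<epsilon> / r) * integral (cball x0 r) A"
    by (rule mult_left_le_imp_le) (use r in simp)
  then have 4: "?I2 \<le> 64 / 27 / \<kappa> * ((4 * K * L + 6 * L\<^sup>2 * sqrt K * \<epsilon> / r) * integral (cball x0 r) A)"
    using \<kappa> by (simp add: field_simps)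
  have "integral (cball x0 (r / 8)) w \<le> 60 * (4 / L\<^sup>2 * (64 / 27 / \<kappa> * ((4 * K * L + 6 * L\<^sup>2 * sqrt K * \<epsilon> / r) * integral (cball x0 r) A)))"
    by (rule order_trans[OF 1]) (intro mult_left_mono 4, use L0 in auto)
  also have "\<dots> = (60 * 4 * 64 / 27) * (1 / \<kappa> * (4 * K / L + 6 * sqrt K * (\<epsilon> / r)) * integral (cball x0 r) A)"
    using L0 \<kappa> r by (simp add: field_simps power2_eq_square)
  \<comment> \<open>60 * 4 * 64 / 27 = 568.9 collects Pohozaev's constant, the normalisation of
    \<open>N\<close>, and the lower bound (3 / 4)^3 r^6 of the cubed bump on the half disc.\<close>
  also have "\<dots> \<le> 569 * (1 / \<kappa> * (4 * K / L + 6 * sqrt K * (\<epsilon> / r)) * integral (cball x0 r) A)"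
  proof (rule mult_right_mono)
    show "0 \<le> 1 / \<kappa> * (4 * K / L + 6 * sqrt K * (\<epsilon> / r)) * integral (cball x0 r) A"
      using \<kappa> K L0 eps_pos r I_nn by (intro mult_nonneg_nonneg add_nonneg_nonneg) auto
  qed simp
  also have "\<dots> = 569 / \<kappa> * (4 * K / L + 6 * sqrt K * (\<epsilon> / r)) * integral (cball x0 r) A"
    by (simp only: mult.assoc[symmetric] times_divide_eq_right mult_1_right)
  finally show ?thesis .
qed

end

subsection \<open>Iteration over scales\<close>

lemma Ck_on_subset: "Ck_on n f S \<Longrightarrow> T \<subseteq> S \<Longrightarrow> Ck_on n f T"
  by (induction n arbitrary: f) (auto intro: continuous_on_subset)

lemma (in solution) solution_subset:
  assumes "open U'" "U' \<subseteq> U"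
  shows "solution V \<epsilon> u U'"
proof
  show "is_solution V \<epsilon> U' u"
    using sol assms Ck_on_subset unfolding is_solution_def smooth_on_def by blast
qed (use V_smooth V_nonneg eps_pos assms in auto)

text \<open>The bound I(r) <= \<eta> \<epsilon> r is linear in r, so the condition of
  \<open>step\<close> reproduces itself at r / 16. The descent ends at the first radius below
  \<epsilon> / d, which is still at least \<epsilon> / 16; there a bound linear in r becomes
  quadratic in \<epsilon>.\<close>

lemma scale_iteration:
  fixes I :: "real \<Rightarrow> real"
  assumes mono: "\<And>s r. 0 < s \<Longrightarrow> s \<le> r \<Longrightarrow> r \<le> 1 / 16 \<Longrightarrow> I s \<le> I r"
    and \<epsilon>: "0 < \<epsilon>" "\<epsilon> \<le> 1" and d: "0 < d" "d \<le> 1" and \<eta>: "\<eta> > 0"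
    and step: "\<And>r. 0 < r \<Longrightarrow> r \<le> 1 / 16 \<Longrightarrow> \<epsilon> \<le> d * r \<Longrightarrow> I r \<le> \<eta> * \<epsilon> * r \<Longrightarrow> I (r / 16) \<le> I r / 16"
    and start: "I (1 / 16) \<le> \<eta> * \<epsilon> * (1 / 16)"
  shows "I (\<epsilon> / 16) \<le> \<eta> / d * \<epsilon>\<^sup>2"
proof -
  define r where "r n = (1 / 16 :: real) ^ Suc n" for n
  have r: "0 < r n" "r n \<le> 1 / 16" "r (Suc n) = r n / 16" for n
    by (simp_all add: r_def power_le_one)
  have ex: "\<exists>n. d * r n < \<epsilon>"
  proof -
    obtain n where n: "(1 / 16 :: real) ^ n < \<epsilon> / d" using real_arch_pow_inv[of "\<epsilon> / d" "1 / 16"] \<epsilon> d by auto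
    have "r n \<le> (1 / 16) ^ n" by (simp add: r_def)
    then have "r n < \<epsilon> / d" using n by linarith
    then have "d * r n < \<epsilon>" using d by (simp add: pos_less_divide_eq mult.commute)
    then show ?thesis ..
  qed
  define n where "n = (LEAST n. d * r n < \<epsilon>)"
  have n: "d * r n < \<epsilon>" unfolding n_def using ex by (rule LeastI_ex)
  have before: "\<epsilon> \<le> d * r m" if "m < n" for m
    using not_less_Least[OF that[unfolded n_def]] by simp
  have I: "I (r m) \<le> \<eta> * \<epsilon> * r m" if "m \<le> n" for m
    using that
  proof (induction m)
    case 0 then show ?case using start by (simp add: r_def)
  next
    case (Suc m)
    then have "I (r m / 16) \<le> I (r m) / 16" by (intro step r before) auto
    also have "\<dots> \<le> \<eta> * \<epsilon> * r m / 16" using Suc by (intro divide_right_mono) auto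
    finally show ?case by (simp add: r(3))
  qed
  \<comment> \<open>Either the descent stops at its start 1 / 16, and \<epsilon> <= 1, or the
    previous radius was at least \<epsilon> / d >= \<epsilon>.\<close>
  have "\<epsilon> / 16 \<le> r n"
  proof (cases n)
    case 0 then show ?thesis using \<epsilon> by (simp add: r_def)
  next
    case (Suc m)
    then have "\<epsilon> \<le> d * r m" by (intro before) simp
    also have "\<dots> \<le> 1 * r m" using d r(1)[of m] by (intro mult_right_mono) auto
    finally show ?thesis unfolding Suc r(3) by simp
  qed
  then have "I (\<epsilon> / 16) \<le> I (r n)" using \<epsilon> r by (intro mono) auto
  also have "\<dots> \<le> \<eta> * \<epsilon> * r n" by (rule I) simp
  also have "\<dots> \<le> \<eta> * \<epsilon> * (\<epsilon> / d)"
    using n d \<eta> \<epsilon> by (intro mult_left_mono) (auto simp: pos_le_divide_eq mult.commute)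
  finally show ?thesis by (simp add: power2_eq_square)
qed

section \<open>One step of decay, pointwise smallness of the potential, and the gain of a factor
  \<epsilon>\<close>

context solution
begin

lemma integral_A_mono:
  assumes "s \<le> r" "cball x0 r \<subseteq> U"
  shows "integral (cball x0 s) A \<le> integral (cball x0 r) A"
proof -
  have sub: "cball x0 s \<subseteq> cball x0 r" using assms by auto
  show ?thesis
    by (intro integral_subset_le sub integrable_on_compact compact_cball continuous_on_subset[OF A_cont])
      (use sub assms A_nonneg in auto)
qed

lemma energy_density_eq: "energy_density V \<epsilon> u x = A x / \<epsilon>"
  using eps_pos by (simp add: energy_density_def A_def a_def w_def sum_Basis_real2 field_simps power2_eq_square)

lemma energy_cball:
  assumes "cball x0 r \<subseteq> U"
  shows "energy V \<epsilon> u (cball x0 r) = ennreal (integral (cball x0 r) A / \<epsilon>)"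
proof -
  have c: "continuous_on (cball x0 r) A" using continuous_on_subset[OF A_cont assms] .
  have "energy V \<epsilon> u (cball x0 r) = (\<integral>\<^sup>+x. ennreal (indicator (cball x0 r) x * (A x / \<epsilon>)) \<partial>lborel)"
    unfolding energy_def energy_density_eq
    by (rule nn_integral_cong) (simp add: indicator_def)
  also have "\<dots> = ennreal (\<integral>x. indicator (cball x0 r) x * (A x / \<epsilon>) \<partial>lborel)"
  proof (rule nn_integral_eq_integral)
    have "continuous_on (cball x0 r) (\<lambda>x. A x / \<epsilon>)" using c eps_pos by (intro continuous_intros) auto
    from borel_integrable_compact[OF compact_cball this]
    show "integrable lborel (\<lambda>x. indicator (cball x0 r) x * (A x / \<epsilon>))" by simp
  qed (use A_nonneg eps_pos in auto)
  also have "(\<integral>x. indicator (cball x0 r) x * (A x / \<epsilon>) \<partial>lborel) = integral (cball x0 r) (\<lambda>x. A x / \<epsilon>)"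
  proof -
    have "continuous_on (cball x0 r) (\<lambda>x. A x / \<epsilon>)" using c eps_pos by (intro continuous_intros) auto
    from integrable_on_compact(3)[OF compact_cball this] show ?thesis by (simp add: set_lebesgue_integral_def)
  qed
  finally show ?thesis by simp
qed

lemma energy_mono: "S \<subseteq> T \<Longrightarrow> energy V \<epsilon> u S \<le> energy V \<epsilon> u T"
  unfolding energy_def by (rule nn_integral_mono) (auto simp: indicator_def)

text \<open>Two losses of radius: from r to r / 8 Pohozaev's identity bounds the potential, and from
  r / 8 to r / 16 the potential bounds the energy. 192 is 24 * 8, since the second estimate runs at
  radius r / 8.\<close>

lemma energy_decay:
  assumes B: "cball x0 r \<subseteq> U" and r: "r > 0" and K: "K > 0" and \<kappa>: "\<kappa> > 0" and k: "0 < k" "k < v0"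
    and gK: "\<And>x. x \<in> U \<Longrightarrow> (norm (grad V (u x)))\<^sup>2 \<le> K * w x"
    and convex: "\<And>x \<xi>. x \<in> U \<Longrightarrow> w x < v0 \<Longrightarrow> \<kappa> * (norm \<xi>)\<^sup>2 \<le> hess_apply V (u x) \<xi> \<bullet> \<xi>"
    and coercive: "\<And>x. x \<in> U \<Longrightarrow> w x < v0 \<Longrightarrow> \<kappa> * w x \<le> (norm (grad V (u x)))\<^sup>2"
    and C: "\<And>x. x \<in> U \<Longrightarrow> \<epsilon>\<^sup>2 * a x \<le> C" "C \<ge> 0"
    and L: "L = ln v0 - ln k" "2 * ln 2 \<le> L" and er: "\<epsilon> \<le> r"
    and small: "integral (cball x0 r) A \<le> k * \<epsilon> * r / (24 * (2 + sqrt K))"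
  shows "integral (cball x0 (r / 16)) A \<le>
    64 / 27 * ((8 * K * C / (v0 * \<kappa>) + 1 + C / v0) * (569 / \<kappa> * (4 * K / L + 6 * sqrt K * (\<epsilon> / r)))
      + 192 * sqrt K / \<kappa> * (\<epsilon> / r)) * integral (cball x0 r) A"
proof -
  let ?I = "integral (cball x0 r) A" and ?c = "8 * K * C / (v0 * \<kappa>) + 1 + C / v0"
  have v0: "v0 > 0" using k by simp
  have sub: "cball x0 (r / 8) \<subseteq> cball x0 r" using r by auto
  have c: "0 \<le> ?c" using K C v0 \<kappa> by (intro add_nonneg_nonneg divide_nonneg_nonneg mult_nonneg_nonneg) auto
  have "integral (cball x0 (r / 8 / 2)) A \<le> 64 / 27 * (?c * integral (cball x0 (r / 8)) w
      + 24 * sqrt K / \<kappa> * (\<epsilon> / (r / 8)) * integral (cball x0 (r / 8)) A)"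
    by (rule energy_le_potential[OF order_trans[OF sub B] _ K \<kappa> v0 gK convex coercive C]) (use r in auto)
  also have "\<dots> \<le> 64 / 27 * (?c * (569 / \<kappa> * (4 * K / L + 6 * sqrt K * (\<epsilon> / r)) * ?I) + 24 * sqrt K / \<kappa> * (\<epsilon> / (r / 8)) * ?I)"
  proof (intro mult_left_mono add_mono)
    show "integral (cball x0 (r / 8)) w \<le> 569 / \<kappa> * (4 * K / L + 6 * sqrt K * (\<epsilon> / r)) * ?I"
      by (rule potential_decay[OF B r K \<kappa> k gK convex coercive L er small])
    show "integral (cball x0 (r / 8)) A \<le> ?I" by (rule integral_A_mono[OF _ B]) (use r in simp)
  qed (use c K \<kappa> eps_pos r in auto)
  also have "\<dots> = 64 / 27 * (?c * (569 / \<kappa> * (4 * K / L + 6 * sqrt K * (\<epsilon> / r))) + 192 * sqrt K / \<kappa> * (\<epsilon> / r)) * ?I"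
  proof -
    have "24 * sqrt K / \<kappa> * (\<epsilon> / (r / 8)) = 192 * sqrt K / \<kappa> * (\<epsilon> / r)" by simp
    then show ?thesis by (simp only: distrib_right mult.assoc)
  qed
  finally show ?thesis by simp
qed

text \<open>The gradient of w is of order 1 / \<epsilon>, so w varies by at most v0 / 2 on the disc
  of radius s \<epsilon>. A value w(x0) >= v0 would force an energy of v0 / 2 times the area pi s^2
  \<epsilon>^2, more than \<delta> \<epsilon>^2.\<close>

lemma potential_less:
  assumes B: "cball x0 (1 / 16) \<subseteq> U" and \<epsilon>1: "\<epsilon> \<le> 1"
    and G: "G \<ge> 0" "\<And>x. x \<in> U \<Longrightarrow> norm (grad V (u x)) \<le> G" and C: "\<And>x. x \<in> U \<Longrightarrow> \<epsilon>\<^sup>2 * a x \<le> C" "C \<ge> 0"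
    and I: "integral (cball x0 (\<epsilon> / 16)) A \<le> \<delta> * \<epsilon>\<^sup>2" and s: "0 < s" "s \<le> 1 / 16" "2 * G * sqrt C * s \<le> v0 / 2"
    and \<delta>: "\<delta> < v0 / 2 * pi * s\<^sup>2"
  shows "w x0 < v0"
proof (rule ccontr)
  assume "\<not> w x0 < v0"
  then have w0: "v0 \<le> w x0" by simp
  let ?B = "cball x0 (s * \<epsilon>)"
  have "s * \<epsilon> \<le> 1 / 16 * \<epsilon>" using s eps_pos by (intro mult_right_mono) auto
  then have sub1: "?B \<subseteq> cball x0 (\<epsilon> / 16)" by (intro subset_cball) simp
  have sub2: "cball x0 (\<epsilon> / 16) \<subseteq> U" using \<epsilon>1 B by (auto intro: order_trans[rotated])
  have sub: "?B \<subseteq> U" using sub1 sub2 by auto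
  have w_ge: "v0 / 2 \<le> w x" if x: "x \<in> ?B" for x
  proof -
    have "norm (w x0 - w x) \<le> 2 * G * sqrt C / \<epsilon> * norm (x0 - x)"
    proof (rule differentiable_bound[where S="?B"])
      show "convex ?B" by simp
      fix y assume "y \<in> ?B"
      then have y: "y \<in> U" using sub by auto
      show "(w has_derivative (\<lambda>h. (h \<bullet> e1) * w1 y + (h \<bullet> e2) * w2 y)) (at y within ?B)"
        by (rule has_derivative_at_withinI[OF w_der[OF y]])
      show "onorm (\<lambda>h. (h \<bullet> e1) * w1 y + (h \<bullet> e2) * w2 y) \<le> 2 * G * sqrt C / \<epsilon>"
      proof (rule onorm_le)
        fix h :: "real ^ 2"
        have ay: "a y \<le> (sqrt C / \<epsilon>)\<^sup>2"
          using C(1)[OF y] C(2) eps_pos by (simp add: power_divide pos_le_divide_eq mult.commute)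
        have sC: "0 \<le> sqrt C / \<epsilon>" using C(2) eps_pos by simp
        have "(norm (u1 y))\<^sup>2 \<le> a y" "(norm (u2 y))\<^sup>2 \<le> a y" by (simp_all add: a_def)
        then have n: "norm (u1 y) \<le> sqrt C / \<epsilon>" "norm (u2 y) \<le> sqrt C / \<epsilon>"
          by (auto intro!: power2_le_imp_le[OF order_trans[OF _ ay] sC])
        have "\<bar>w1 y\<bar> \<le> norm (grad V (u y)) * norm (u1 y)" "\<bar>w2 y\<bar> \<le> norm (grad V (u y)) * norm (u2 y)"
          unfolding w1_def w2_def by (rule Cauchy_Schwarz_ineq2)+
        moreover have "norm (grad V (u y)) * norm (u1 y) \<le> G * (sqrt C / \<epsilon>)" "norm (grad V (u y)) * norm (u2 y) \<le> G * (sqrt C / \<epsilon>)"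
          by (intro mult_mono G(2)[OF y] n G(1) norm_ge_zero)+
        ultimately have wb: "\<bar>w1 y\<bar> \<le> G * (sqrt C / \<epsilon>)" "\<bar>w2 y\<bar> \<le> G * (sqrt C / \<epsilon>)" by linarith+
        have hb: "\<bar>h \<bullet> e1\<bar> \<le> norm h" "\<bar>h \<bullet> e2\<bar> \<le> norm h" by (auto intro!: Basis_le_norm simp: Basis_real2)
        have "\<bar>(h \<bullet> e1) * w1 y\<bar> \<le> norm h * (G * (sqrt C / \<epsilon>))" "\<bar>(h \<bullet> e2) * w2 y\<bar> \<le> norm h * (G * (sqrt C / \<epsilon>))"
          unfolding abs_mult by (intro mult_mono hb wb; simp)+
        then have "\<bar>(h \<bullet> e1) * w1 y + (h \<bullet> e2) * w2 y\<bar> \<le> 2 * (norm h * (G * (sqrt C / \<epsilon>)))" by linarith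
        then show "norm ((h \<bullet> e1) * w1 y + (h \<bullet> e2) * w2 y) \<le> 2 * G * sqrt C / \<epsilon> * norm h"
          by (simp add: mult_ac)
      qed
    qed (use x s eps_pos in auto)
    also have "\<dots> \<le> 2 * G * sqrt C / \<epsilon> * (s * \<epsilon>)"
    proof (rule mult_left_mono)
      show "norm (x0 - x) \<le> s * \<epsilon>" using x by (simp add: dist_norm)
      show "0 \<le> 2 * G * sqrt C / \<epsilon>" using G C(2) eps_pos by simp
    qed
    also have "\<dots> = 2 * G * sqrt C * s" using eps_pos by simp
    finally have "\<bar>w x0 - w x\<bar> \<le> v0 / 2" using s(3) by (simp only: real_norm_def)
    then show ?thesis using w0 by linarith
  qed
  have "v0 / 2 * pi * s\<^sup>2 * \<epsilon>\<^sup>2 = v0 / 2 * measure lborel ?B"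
    using s eps_pos by (simp add: measure_cball_real2 power_mult_distrib)
  also have "\<dots> = integral ?B (\<lambda>_. v0 / 2)" by (simp only: integral_const_cball)
  also have "\<dots> \<le> integral ?B A"
  proof (rule integral_le)
    show "(\<lambda>_. v0 / 2) integrable_on ?B" by (intro integrable_on_compact) auto
    show "A integrable_on ?B" by (intro integrable_on_compact continuous_on_subset[OF A_cont sub]) auto
  qed (use w_ge w_le_A order_trans in blast)
  also have "\<dots> \<le> integral (cball x0 (\<epsilon> / 16)) A"
    by (rule integral_A_mono[OF _ sub2]) (use s eps_pos in auto)
  also note I
  finally have "v0 / 2 * pi * s\<^sup>2 \<le> \<delta>" using eps_pos by simp
  then show False using \<delta> by simp
qed

text \<open>Convexity now holds on the whole disc, so the weight may be constant and the term with
  h' disappears. What remains is the flux term, whose factor \<epsilon> is the one gained in the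
  energy estimate.\<close>

lemma energy_improvement:
  assumes B: "cball x0 r \<subseteq> U" and r: "r > 0" "r \<le> 1" and \<rho>: "0 < \<rho>" "\<rho> < r" and K: "K > 0" and \<kappa>: "\<kappa> > 0"
    and gK: "\<And>x. x \<in> cball x0 r \<Longrightarrow> (norm (grad V (u x)))\<^sup>2 \<le> K * w x"
    and convex: "\<And>x \<xi>. x \<in> cball x0 r \<Longrightarrow> \<kappa> * (norm \<xi>)\<^sup>2 \<le> hess_apply V (u x) \<xi> \<bullet> \<xi>"
    and coercive: "\<And>x. x \<in> cball x0 r \<Longrightarrow> \<kappa> * w x \<le> (norm (grad V (u x)))\<^sup>2"
  shows "integral (cball x0 \<rho>) A \<le> 6 * sqrt K / (\<kappa> * (r\<^sup>2 - \<rho>\<^sup>2) ^ 3) * \<epsilon> * integral (cball x0 r) A"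
proof -
  let ?m = "bump_base x0 r" and ?I = "integral (cball x0 r) A"
  have "\<kappa> * integral (cball x0 r) (\<lambda>x. ?m x ^ 3 * 1 * A x)
    \<le> K * integral (cball x0 r) (\<lambda>x. ?m x ^ 3 * (\<bar>0\<bar> * w x) * (\<epsilon>\<^sup>2 * a x)) + 6 * r ^ 5 * 1 * sqrt K * \<epsilon> * ?I"
    by (rule weighted_energy_bound[OF B r(1) K \<kappa> gK, where h="\<lambda>_. 1" and h'="\<lambda>_. 0"])
      (use convex coercive in auto)
  then have 1: "\<kappa> * integral (cball x0 r) (\<lambda>x. ?m x ^ 3 * A x) \<le> r ^ 5 * (6 * sqrt K * \<epsilon> * ?I)" by simp
  have I_nn: "0 \<le> ?I"
    by (intro Henstock_Kurzweil_Integration.integral_nonneg integrable_on_compact compact_cball continuous_on_subset[OF A_cont B] A_nonneg)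
  have "r ^ 5 * (6 * sqrt K * \<epsilon> * ?I) \<le> 1 * (6 * sqrt K * \<epsilon> * ?I)"
    using r K eps_pos I_nn by (intro mult_right_mono power_le_one) auto
  with 1 have 2: "\<kappa> * integral (cball x0 r) (\<lambda>x. ?m x ^ 3 * A x) \<le> 6 * sqrt K * \<epsilon> * ?I" by linarith
  have sub: "cball x0 \<rho> \<subseteq> cball x0 r" using \<rho> by auto
  have pos: "0 < (r\<^sup>2 - \<rho>\<^sup>2) ^ 3" using \<rho> r by (intro zero_less_power) (simp add: power_strict_mono)
  have "(r\<^sup>2 - \<rho>\<^sup>2) ^ 3 * integral (cball x0 \<rho>) A = integral (cball x0 \<rho>) (\<lambda>x. (r\<^sup>2 - \<rho>\<^sup>2) ^ 3 * A x)" by simp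
  also have "\<dots> \<le> integral (cball x0 \<rho>) (\<lambda>x. ?m x ^ 3 * A x)"
  proof (rule integral_le)
    show "(\<lambda>x. (r\<^sup>2 - \<rho>\<^sup>2) ^ 3 * A x) integrable_on cball x0 \<rho>" "(\<lambda>x. ?m x ^ 3 * A x) integrable_on cball x0 \<rho>"
      by (intro integrable_on_compact continuous_on_subset[OF _ order_trans[OF sub B]] continuous_intros A_cont compact_cball)+
    fix x assume "x \<in> cball x0 \<rho>"
    then have "(norm (x - x0))\<^sup>2 \<le> \<rho>\<^sup>2" by (intro power_mono) (auto simp: dist_norm norm_minus_commute)
    then have "r\<^sup>2 - \<rho>\<^sup>2 \<le> ?m x" by (simp add: bump_base_def)
    then have "(r\<^sup>2 - \<rho>\<^sup>2) ^ 3 \<le> ?m x ^ 3" using \<rho> r by (intro power_mono) (auto intro: power_mono)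
    then show "(r\<^sup>2 - \<rho>\<^sup>2) ^ 3 * A x \<le> ?m x ^ 3 * A x" using A_nonneg by (intro mult_right_mono)
  qed
  also have "\<dots> \<le> integral (cball x0 r) (\<lambda>x. ?m x ^ 3 * A x)"
  proof (rule integral_subset_le[OF sub])
    show "(\<lambda>x. ?m x ^ 3 * A x) integrable_on cball x0 \<rho>"
      by (intro integrable_on_compact continuous_on_subset[OF _ order_trans[OF sub B]] continuous_intros A_cont compact_cball)
    show "(\<lambda>x. ?m x ^ 3 * A x) integrable_on cball x0 r"
      by (intro integrable_on_compact continuous_on_subset[OF _ B] continuous_intros A_cont compact_cball)
  qed (simp add: A_nonneg)
  finally have "\<kappa> * ((r\<^sup>2 - \<rho>\<^sup>2) ^ 3 * integral (cball x0 \<rho>) A) \<le> \<kappa> * integral (cball x0 r) (\<lambda>x. ?m x ^ 3 * A x)"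
    using \<kappa> by (intro mult_left_mono) auto
  with 2 have "(\<kappa> * (r\<^sup>2 - \<rho>\<^sup>2) ^ 3) * integral (cball x0 \<rho>) A \<le> 6 * sqrt K * \<epsilon> * ?I" by simp
  then have "integral (cball x0 \<rho>) A \<le> 6 * sqrt K * \<epsilon> * ?I / (\<kappa> * (r\<^sup>2 - \<rho>\<^sup>2) ^ 3)"
    using pos \<kappa> by (simp add: pos_le_divide_eq mult.commute)
  then show ?thesis by simp
qed

end

subsection \<open>Clearing-out\<close>

text \<open>One ball that is hit and the union of all the others are disjoint open sets covering the
  connected image.\<close>

lemma connected_image_in_one_ball:
  fixes f :: "'a::topological_space \<Rightarrow> 'b::metric_space"
  assumes S: "connected S" "S \<noteq> {}" and f: "continuous_on S f"
    and disj: "disjoint_family_on (\<lambda>\<sigma>. ball \<sigma> \<rho>) W"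
    and cover: "\<And>x. x \<in> S \<Longrightarrow> \<exists>\<sigma>\<in>W. f x \<in> ball \<sigma> \<rho>"
  shows "\<exists>\<sigma>\<in>W. \<forall>x\<in>S. f x \<in> ball \<sigma> \<rho>"
proof -
  obtain x0 where x0: "x0 \<in> S" using S by blast
  obtain \<sigma> where \<sigma>: "\<sigma> \<in> W" "f x0 \<in> ball \<sigma> \<rho>" using cover[OF x0] by blast
  let ?V = "\<Union>\<tau>\<in>W - {\<sigma>}. ball \<tau> \<rho>"
  have "ball \<sigma> \<rho> \<inter> ?V \<inter> f ` S = {}"
    using disj \<sigma>(1) unfolding disjoint_family_on_def by blast
  moreover have "f ` S \<subseteq> ball \<sigma> \<rho> \<union> ?V" using cover by blast
  ultimately have "ball \<sigma> \<rho> \<inter> f ` S = {} \<or> ?V \<inter> f ` S = {}"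
    by (intro connectedD[OF connected_continuous_image[OF f S(1)]]) auto
  moreover have "f x0 \<in> ball \<sigma> \<rho> \<inter> f ` S" using \<sigma> x0 by blast
  ultimately have "?V \<inter> f ` S = {}" by blast
  then have "f x \<in> ball \<sigma> \<rho>" if "x \<in> S" for x using cover[OF that] that by blast
  then show ?thesis using \<sigma>(1) by blast
qed

lemma cball_subset_ball_0: "norm (x :: 'a::euclidean_space) + r < s \<Longrightarrow> cball x r \<subseteq> ball 0 s"
  by (rule subsetI) (smt (verit) dist_0_norm dist_triangle mem_ball mem_cball)

lemma (in solution) integral_A_le:
  assumes "cball x r \<subseteq> U" "energy V \<epsilon> u U \<le> ennreal \<eta>" "\<eta> \<ge> 0"
  shows "integral (cball x r) A \<le> \<eta> * \<epsilon>"
proof -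
  have "ennreal (integral (cball x r) A / \<epsilon>) \<le> ennreal \<eta>"
    using energy_cball[OF assms(1)] energy_mono[OF assms(1)] assms(2) by (metis order_trans)
  then have "integral (cball x r) A / \<epsilon> \<le> \<eta>" using assms(3) by (simp add: ennreal_le_iff)
  then show ?thesis using eps_pos by (simp add: divide_le_eq)
qed

text \<open>The constants depend on \<open>V\<close> alone because the bound on \<open>u\<close>
  uses a fixed radius and the energy bound 1, while the gradient bound uses a radius proportional to
  \<epsilon>, so that only the ratio of the two enters.\<close>

lemma uniform_solution_bounds:
  fixes V :: "real ^ 'k \<Rightarrow> real"
  assumes V: "multi_well_potential V"
  obtains M C where "M \<ge> 0" "C \<ge> 0"
    "\<And>\<epsilon> u x. solution V \<epsilon> u (ball 0 1) \<Longrightarrow> \<epsilon> \<le> 1 \<Longrightarrow> energy V \<epsilon> u (ball 0 1) \<le> ennreal 1 \<Longrightarrow>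
       x \<in> ball 0 (7 / 8) \<Longrightarrow> norm (u x) \<le> M \<and> \<epsilon>\<^sup>2 * solution.a u x \<le> C"
proof -
  have sm: "smooth_on UNIV V" using V by (simp add: multi_well_potential_def)
  obtain R \<beta> where R: "R > 0" "\<beta> > 0" "\<And>y. norm y > R \<Longrightarrow> 0 \<le> y \<bullet> grad V y"
    "\<And>y. (norm y)\<^sup>2 \<le> R\<^sup>2 + \<beta> * V y"
    using potential_growth[OF V] by metis
  have b: "bump_mass > 0" by (rule bump_mass_pos)
  \<comment> \<open>1024 = 32^2 comes from averaging over discs of radius 1 / 32, on which the
    integral of the potential is at most \<epsilon> <= 1.\<close>
  define M where "M = sqrt (R\<^sup>2 + 2 + 1024 * \<beta> / bump_mass)"
  have M: "M \<ge> 0" using R b by (simp add: M_def)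
  have Msq: "M\<^sup>2 = R\<^sup>2 + 2 + 1024 * \<beta> / bump_mass"
    unfolding M_def by (rule real_sqrt_pow2) (use R b in simp)
  obtain L where L: "L > 0" "\<And>y h. norm y \<le> M \<Longrightarrow> \<bar>hess_apply V y h \<bullet> h\<bar> \<le> L * (norm h)\<^sup>2"
    using hess_bounded[OF sm, of M] by metis
  have "bounded (grad V ` cball 0 M)"
    by (intro compact_imp_bounded compact_continuous_image continuous_on_grad[OF sm]) auto
  then obtain G' where G': "\<And>y. norm y \<le> M \<Longrightarrow> norm (grad V y) \<le> G'"
    unfolding bounded_iff by force
  define G where "G = max 0 G'"
  have G: "G \<ge> 0" "\<And>y. norm y \<le> M \<Longrightarrow> norm (grad V y) \<le> G" using G' by (force simp: G_def)+
  \<comment> \<open>The right-hand side of the gradient bound at r = \<epsilon> / 128, where r^2 /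
    \<epsilon>^2 = 1 / 16384.\<close>
  define D where "D = 2 * pi * 16384 * (22 * M\<^sup>2 + 5 * M * G / 16384) + L * M\<^sup>2 * pi / 2 + pi * (L * M * G) / 16384"
  define C where "C = 2 * D / bump_mass"
  have "D \<ge> 0" using M G L by (simp add: D_def)
  then have C: "C \<ge> 0" using b by (simp add: C_def)
  have main: "norm (u x) \<le> M \<and> \<epsilon>\<^sup>2 * solution.a u x \<le> C"
    if S: "solution V \<epsilon> u (ball 0 1)" and \<epsilon>: "\<epsilon> \<le> 1" and E: "energy V \<epsilon> u (ball 0 1) \<le> ennreal 1" and x: "x \<in> ball 0 (7 / 8)"
    for \<epsilon> u x
  proof -
    interpret S: solution V \<epsilon> u "ball 0 1" by (rule S)
    \<comment> \<open>Nested discs: this bound needs room 1 / 16 inside the unit disc, and the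
      gradient bound needs room \<epsilon> / 64 between the radii 7 / 8 and 29 / 32.\<close>
    have uM: "norm (u y) \<le> M" if y: "y \<in> ball 0 (29 / 32)" for y
    proof -
      have sub: "cball y (2 * (1 / 32)) \<subseteq> ball 0 1" by (rule cball_subset_ball_0) (use y in simp)
      have sub': "cball y (1 / 32) \<subseteq> ball 0 1" by (rule cball_subset_ball_0) (use y in simp)
      have "integral (cball y (1 / 32)) S.w \<le> integral (cball y (1 / 32)) S.A"
        by (intro integral_le integrable_on_compact continuous_on_subset[OF S.w_cont sub'] continuous_on_subset[OF S.A_cont sub'] S.w_le_A) auto
      also have "\<dots> \<le> 1 * \<epsilon>" by (rule S.integral_A_le[OF sub' E]) simp
      finally have I: "integral (cball y (1 / 32)) S.w \<le> 1" using \<epsilon> by simp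
      have "bump_mass * ((norm (u y))\<^sup>2 - R\<^sup>2 - 2) \<le> \<beta> * integral (cball y (1 / 32)) S.w / (1 / 32)\<^sup>2"
        by (rule S.sup_bound[OF sub _ R]) simp
      also have "\<dots> \<le> \<beta> * 1 / (1 / 32)\<^sup>2" using I R by (intro divide_right_mono mult_left_mono) auto
      also have "\<dots> = 1024 * \<beta>" by (simp add: power2_eq_square)
      finally have "(norm (u y))\<^sup>2 - R\<^sup>2 - 2 \<le> 1024 * \<beta> / bump_mass"
        using b by (simp add: pos_le_divide_eq mult.commute)
      then have "(norm (u y))\<^sup>2 \<le> M\<^sup>2" unfolding Msq by simp
      then show ?thesis using M by (rule power2_le_imp_le)
    qed
    interpret T: solution V \<epsilon> u "ball 0 (29 / 32)" by (rule S.solution_subset) auto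
    define r where "r = \<epsilon> / 128"
    have r: "r > 0" "r\<^sup>2 = \<epsilon>\<^sup>2 / 16384" using S.eps_pos by (simp_all add: r_def power_divide)
    have sub: "cball x (2 * r) \<subseteq> ball 0 (29 / 32)"
      by (rule cball_subset_ball_0) (use x \<epsilon> in \<open>simp add: r_def\<close>)
    have "bump_mass * (\<epsilon>\<^sup>2 * S.a x / 2) \<le> 2 * pi * \<epsilon>\<^sup>2 / r\<^sup>2 * (22 * M\<^sup>2 + 5 * M * G * r\<^sup>2 / \<epsilon>\<^sup>2)
      + L * M\<^sup>2 * pi / 2 + pi * (L * M * G / \<epsilon>\<^sup>2) * r\<^sup>2"
      by (rule T.gradient_bound[OF sub r(1) M uM G(1) _ less_imp_le[OF L(1)]]) (use uM G L in auto)
    also have "\<dots> = D" using S.eps_pos unfolding D_def r(2) by simp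
    finally have "\<epsilon>\<^sup>2 * S.a x \<le> C" using b by (simp add: C_def pos_le_divide_eq mult.commute)
    then show ?thesis using uM[of x] x by simp
  qed
  show thesis by (rule that[OF M C main])
qed

theorem theorem4:
  fixes V :: "real ^ 'k \<Rightarrow> real" and \<mu>\<^sub>0 :: real
  assumes "multi_well_potential V"
    and "admissible_radius V \<mu>\<^sub>0"
  shows "\<exists>\<eta>\<^sub>0 C\<^sub>n\<^sub>r\<^sub>g :: real. \<eta>\<^sub>0 > 0 \<and> C\<^sub>n\<^sub>r\<^sub>g > 0 \<and>
    (\<forall>\<epsilon> :: real. \<forall>u :: real ^ 2 \<Rightarrow> real ^ 'k.
       0 < \<epsilon> \<longrightarrow> \<epsilon> \<le> 1 \<longrightarrow> is_solution V \<epsilon> (ball 0 1) u \<longrightarrow>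
       energy V \<epsilon> u (ball 0 1) \<le> ennreal \<eta>\<^sub>0 \<longrightarrow>
       (\<exists>\<sigma>\<in>wells V. \<forall>x\<in>ball 0 (3 / 4). norm (u x - \<sigma>) \<le> \<mu>\<^sub>0 / 2) \<and>
       energy V \<epsilon> u (ball 0 (5 / 8)) \<le> ennreal (C\<^sub>n\<^sub>r\<^sub>g * \<epsilon>) * energy V \<epsilon> u (ball 0 1))"
proof -
  note V = assms(1) and nn = multi_well_potential_nonneg[OF assms(1)]
  have sm: "smooth_on UNIV V" using V by (simp add: multi_well_potential_def)
  have \<mu>: "\<mu>\<^sub>0 / 2 > 0" and disj: "disjoint_family_on (\<lambda>\<sigma>. ball \<sigma> (\<mu>\<^sub>0 / 2)) (wells V)"
  proof -
    show m: "\<mu>\<^sub>0 / 2 > 0" using assms(2) by (simp add: admissible_radius_def)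
    have "ball \<sigma> (\<mu>\<^sub>0 / 2) \<subseteq> ball \<sigma> (2 * \<mu>\<^sub>0)" for \<sigma> :: "real ^ 'k" using m by (intro subset_ball) simp
    then show "disjoint_family_on (\<lambda>\<sigma>. ball \<sigma> (\<mu>\<^sub>0 / 2)) (wells V)"
      using assms(2) unfolding admissible_radius_def disjoint_family_on_def by blast
  qed
  \<comment> \<open>With the radius \<open>\<mu>\<^sub>0 / 2\<close> fed in here, V(u) < v0 already
    gives the claimed distance to some well.\<close>
  obtain v0 \<kappa> where v0: "v0 > 0" and \<kappa>: "\<kappa> > 0"
    and near: "\<And>y. V y < v0 \<Longrightarrow> \<exists>\<sigma>\<in>wells V. y \<in> ball \<sigma> (\<mu>\<^sub>0 / 2)"
    and hess: "\<And>y h. V y < v0 \<Longrightarrow> \<kappa> * (norm h)\<^sup>2 \<le> hess_apply V y h \<bullet> h"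
    and coer: "\<And>y. V y < v0 \<Longrightarrow> \<kappa> * V y \<le> (norm (grad V y))\<^sup>2"
    using potential_near_wells[OF V \<mu>] by metis
  obtain M C where M: "M \<ge> 0" and C: "C \<ge> 0"
    and bounds: "\<And>\<epsilon> u x. solution V \<epsilon> u (ball 0 1) \<Longrightarrow> \<epsilon> \<le> 1 \<Longrightarrow> energy V \<epsilon> u (ball 0 1) \<le> ennreal 1 \<Longrightarrow>
       x \<in> ball 0 (7 / 8) \<Longrightarrow> norm (u x) \<le> M \<and> \<epsilon>\<^sup>2 * solution.a u x \<le> C"
    using uniform_solution_bounds[OF V] by blast
  obtain K where K: "K > 0" "\<And>y. norm y \<le> M \<Longrightarrow> (norm (grad V y))\<^sup>2 \<le> K * V y"
    using grad_sq_le_potential[OF sm nn, of M] by metis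
  have "bounded (grad V ` cball 0 M)"
    by (intro compact_imp_bounded compact_continuous_image continuous_on_grad[OF sm]) auto
  then obtain G' where G': "\<And>y. norm y \<le> M \<Longrightarrow> norm (grad V y) \<le> G'"
    unfolding bounded_iff by force
  define G where "G = max 0 G'"
  have G: "G \<ge> 0" "\<And>y. norm y \<le> M \<Longrightarrow> norm (grad V y) \<le> G" using G' by (force simp: G_def)+
  define c0 where "c0 = 8 * K * C / (v0 * \<kappa>) + 1 + C / v0"
  have c0: "c0 > 0" unfolding c0_def using K C v0 \<kappa> by (intro add_pos_nonneg add_nonneg_pos) auto
  \<comment> \<open>The decay factor of one step from r to r / 16 is a1 / L + a2 \<epsilon> / r. The
    choices of \<open>L\<close> and \<open>d\<close> make each summand at most 1 / 32, which adds up
    to 1 / 16.\<close>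
  define a1 where "a1 = 64 / 27 * (c0 * (569 / \<kappa> * (4 * K)))"
  define a2 where "a2 = 64 / 27 * (c0 * (569 / \<kappa> * (6 * sqrt K)) + 192 * sqrt K / \<kappa>)"
  have a: "a1 > 0" "a2 > 0" using c0 \<kappa> K by (simp_all add: a1_def a2_def add_pos_pos)
  define L where "L = max (2 * ln 2) (32 * a1)"
  have L: "2 * ln 2 \<le> L" "32 * a1 \<le> L" "L > 0" using a by (auto simp: L_def)
  define d where "d = min 1 (1 / (32 * a2))"
  have d: "0 < d" "d \<le> 1" "a2 * d \<le> 1 / 32"
  proof -
    show "0 < d" "d \<le> 1" using a by (auto simp: d_def)
    have "a2 * d \<le> a2 * (1 / (32 * a2))" using a by (intro mult_left_mono) (auto simp: d_def)
    then show "a2 * d \<le> 1 / 32" using a by simp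
  qed
  \<comment> \<open>The solution of ln v0 - ln k = L.\<close>
  define k where "k = v0 * exp (- L)"
  have k: "0 < k" "k < v0" "L = ln v0 - ln k" using v0 L by (auto simp: k_def ln_mult)
  \<comment> \<open>Small enough for the Lipschitz bound on V(u); the summand 1 keeps the
    denominator positive when \<open>G\<close> or \<open>C\<close> is zero.\<close>
  define s where "s = min (1 / 16) (v0 / (2 * (2 * G * sqrt C + 1)))"
  have den: "2 * G * sqrt C + 1 > 0" using G C by (simp add: add_nonneg_pos)
  have s: "0 < s" "s \<le> 1 / 16" "2 * G * sqrt C * s \<le> v0 / 2"
  proof -
    have s0: "0 < s" using v0 den by (simp add: s_def)
    then show "0 < s" .
    show "s \<le> 1 / 16" unfolding s_def by (rule min.cobounded1)
    have "2 * G * sqrt C * s \<le> (2 * G * sqrt C + 1) * s" using s0 by (intro mult_right_mono) auto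
    also have "\<dots> \<le> (2 * G * sqrt C + 1) * (v0 / (2 * (2 * G * sqrt C + 1)))"
      using den by (intro mult_left_mono) (auto simp: s_def)
    also have "\<dots> = v0 / 2" using den by (simp add: field_simps)
    finally show "2 * G * sqrt C * s \<le> v0 / 2" .
  qed
  \<comment> \<open>The first bound keeps V(u) below \<open>k\<close> along the lines used by the
    cutoffs. The second leaves too little energy at scale \<epsilon> for a value v0 of V(u); v0 / 4
    in place of v0 / 2 provides strictness.\<close>
  define \<eta> where "\<eta> = min (k / (24 * (2 + sqrt K))) (d * (v0 / 4 * pi * s\<^sup>2))"
  have \<eta>: "\<eta> > 0" "\<eta> \<le> k / (24 * (2 + sqrt K))" "\<eta> \<le> d * (v0 / 4 * pi * s\<^sup>2)"
  proof -
    show "\<eta> > 0" using k K d v0 s by (simp add: \<eta>_def add_pos_nonneg)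
  qed (unfold \<eta>_def, rule min.cobounded1, rule min.cobounded2)
  have \<eta>d: "\<eta> / d < v0 / 2 * pi * s\<^sup>2"
  proof -
    have "\<eta> / d \<le> v0 / 4 * pi * s\<^sup>2" using \<eta>(3) d by (simp add: pos_divide_le_eq mult.commute)
    also have "\<dots> < v0 / 2 * pi * s\<^sup>2" using v0 s by simp
    finally show ?thesis .
  qed
  \<comment> \<open>1 is the energy level for which \<open>M\<close> and \<open>C\<close> are valid,
    and the divisor 16 reflects the starting radius 1 / 16 in I(r) <= \<eta> \<epsilon> r.\<close>
  define \<eta>0 where "\<eta>0 = min 1 (\<eta> / 16)"
  have \<eta>0: "\<eta>0 > 0" "\<eta>0 \<le> 1" "\<eta>0 \<le> \<eta> / 16" using \<eta> by (auto simp: \<eta>0_def)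
  \<comment> \<open>The constant of the improvement from radius 3 / 4 to radius 5 / 8.\<close>
  define Cn where "Cn = 6 * sqrt K / (\<kappa> * ((3 / 4)\<^sup>2 - (5 / 8)\<^sup>2) ^ 3)"
  have Cn: "Cn > 0" using K \<kappa> by (simp add: Cn_def power2_eq_square)
  have main: "(\<exists>\<sigma>\<in>wells V. \<forall>x\<in>ball 0 (3 / 4). norm (u x - \<sigma>) \<le> \<mu>\<^sub>0 / 2) \<and>
       energy V \<epsilon> u (ball 0 (5 / 8)) \<le> ennreal (Cn * \<epsilon>) * energy V \<epsilon> u (ball 0 1)"
    if \<epsilon>: "0 < \<epsilon>" "\<epsilon> \<le> 1" and sol: "is_solution V \<epsilon> (ball 0 1) u" and E: "energy V \<epsilon> u (ball 0 1) \<le> ennreal \<eta>0" for \<epsilon> u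
  proof -
    interpret S: solution V \<epsilon> u "ball 0 1"
      by standard (use sm nn \<epsilon> sol in auto)
    interpret T: solution V \<epsilon> u "ball 0 (7 / 8)" by (rule S.solution_subset) auto
    have E1: "energy V \<epsilon> u (ball 0 1) \<le> ennreal 1"
      using E \<eta>0(2) by (meson ennreal_leI order_trans)
    note bd = bounds[OF S.solution_axioms \<epsilon>(2) E1]
    have gK: "(norm (grad V (u x)))\<^sup>2 \<le> K * S.w x" if "x \<in> ball 0 (7 / 8)" for x
      using K(2) bd[OF that] by (simp add: S.w_def)
    have gG: "norm (grad V (u x)) \<le> G" if "x \<in> ball 0 (7 / 8)" for x
      using G(2) bd[OF that] by simp
    have aC: "\<epsilon>\<^sup>2 * S.a x \<le> C" if "x \<in> ball 0 (7 / 8)" for x using bd[OF that] by simp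
    have convex: "\<kappa> * (norm \<xi>)\<^sup>2 \<le> hess_apply V (u x) \<xi> \<bullet> \<xi>" if "S.w x < v0" for x \<xi>
      using hess that by (simp add: S.w_def)
    have coercive: "\<kappa> * S.w x \<le> (norm (grad V (u x)))\<^sup>2" if "S.w x < v0" for x
      using coer that by (simp add: S.w_def)
    \<comment> \<open>Since 3 / 4 + 1 / 16 < 7 / 8, every disc of the descent lies where
      \<open>M\<close> and \<open>C\<close> bound the solution. The centres range over the closed
      disc because the energy improvement is applied on it.\<close>
    have small: "S.w x0 < v0" if x0: "x0 \<in> cball 0 (3 / 4)" for x0
    proof -
      have sub: "cball x0 r \<subseteq> ball 0 (7 / 8)" if "r \<le> 1 / 16" for r
        by (rule cball_subset_ball_0) (use x0 that in simp)
      have sub1: "cball x0 (1 / 16) \<subseteq> ball 0 1"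
        by (rule cball_subset_ball_0) (use x0 in simp)
      define I where "I r = integral (cball x0 r) S.A" for r
      have "I (\<epsilon> / 16) \<le> \<eta> / d * \<epsilon>\<^sup>2"
      proof (rule scale_iteration[OF _ \<epsilon> d(1,2) \<eta>(1)])
        show "I s \<le> I r" if "0 < s" "s \<le> r" "r \<le> 1 / 16" for s r
          unfolding I_def by (rule T.integral_A_mono[OF that(2) sub[OF that(3)]])
        have "I (1 / 16) \<le> \<eta>0 * \<epsilon>" unfolding I_def
          by (rule S.integral_A_le[OF sub1 E]) (use \<eta>0 in simp)
        also have "\<dots> \<le> \<eta> / 16 * \<epsilon>" using \<eta>0 \<epsilon> by (intro mult_right_mono) auto
        finally show "I (1 / 16) \<le> \<eta> * \<epsilon> * (1 / 16)" by simp
      next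
        fix r assume r: "0 < r" "r \<le> 1 / 16" "\<epsilon> \<le> d * r" "I r \<le> \<eta> * \<epsilon> * r"
        have "d * r \<le> 1 * r" using d r by (intro mult_right_mono) auto
        then have er: "\<epsilon> \<le> r" using r(3) by linarith
        have t: "\<epsilon> / r \<le> d" using r by (simp add: pos_divide_le_eq)
        have "\<eta> * (\<epsilon> * r) \<le> k / (24 * (2 + sqrt K)) * (\<epsilon> * r)"
          using \<eta> \<epsilon> r by (intro mult_right_mono) auto
        then have sm: "integral (cball x0 r) T.A \<le> k * \<epsilon> * r / (24 * (2 + sqrt K))"
          using r(4) by (simp add: I_def mult_ac)
        have I_nn: "0 \<le> I r"
          unfolding I_def
          by (intro Henstock_Kurzweil_Integration.integral_nonneg integrable_on_compact compact_cball
              continuous_on_subset[OF T.A_cont sub] S.A_nonneg) (use r in auto)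
        have "I (r / 16) \<le> 64 / 27 * (c0 * (569 / \<kappa> * (4 * K / L + 6 * sqrt K * (\<epsilon> / r)))
            + 192 * sqrt K / \<kappa> * (\<epsilon> / r)) * I r"
          unfolding I_def c0_def
          by (rule T.energy_decay[OF sub[OF r(2)] r(1) K(1) \<kappa> k(1,2) gK convex coercive aC C k(3) L(1) er sm])
        also have "64 / 27 * (c0 * (569 / \<kappa> * (4 * K / L + 6 * sqrt K * (\<epsilon> / r))) + 192 * sqrt K / \<kappa> * (\<epsilon> / r))
            = a1 / L + a2 * (\<epsilon> / r)"
          unfolding a1_def a2_def by (simp only: distrib_left distrib_right times_divide_eq_right times_divide_eq_left mult.assoc add.assoc add_divide_distrib)
        also have "(a1 / L + a2 * (\<epsilon> / r)) * I r \<le> (1 / 32 + 1 / 32) * I r"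
        proof (intro mult_right_mono add_mono I_nn)
          show "a1 / L \<le> 1 / 32" using L by (simp add: divide_le_eq)
          have "a2 * (\<epsilon> / r) \<le> a2 * d" using t a by (intro mult_left_mono) auto
          then show "a2 * (\<epsilon> / r) \<le> 1 / 32" using d(3) by linarith
        qed
        finally show "I (r / 16) \<le> I r / 16" by simp
      qed
      then have I0: "integral (cball x0 (\<epsilon> / 16)) T.A \<le> \<eta> / d * \<epsilon>\<^sup>2" by (simp add: I_def)
      show ?thesis
        by (rule T.potential_less[OF sub[OF order_refl] \<epsilon>(2) G(1) gG aC C I0 s \<eta>d])
    qed
    have "\<exists>\<sigma>\<in>wells V. \<forall>x\<in>ball 0 (3 / 4). u x \<in> ball \<sigma> (\<mu>\<^sub>0 / 2)"
    proof (rule connected_image_in_one_ball[OF _ _ _ disj])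
      show "continuous_on (ball 0 (3 / 4)) u"
        by (rule continuous_on_subset[OF S.u_cont]) auto
      show "\<exists>\<sigma>\<in>wells V. u x \<in> ball \<sigma> (\<mu>\<^sub>0 / 2)" if "x \<in> ball 0 (3 / 4)" for x
        using near small[of x] that by (simp add: S.w_def)
    qed auto
    then obtain \<sigma> where \<sigma>: "\<sigma> \<in> wells V" "\<And>x. x \<in> ball 0 (3 / 4) \<Longrightarrow> u x \<in> ball \<sigma> (\<mu>\<^sub>0 / 2)" by blast
    have 1: "\<exists>\<sigma>\<in>wells V. \<forall>x\<in>ball 0 (3 / 4). norm (u x - \<sigma>) \<le> \<mu>\<^sub>0 / 2"
    proof (intro bexI[OF _ \<sigma>(1)] ballI)
      fix x :: "real ^ 2" assume "x \<in> ball 0 (3 / 4)"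
      from \<sigma>(2)[OF this] show "norm (u x - \<sigma>) \<le> \<mu>\<^sub>0 / 2"
        by (simp add: dist_norm norm_minus_commute)
    qed
    have sub34: "cball 0 (3 / 4) \<subseteq> ball (0 :: real ^ 2) (7 / 8)" by auto
    have sub34': "cball 0 (3 / 4) \<subseteq> ball (0 :: real ^ 2) 1" "cball 0 (5 / 8) \<subseteq> ball (0 :: real ^ 2) 1" by auto
    have "integral (cball 0 (5 / 8)) T.A \<le> Cn * \<epsilon> * integral (cball 0 (3 / 4)) T.A"
      unfolding Cn_def
      by (rule T.energy_improvement[OF sub34 _ _ _ _ K(1) \<kappa>]) (use gK convex coercive small sub34 in auto)
    then have "integral (cball 0 (5 / 8)) S.A / \<epsilon> \<le> Cn * \<epsilon> * integral (cball 0 (3 / 4)) S.A / \<epsilon>"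
      using \<epsilon> by (intro divide_right_mono) auto
    then have "ennreal (integral (cball 0 (5 / 8)) S.A / \<epsilon>) \<le> ennreal ((Cn * \<epsilon>) * (integral (cball 0 (3 / 4)) S.A / \<epsilon>))"
      by (intro ennreal_leI) simp
    also have "\<dots> = ennreal (Cn * \<epsilon>) * ennreal (integral (cball 0 (3 / 4)) S.A / \<epsilon>)"
      using Cn \<epsilon> by (intro ennreal_mult') simp
    finally have "energy V \<epsilon> u (cball 0 (5 / 8)) \<le> ennreal (Cn * \<epsilon>) * energy V \<epsilon> u (cball 0 (3 / 4))"
      by (simp only: S.energy_cball[OF sub34'(1)] S.energy_cball[OF sub34'(2)])
    also have "\<dots> \<le> ennreal (Cn * \<epsilon>) * energy V \<epsilon> u (ball 0 1)"
      by (intro mult_left_mono S.energy_mono sub34') simp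
    finally have "energy V \<epsilon> u (ball 0 (5 / 8)) \<le> ennreal (Cn * \<epsilon>) * energy V \<epsilon> u (ball 0 1)"
      using S.energy_mono[OF ball_subset_cball] order_trans by blast
    with 1 show ?thesis by blast
  qed
  show ?thesis
    by (rule exI[of _ \<eta>0], rule exI[of _ Cn]) (use \<eta>0(1) Cn main in blast)
qed

end
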